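(* For each $\nu\in\Lambda_G$ (viewed as an element of $\mathfrak a_G$), the set $$X_\nu=\{c\in\mathbb{A}(F)_\nu:\ \exists\,a\in A(\overline F)\text{ with } c=c(a)\text{ and }\mathrm{val}\,\Omega(a)=m_\nu\}$$ is non-empty, and for any $a\in A(\overline F)$ with $c(a)\in X_\nu$, any element $h\in W$ with $\sigma(a)=h(a)$ is conjugate in $W$ to $\psi_G(\nu)$.
   Context: Let $G$ be a connected reductive group over $\mathbb{C}$ of rank $n$ whose derived group $G_{sc}$ is simply connected, of rank $l$. Fix a maximal torus $A$ and a Borel subgroup $B\supseteq A$; $A_{sc}=A\cap G_{sc}$. $R\subset X^*(A)$ are the roots, $\{\alpha_i\}_{i\in I}$, $I=\{1,\dots,l\}$, the simple roots for $B$; $Q(R),Q(R^\vee)$ root and coroot lattices, $P(R),P(R^\vee)$ the dual lattices (so $X_*(A_{sc})=Q(R^\vee)$), $\varpi_i$ the fundamental weights. Choose a $\mathbb{Z}$-basis $\omega_1,\dots,\omega_n$ of $X^*(A)$ with $\omega_i|_{A_{sc}}=\varpi_i$ for $i\le l$ and $\omega_{l+1},\dots,\omega_n$ a basis of the kernel of restriction. $W$ is the Weyl group, $c_i=\sum_{\lambda\in W\omega_i}e^\lambda$, $\mathbb{A}=\mathbb{G}_a^l\times\mathbb{G}_m^{n-l}$, $c=(c_1,\dots,c_n):A\to\mathbb{A}$. $\Omega=\prod_{\alpha\in R}(1-e^\alpha)$, $m_\nu=\sum_{\alpha\in R}\max\{0,\langle\alpha,\nu\rangle\}$ (which is $0$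 for $\nu\in\Lambda_G$). $F=\mathbb{C}((\epsilon))$, $\overline F=\bigcup_n\mathbb{C}((\epsilon^{1/n}))$ with compatible roots, $\sigma$ the Galois generator with $\sigma(\epsilon^{1/n})=e^{2\pi\sqrt{-1}/n}\epsilon^{1/n}$, $\mathrm{val}$ the valuation with $\mathrm{val}(\epsilon^{1/n})=-1/n$. $\mathfrak a=X_*(A)\otimes\mathbb{R}$; $A_G$ is the identity component of the center of $G$, $\mathfrak a_G=X_*(A_G)\otimes\mathbb{R}=\mathfrak a^W$, $p_G:\mathfrak a\to\mathfrak a_G$ the $W$-average, and $\Lambda_G=X_*(A)/X_*(A_{sc})$, identified with $p_G(X_*(A))\subset\mathfrak a_G$. For $\nu\in\Lambda_G$, $\mathbb{A}(F)_\nu$ is the set of $c\in\mathbb{A}(\overline F)$ for which there is $a\in A(\overline F)$ with $c=c(a)$, $\sigma(a)=g(a)$ for some $g\in W$, and $\langle\lambda,\nu\rangle=\mathrm{val}\,\lambda(a)$ for all $\lambda\in X^*(A)$. $\psi$: for a reduced irreducible root system $R$ with basis $\{\alpha_i\}$, highest root $\tilde\alpha$, let $W_e=P(R^\vee)\rtimes W$ act on $V^*$ ($V=Q(R)\otimes\mathbb{R}$), $P(R^\vee)$ by translations; $C=\{v:\langle\alpha_i,v\rangle>0\ \forall i,\ \langle\tilde\alpha,v\rangle<1\}$; the stabilizer $\Gamma_C$ of $C$ in $W_e$ maps isomorphically ($\xi$) onto $W_e/(Q(R^\vee)\rtimes W)\cong P(R^\vee)/Q(R^\vee)$, and $\psi=\mathrm{pr}\circ\xi^{-1}$,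 $\mathrm{pr}:W_e\to W$; for reducible $R$ take the product over components. $\psi_G$ is the composite of $\Lambda_G\to P(R^\vee)/Q(R^\vee)$ (induced by $\lambda\mapsto\langle\cdot,\lambda\rangle|_{Q(R)}$, i.e. $\Lambda_G\twoheadrightarrow\Lambda_G/X_*(A_G)\hookrightarrow P(R^\vee)/Q(R^\vee)$) with $\psi$. *)

theory Defs
  imports Complex_Main "HOL-Computational_Algebra.Formal_Laurent_Series"
begin

(* Lattices: X^*(A) = X_*(A) = Z^n, elements are functions nat => int supported on {0..<n}. *)
type_synonym lat = "nat \<Rightarrow> int"
type_synonym rvec = "nat \<Rightarrow> real"

definition isvec :: "nat \<Rightarrow> (nat \<Rightarrow> 'a::zero) \<Rightarrow> bool" where
  "isvec n x \<longleftrightarrow> (\<forall>i\<ge>n. x i = 0)"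

definition pair :: "nat \<Rightarrow> lat \<Rightarrow> lat \<Rightarrow> int" where
  "pair n x y = (\<Sum>i<n. x i * y i)"

definition rpair :: "nat \<Rightarrow> lat \<Rightarrow> rvec \<Rightarrow> real" where
  "rpair n x v = (\<Sum>i<n. real_of_int (x i) * v i)"

definition unitv :: "nat \<Rightarrow> lat" where
  "unitv i = (\<lambda>j. if j = i then 1 else 0)"

definition refl :: "nat \<Rightarrow> (lat \<Rightarrow> lat) \<Rightarrow> lat \<Rightarrow> lat \<Rightarrow> lat" where
  "refl n cor \<alpha> x = (\<lambda>j. x j - pair n x (cor \<alpha>) * \<alpha> j)"

definition corefl :: "nat \<Rightarrow> (lat \<Rightarrow> lat) \<Rightarrow> lat \<Rightarrow> lat \<Rightarrow> lat" where
  "corefl n cor \<alpha> y = (\<lambda>j. y j - pair n \<alpha> y * cor \<alpha> j)"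

definition root_datum_with_base ::
  "nat \<Rightarrow> nat \<Rightarrow> lat set \<Rightarrow> (lat \<Rightarrow> lat) \<Rightarrow> (nat \<Rightarrow> lat) \<Rightarrow> bool" where
  "root_datum_with_base n l R cor simple \<longleftrightarrow>
     finite R \<and> (\<forall>\<alpha>\<in>R. isvec n \<alpha> \<and> isvec n (cor \<alpha>)) \<and> inj_on cor R \<and>
     (\<forall>\<alpha>\<in>R. pair n \<alpha> (cor \<alpha>) = 2) \<and>
     (\<forall>\<alpha>\<in>R. refl n cor \<alpha> ` R = R) \<and>
     (\<forall>\<alpha>\<in>R. corefl n cor \<alpha> ` (cor ` R) = cor ` R) \<and>
     (\<forall>\<alpha>\<in>R. (\<lambda>j. 2 * \<alpha> j) \<notin> R) \<and>
     (\<forall>i<l. simple i \<in> R) \<and>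
     (\<forall>c::nat \<Rightarrow> int. (\<lambda>j. \<Sum>i<l. c i * simple i j) = (\<lambda>j. 0) \<longrightarrow> (\<forall>i<l. c i = 0)) \<and>
     (\<forall>\<alpha>\<in>R. \<exists>c::nat \<Rightarrow> int. \<alpha> = (\<lambda>j. \<Sum>i<l. c i * simple i j) \<and>
         ((\<forall>i<l. c i \<ge> 0) \<or> (\<forall>i<l. c i \<le> 0)))"

definition pos_roots :: "nat \<Rightarrow> lat set \<Rightarrow> (nat \<Rightarrow> lat) \<Rightarrow> lat set" where
  "pos_roots l R simple = {\<alpha>\<in>R. \<exists>c::nat \<Rightarrow> int. (\<forall>i<l. c i \<ge> 0) \<and>
       \<alpha> = (\<lambda>j. \<Sum>i<l. c i * simple i j)}"

(* omega_0..omega_{n-1}: Z-basis of X^*(A) (it has an integral dual basis), with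
   omega_i restricting to the fundamental weights for i<l and to 0 on A_sc for i>=l *)
definition adapted_basis ::
  "nat \<Rightarrow> nat \<Rightarrow> (lat \<Rightarrow> lat) \<Rightarrow> (nat \<Rightarrow> lat) \<Rightarrow> (nat \<Rightarrow> lat) \<Rightarrow> bool" where
  "adapted_basis n l cor simple \<omega> \<longleftrightarrow>
     (\<forall>i<n. isvec n (\<omega> i)) \<and>
     (\<exists>y::nat \<Rightarrow> lat. (\<forall>j<n. isvec n (y j)) \<and>
         (\<forall>i<n. \<forall>j<n. pair n (\<omega> i) (y j) = (if i = j then 1 else 0))) \<and>
     (\<forall>i<n. \<forall>j<l. pair n (\<omega> i) (cor (simple j)) = (if i = j then 1 else 0))"

(* Weyl group W, acting on cocharacters X_*(A) = Z^n *)
inductive_set weyl :: "nat \<Rightarrow> lat set \<Rightarrow> (lat \<Rightarrow> lat) \<Rightarrow> (lat \<Rightarrow> lat) set"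
  for n R cor where
  weyl_id: "id \<in> weyl n R cor"
| weyl_step: "w \<in> weyl n R cor \<Longrightarrow> \<alpha> \<in> R \<Longrightarrow> corefl n cor \<alpha> \<circ> w \<in> weyl n R cor"

definition wconj :: "nat \<Rightarrow> lat set \<Rightarrow> (lat \<Rightarrow> lat) \<Rightarrow> (lat \<Rightarrow> lat) \<Rightarrow> (lat \<Rightarrow> lat) \<Rightarrow> bool" where
  "wconj n R cor h g \<longleftrightarrow> (\<exists>w\<in>weyl n R cor. h \<circ> w = w \<circ> g)"

(* real extension of w to a = X_*(A) tensor R *)
definition wR :: "nat \<Rightarrow> (lat \<Rightarrow> lat) \<Rightarrow> rvec \<Rightarrow> rvec" where
  "wR n w v = (\<lambda>j. \<Sum>i<n. v i * real_of_int (w (unitv i) j))"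

definition pG :: "nat \<Rightarrow> lat set \<Rightarrow> (lat \<Rightarrow> lat) \<Rightarrow> rvec \<Rightarrow> rvec" where
  "pG n R cor v = (\<lambda>j. (\<Sum>w\<in>weyl n R cor. wR n w v j) / real (card (weyl n R cor)))"

definition m_nu :: "nat \<Rightarrow> lat set \<Rightarrow> rvec \<Rightarrow> real" where
  "m_nu n R \<nu> = (\<Sum>\<alpha>\<in>R. max 0 (rpair n \<alpha> \<nu>))"

(* fundamental alcove (product over irreducible components), pulled back to a *)
definition alcove :: "nat \<Rightarrow> nat \<Rightarrow> lat set \<Rightarrow> (nat \<Rightarrow> lat) \<Rightarrow> rvec set" where
  "alcove n l R simple = {v. isvec n v \<and>
      (\<forall>\<alpha>\<in>pos_roots l R simple. 0 < rpair n \<alpha> v \<and> rpair n \<alpha> v < 1)}"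

definition corootlat :: "nat \<Rightarrow> lat set \<Rightarrow> (lat \<Rightarrow> lat) \<Rightarrow> lat set" where
  "corootlat n R cor = {q. \<exists>c::lat \<Rightarrow> int. q = (\<lambda>j. \<Sum>\<alpha>\<in>R. c \<alpha> * cor \<alpha> j)}"

(* psi_G of the class of the cocharacter lam: the Weyl part of the element of
   Gamma_C in P(R^vee) x| W lying over the class of <.,lam>|_{Q(R)} mod Q(R^vee) *)
definition psiG :: "nat \<Rightarrow> nat \<Rightarrow> lat set \<Rightarrow> (lat \<Rightarrow> lat) \<Rightarrow> (nat \<Rightarrow> lat) \<Rightarrow> lat \<Rightarrow> (lat \<Rightarrow> lat)" where
  "psiG n l R cor simple lam = (THE w. w \<in> weyl n R cor \<and>
      (\<exists>q\<in>corootlat n R cor.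
         (\<lambda>v. (\<lambda>j. wR n w v j + real_of_int (lam j + q j))) ` alcove n l R simple
           = alcove n l R simple))"

(* Puiseux series: a point of A(Fbar) (resp. of the n-dim affine-type space) is represented
   with a common denominator N > 0 as a tuple of Laurent series in t = eps^(1/N). *)
type_synonym pt = "nat \<times> (nat \<Rightarrow> complex fls)"

(* f(t) |-> f(t^M) : passage from eps^(1/N) to eps^(1/(N M)) *)
definition refine :: "nat \<Rightarrow> complex fls \<Rightarrow> complex fls" where
  "refine M f = Abs_fls (\<lambda>k. if int M dvd k then fls_nth f (k div int M) else 0)"

definition pt_eq :: "nat \<Rightarrow> pt \<Rightarrow> pt \<Rightarrow> bool" where
  "pt_eq n p p' \<longleftrightarrow> (\<forall>i<n. refine (fst p') (snd p i) = refine (fst p) (snd p' i))"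

(* Galois generator: eps^(1/N) |-> exp(2 pi i/N) eps^(1/N) *)
definition gal :: "nat \<Rightarrow> complex fls \<Rightarrow> complex fls" where
  "gal N f = Abs_fls (\<lambda>k. exp (2 * pi * \<i> / of_nat N) powi k * fls_nth f k)"

(* val(eps^(1/N)) = -1/N, only for nonzero elements *)
definition has_val :: "nat \<Rightarrow> complex fls \<Rightarrow> real \<Rightarrow> bool" where
  "has_val N f r \<longleftrightarrow> f \<noteq> 0 \<and> - real_of_int (fls_subdegree f) / real N = r"

definition is_torus_pt :: "nat \<Rightarrow> pt \<Rightarrow> bool" where
  "is_torus_pt n p \<longleftrightarrow> fst p > 0 \<and> (\<forall>i<n. snd p i \<noteq> 0)"

definition charval :: "nat \<Rightarrow> lat \<Rightarrow> (nat \<Rightarrow> complex fls) \<Rightarrow> complex fls" where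
  "charval n lm a = (\<Prod>i<n. a i powi lm i)"

definition wact :: "nat \<Rightarrow> (lat \<Rightarrow> lat) \<Rightarrow> (nat \<Rightarrow> complex fls) \<Rightarrow> (nat \<Rightarrow> complex fls)" where
  "wact n w a = (\<lambda>j. \<Prod>i<n. a i powi w (unitv i) j)"

definition sigma_eq_w :: "nat \<Rightarrow> pt \<Rightarrow> (lat \<Rightarrow> lat) \<Rightarrow> bool" where
  "sigma_eq_w n p w \<longleftrightarrow> (\<forall>j<n. gal (fst p) (snd p j) = wact n w (snd p) j)"

definition worbit :: "nat \<Rightarrow> lat set \<Rightarrow> (lat \<Rightarrow> lat) \<Rightarrow> lat \<Rightarrow> lat set" where
  "worbit n R cor \<omega> = {lm. isvec n lm \<and> (\<exists>w\<in>weyl n R cor.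
       \<forall>y. isvec n y \<longrightarrow> pair n lm (w y) = pair n \<omega> y)}"

definition cmap :: "nat \<Rightarrow> lat set \<Rightarrow> (lat \<Rightarrow> lat) \<Rightarrow> (nat \<Rightarrow> lat) \<Rightarrow> pt \<Rightarrow> pt" where
  "cmap n R cor \<omega> p = (fst p, (\<lambda>i. \<Sum>lm\<in>worbit n R cor (\<omega> i). charval n lm (snd p)))"

definition Omega :: "nat \<Rightarrow> lat set \<Rightarrow> (nat \<Rightarrow> complex fls) \<Rightarrow> complex fls" where
  "Omega n R a = (\<Prod>\<alpha>\<in>R. 1 - charval n \<alpha> a)"

definition in_AF_nu :: "nat \<Rightarrow> lat set \<Rightarrow> (lat \<Rightarrow> lat) \<Rightarrow> (nat \<Rightarrow> lat) \<Rightarrow> rvec \<Rightarrow> pt \<Rightarrow> bool" where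
  "in_AF_nu n R cor \<omega> \<nu> c \<longleftrightarrow> fst c > 0 \<and> (\<exists>a. is_torus_pt n a \<and> pt_eq n c (cmap n R cor \<omega> a) \<and>
      (\<exists>g\<in>weyl n R cor. sigma_eq_w n a g) \<and>
      (\<forall>lm. isvec n lm \<longrightarrow> has_val (fst a) (charval n lm (snd a)) (rpair n lm \<nu>)))"

definition in_X_nu :: "nat \<Rightarrow> lat set \<Rightarrow> (lat \<Rightarrow> lat) \<Rightarrow> (nat \<Rightarrow> lat) \<Rightarrow> rvec \<Rightarrow> pt \<Rightarrow> bool" where
  "in_X_nu n R cor \<omega> \<nu> c \<longleftrightarrow> in_AF_nu n R cor \<omega> \<nu> c \<and>
     (\<exists>a. is_torus_pt n a \<and> pt_eq n c (cmap n R cor \<omega> a) \<and>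
        has_val (fst a) (Omega n R (snd a)) (m_nu n R \<nu>))"

end

theory Submission
  imports Defs "Jordan_Normal_Form.Determinant"
begin

text \<open>If \<open>c(a)\<close> lies in the set, then, since orbit sums separate Weyl orbits on the torus, every root
  takes a unit value on \<open>a\<close> with leading coefficient different from 1. Writing the leading coefficients
  of \<open>a\<close> as \<open>exp (2 \<pi> i x)\<close>, the relation \<open>\<sigma>(a) = h(a)\<close> becomes \<open>h x = x - \<nu> + \<mu>\<close> with \<open>\<mu>\<close> an
  integral cocharacter in the class \<open>\<nu>\<close>, and \<open>x\<close> may be taken real and off all affine root
  hyperplanes. Moving \<open>x\<close> into the fundamental alcove by the affine Weyl group conjugates \<open>h\<close> to the
  linear part of the alcove stabilizer element over \<open>- \<nu>\<close>, and \<open>v \<mapsto> - v\<close> identifies this, up to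
  conjugation, with the one over \<open>\<nu>\<close>. Conversely, a point of the alcove fixed by the stabilizer
  element modulo the centre exponentiates to a point of the set.\<close>

subsection \<open>Pairings and reflections\<close>

text \<open>Membership in the set is witnessed by two points with the same \<open>c\<close>: one
  carries the valuations, the other the condition on \<open>Omega\<close>. The \<open>a\<close> of
  the claim is a third point, possibly with another denominator. Since \<nu> and
  \<open>Omega\<close> are \<open>W\<close>-invariant, conjugacy of the three points after refining
  to a common denominator lets both conditions be read off \<open>a\<close>. Orbit separation is
  therefore needed over Laurent series. It rests on two facts: the sums for the \<omega> i determine
  the sums of all orbits, and distinct characters of a group into a field are linearly independent.
  The minus sign in front of \<nu> comes from val(eps^(1/N)) = -1/N: \<sigma> multiplies the leading
  coefficient of an element of value r by exp(-2 pi i r). \<open>R\<close> may be reducible and need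
  not span. So the alcove is cut out by all positive roots at once, its walls are recognised by how
  their reflections permute positive affine roots, and vanishing on all roots implies being zero
  only inside the coroot lattice.\<close>

lemma pair_simps [simp]:
  "pair n (\<lambda>j. f j + g j) y = pair n f y + pair n g y"
  "pair n (\<lambda>j. f j - g j) y = pair n f y - pair n g y"
  "pair n (\<lambda>j. - f j) y = - pair n f y"
  "pair n (\<lambda>j. c * f j) y = c * pair n f y"
  "pair n (\<lambda>j. 0) y = 0"
  "pair n (\<lambda>j. \<Sum>i\<in>A. h i j) y = (\<Sum>i\<in>A. pair n (h i) y)"
  "pair n y (\<lambda>j. f j + g j) = pair n y f + pair n y g"
  "pair n y (\<lambda>j. f j - g j) = pair n y f - pair n y g"
  "pair n y (\<lambda>j. - f j) = - pair n y f"
  "pair n y (\<lambda>j. c * f j) = c * pair n y f"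
  "pair n y (\<lambda>j. 0) = 0"
  "pair n y (\<lambda>j. \<Sum>i\<in>A. h i j) = (\<Sum>i\<in>A. pair n y (h i))"
  unfolding pair_def
  by (auto simp: algebra_simps sum.distrib sum_subtractf sum_negf sum_distrib_left sum_distrib_right intro: sum.swap)

lemma rpair_simps [simp]:
  "rpair n (\<lambda>j. f j + g j) v = rpair n f v + rpair n g v"
  "rpair n (\<lambda>j. f j - g j) v = rpair n f v - rpair n g v"
  "rpair n (\<lambda>j. - f j) v = - rpair n f v"
  "rpair n (\<lambda>j. c * f j) v = of_int c * rpair n f v"
  "rpair n (\<lambda>j. 0) v = 0"
  "rpair n (\<lambda>j. \<Sum>i\<in>A. h i j) v = (\<Sum>i\<in>A. rpair n (h i) v)"
  "rpair n x (\<lambda>j. p j + q j) = rpair n x p + rpair n x q"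
  "rpair n x (\<lambda>j. p j - q j) = rpair n x p - rpair n x q"
  "rpair n x (\<lambda>j. - p j) = - rpair n x p"
  "rpair n x (\<lambda>j. d * p j) = d * rpair n x p"
  "rpair n x (\<lambda>j. p j / d) = rpair n x p / d"
  "rpair n x (\<lambda>j. 0) = 0"
  "rpair n x (\<lambda>j. \<Sum>i\<in>A. k i j) = (\<Sum>i\<in>A. rpair n x (k i))"
  "rpair n x (\<lambda>j. of_int (y j)) = of_int (pair n x y)"
  unfolding rpair_def pair_def
  by (auto simp: algebra_simps sum.distrib sum_subtractf sum_negf sum_distrib_left sum_distrib_right
      sum_divide_distrib intro: sum.swap)

lemma pair_unitv [simp]: "i < n \<Longrightarrow> pair n x (unitv i) = x i"
  unfolding pair_def unitv_def by (simp add: if_distrib[of "(*) _"] sum.delta cong: if_cong)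

lemma rpair_unitv [simp]: "i < n \<Longrightarrow> rpair n (unitv i) v = v i"
  unfolding rpair_def unitv_def
  by (simp add: if_distrib[of real_of_int] if_distrib[of "\<lambda>x. x * _"] sum.delta cong: if_cong)

lemma isvec_unitv [simp]: "i < n \<Longrightarrow> isvec n (unitv i)"
  by (auto simp: isvec_def unitv_def)

lemma isvec_ext: "isvec n x \<Longrightarrow> isvec n y \<Longrightarrow> (\<And>j. j < n \<Longrightarrow> x j = y j) \<Longrightarrow> x = y"
  unfolding isvec_def by (metis ext not_le_imp_less)

lemma pair_cong_right: "(\<And>j. j < n \<Longrightarrow> x j = y j) \<Longrightarrow> pair n a x = pair n a y"
  unfolding pair_def by auto

lemma corefl_simps:
  "corefl n cor \<alpha> (\<lambda>j. f j + g j) = (\<lambda>j. corefl n cor \<alpha> f j + corefl n cor \<alpha> g j)"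
  "corefl n cor \<alpha> (\<lambda>j. f j - g j) = (\<lambda>j. corefl n cor \<alpha> f j - corefl n cor \<alpha> g j)"
  "corefl n cor \<alpha> (\<lambda>j. c * f j) = (\<lambda>j. c * corefl n cor \<alpha> f j)"
  unfolding corefl_def by (auto simp: algebra_simps)

lemma pair_refl: "pair n (refl n cor \<alpha> x) y = pair n x (corefl n cor \<alpha> y)"
  unfolding refl_def corefl_def by simp

section \<open>Root datum axioms, the invariant form and the coroot lattice\<close>

locale based_root_datum =
  fixes n l :: nat and R :: "lat set" and cor :: "lat \<Rightarrow> lat" and simple :: "nat \<Rightarrow> lat"
  assumes root_datum: "root_datum_with_base n l R cor simple"
begin

abbreviation "W \<equiv> weyl n R cor"
abbreviation "s \<equiv> refl n cor"
abbreviation "sc \<equiv> corefl n cor"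

lemma finite_R [simp]: "finite R"
  and isvec_root: "\<alpha> \<in> R \<Longrightarrow> isvec n \<alpha>"
  and isvec_cor: "\<alpha> \<in> R \<Longrightarrow> isvec n (cor \<alpha>)"
  and pair_cor_self [simp]: "\<alpha> \<in> R \<Longrightarrow> pair n \<alpha> (cor \<alpha>) = 2"
  and refl_image: "\<alpha> \<in> R \<Longrightarrow> s \<alpha> ` R = R"
  and corefl_image: "\<alpha> \<in> R \<Longrightarrow> sc \<alpha> ` (cor ` R) = cor ` R"
  and reduced: "\<alpha> \<in> R \<Longrightarrow> (\<lambda>j. 2 * \<alpha> j) \<notin> R"
  and simple_in_R [simp]: "i < l \<Longrightarrow> simple i \<in> R"
  and simple_indep: "(\<lambda>j. \<Sum>i<l. c i * simple i j) = (\<lambda>j. 0) \<Longrightarrow> i < l \<Longrightarrow> (c i :: int) = 0"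
  and root_expand: "\<alpha> \<in> R \<Longrightarrow> \<exists>c::nat \<Rightarrow> int. \<alpha> = (\<lambda>j. \<Sum>i<l. c i * simple i j) \<and>
         ((\<forall>i<l. c i \<ge> 0) \<or> (\<forall>i<l. c i \<le> 0))"
  using root_datum unfolding root_datum_with_base_def by auto

lemma refl_in_R [simp]: "\<alpha> \<in> R \<Longrightarrow> \<beta> \<in> R \<Longrightarrow> s \<alpha> \<beta> \<in> R"
  using refl_image by blast

lemma corefl_corefl [simp]: "\<alpha> \<in> R \<Longrightarrow> sc \<alpha> (sc \<alpha> y) = y"
  unfolding corefl_def by (rule ext) simp

lemma refl_refl [simp]: "\<alpha> \<in> R \<Longrightarrow> s \<alpha> (s \<alpha> y) = y"
  unfolding refl_def by (rule ext) simp

lemma refl_self: "\<alpha> \<in> R \<Longrightarrow> s \<alpha> \<alpha> = (\<lambda>j. - \<alpha> j)"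
  unfolding refl_def by (rule ext) simp

lemma uminus_in_R [simp]: "\<alpha> \<in> R \<Longrightarrow> (\<lambda>j. - \<alpha> j) \<in> R"
  using refl_self refl_in_R by metis

lemma root_nonzero: "\<alpha> \<in> R \<Longrightarrow> \<alpha> \<noteq> (\<lambda>j. 0)"
  using pair_cor_self by fastforce

lemma bij_corefl: "\<alpha> \<in> R \<Longrightarrow> bij_betw (sc \<alpha>) (cor ` R) (cor ` R)"
  by (intro bij_betw_imageI corefl_image) (metis corefl_corefl inj_onI)

text \<open>The identity \<open>2 P \<beta> = B \<beta> \<beta> \<beta>\<^sup>\<or>\<close> is what forces \<open>cor\<close> to be \<open>W\<close>-equivariant.\<close>

definition P :: "lat \<Rightarrow> lat" where "P x = (\<lambda>j. \<Sum>g\<in>cor ` R. pair n x g * g j)"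
definition B :: "lat \<Rightarrow> lat \<Rightarrow> int" where "B x y = (\<Sum>g\<in>cor ` R. pair n x g * pair n y g)"

lemma B_sym: "B x y = B y x" unfolding B_def by (simp add: mult.commute)

lemma B_simps [simp]:
  "B (\<lambda>j. f j + g j) y = B f y + B g y"
  "B (\<lambda>j. f j - g j) y = B f y - B g y"
  "B (\<lambda>j. c * f j) y = c * B f y"
  "B (\<lambda>j. - f j) y = - B f y"
  "B (\<lambda>j. 0) y = 0"
  "B (\<lambda>j. \<Sum>i\<in>A. h i j) y = (\<Sum>i\<in>A. B (h i) y)"
  unfolding B_def
  by (auto simp: algebra_simps sum.distrib sum_subtractf sum_negf sum_distrib_left sum_distrib_right intro: sum.swap)

lemma B_simps_right [simp]:
  "B y (\<lambda>j. f j + g j) = B y f + B y g"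
  "B y (\<lambda>j. f j - g j) = B y f - B y g"
  "B y (\<lambda>j. c * f j) = c * B y f"
  "B y (\<lambda>j. - f j) = - B y f"
  "B y (\<lambda>j. \<Sum>i\<in>A. h i j) = (\<Sum>i\<in>A. B y (h i))"
  by (simp_all add: B_sym[of y])

lemma sum_coroot_corefl:
  "\<beta> \<in> R \<Longrightarrow> (\<Sum>g\<in>cor ` R. F (sc \<beta> g)) = (\<Sum>g\<in>cor ` R. F g)"
  by (rule sum.reindex_bij_betw[OF bij_corefl])

lemma pair_P: "pair n y (P x) = B x y"
  unfolding P_def B_def by simp

lemma pair_corefl_self: "\<beta> \<in> R \<Longrightarrow> pair n \<beta> (sc \<beta> g) = - pair n \<beta> g"
  unfolding corefl_def by simp

text \<open>Reindexing the sum by the reflection in \<beta> negates \<open>pair n \<beta> g\<close>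
  and replaces \<open>g\<close> by \<open>g - pair n \<beta> g * cor \<beta>\<close>, so the sum
  reproduces itself with the opposite sign, up to
  \<open>B \<beta> \<beta> * cor \<beta>\<close>.\<close>

lemma two_P: assumes "\<beta> \<in> R" shows "2 * P \<beta> j = B \<beta> \<beta> * cor \<beta> j"
proof -
  have "P \<beta> j = (\<Sum>g\<in>cor ` R. pair n \<beta> (sc \<beta> g) * sc \<beta> g j)"
    unfolding P_def using assms by (subst sum_coroot_corefl) auto
  also have "\<dots> = (\<Sum>g\<in>cor ` R. pair n \<beta> g * pair n \<beta> g * cor \<beta> j - pair n \<beta> g * g j)"
    by (intro sum.cong refl) (simp add: pair_corefl_self assms, simp add: corefl_def algebra_simps)
  also have "\<dots> = B \<beta> \<beta> * cor \<beta> j - P \<beta> j"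
    unfolding B_def P_def by (simp add: sum_subtractf sum_distrib_right)
  finally show ?thesis by simp
qed

lemma B_refl: "\<beta> \<in> R \<Longrightarrow> B (s \<beta> x) (s \<beta> y) = B x y"
  unfolding B_def pair_refl by (rule sum_coroot_corefl)

lemma P_refl: assumes "\<beta> \<in> R" shows "P (s \<beta> x) = sc \<beta> (P x)"
proof
  fix j
  have "P (s \<beta> x) j = (\<Sum>g\<in>cor ` R. pair n x (sc \<beta> (sc \<beta> g)) * sc \<beta> g j)"
    unfolding P_def pair_refl using assms
    by (subst sum_coroot_corefl[where F="\<lambda>g. pair n x (sc \<beta> g) * g j"]) auto
  also have "\<dots> = (\<Sum>g\<in>cor ` R. pair n x g * g j - pair n x g * pair n \<beta> g * cor \<beta> j)"
    using assms by (intro sum.cong refl) (simp, simp add: corefl_def algebra_simps)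
  also have "\<dots> = P x j - B x \<beta> * cor \<beta> j"
    unfolding B_def P_def by (simp add: sum_subtractf sum_distrib_right)
  finally show "P (s \<beta> x) j = sc \<beta> (P x) j" by (simp add: corefl_def pair_P)
qed

lemma B_nonneg: "B x x \<ge> 0" unfolding B_def by (intro sum_nonneg) simp

lemma B_eq_0: "B x x = 0 \<Longrightarrow> \<alpha> \<in> R \<Longrightarrow> pair n x (cor \<alpha>) = 0"
  unfolding B_def by (subst (asm) sum_nonneg_eq_0_iff) auto

lemma B_root_pos: "\<beta> \<in> R \<Longrightarrow> B \<beta> \<beta> > 0"
  using B_nonneg[of \<beta>] B_eq_0[of \<beta> \<beta>] by fastforce

lemma two_B: "\<beta> \<in> R \<Longrightarrow> 2 * B x \<beta> = B \<beta> \<beta> * pair n x (cor \<beta>)"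
proof -
  assume b: "\<beta> \<in> R"
  have "(\<lambda>j. 2 * P \<beta> j) = (\<lambda>j. B \<beta> \<beta> * cor \<beta> j)" using two_P[OF b] by auto
  hence "pair n x (\<lambda>j. 2 * P \<beta> j) = pair n x (\<lambda>j. B \<beta> \<beta> * cor \<beta> j)" by simp
  thus ?thesis by (simp add: pair_P B_sym)
qed

text \<open>The axioms only say that reflections permute the set of coroots. By
  \<open>two_P\<close>, \<open>cor \<beta>\<close> is \<open>P \<beta>\<close> up to a factor that
  reflections preserve, and \<open>P\<close> is equivariant.\<close>

lemma cor_refl: assumes "\<alpha> \<in> R" "\<beta> \<in> R" shows "cor (s \<alpha> \<beta>) = sc \<alpha> (cor \<beta>)"
proof
  fix j
  let ?b = "B \<beta> \<beta>"
  have "?b * cor (s \<alpha> \<beta>) j = 2 * sc \<alpha> (P \<beta>) j"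
    using two_P[of "s \<alpha> \<beta>" j] assms by (simp add: B_refl P_refl)
  also have "\<dots> = sc \<alpha> (\<lambda>j. 2 * P \<beta> j) j" by (simp add: corefl_simps)
  also have "(\<lambda>j. 2 * P \<beta> j) = (\<lambda>j. ?b * cor \<beta> j)" using two_P assms by auto
  also have "sc \<alpha> \<dots> j = ?b * sc \<alpha> (cor \<beta>) j" by (simp add: corefl_simps)
  finally show "cor (s \<alpha> \<beta>) j = sc \<alpha> (cor \<beta>) j" using B_root_pos[OF assms(2)] by simp
qed

lemma cor_uminus: "\<alpha> \<in> R \<Longrightarrow> cor (\<lambda>j. - \<alpha> j) = (\<lambda>j. - cor \<alpha> j)"
  using cor_refl[of \<alpha> \<alpha>] by (auto simp: refl_self corefl_def)

lemma pair_sgn_swap: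
  assumes "\<alpha> \<in> R" "\<beta> \<in> R"
  shows "pair n \<alpha> (cor \<beta>) > 0 \<longleftrightarrow> pair n \<beta> (cor \<alpha>) > 0"
proof -
  have "B \<beta> \<beta> * pair n \<alpha> (cor \<beta>) = B \<alpha> \<alpha> * pair n \<beta> (cor \<alpha>)"
    using two_B[OF assms(1), of \<beta>] two_B[OF assms(2), of \<alpha>] by (simp add: B_sym)
  thus ?thesis using B_root_pos[OF assms(1)] B_root_pos[OF assms(2)]
    by (metis zero_less_mult_pos zero_less_mult_iff)
qed

text \<open>A multiple of \<open>d\<close> is \<open>P z\<close> for some \<open>z\<close> in the
  root lattice. If all roots vanish on \<open>d\<close>, then \<open>B z z = 0\<close>, so
  \<open>z\<close> is orthogonal to every coroot because \<open>B\<close> is a sum of squares, and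
  \<open>P z = 0\<close>.\<close>

lemma corootlat_nondegenerate:
  assumes "d \<in> corootlat n R cor" "\<And>\<alpha>. \<alpha> \<in> R \<Longrightarrow> pair n \<alpha> d = 0"
  shows "d = (\<lambda>j. 0)"
proof -
  obtain c where d: "d = (\<lambda>j. \<Sum>\<alpha>\<in>R. c \<alpha> * cor \<alpha> j)" using assms(1) unfolding corootlat_def by auto
  define D where "D = (\<Prod>\<alpha>\<in>R. B \<alpha> \<alpha>)"
  have Dpos: "D > 0" unfolding D_def using B_root_pos by (intro prod_pos) auto
  \<comment> \<open>Chosen so that
    \<open>e \<alpha> * P \<alpha> = D * c \<alpha> * cor \<alpha>\<close>: the denominators
    \<open>B \<alpha> \<alpha>\<close> of all coroots are cleared at once by their product
    \<open>D\<close>.\<close>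
  define e where "e \<alpha> = c \<alpha> * 2 * (\<Prod>\<beta>\<in>R-{\<alpha>}. B \<beta> \<beta>)" for \<alpha>
  define z where "z = (\<lambda>j. \<Sum>\<alpha>\<in>R. e \<alpha> * \<alpha> j)"
  have De: "D = B \<alpha> \<alpha> * (\<Prod>\<beta>\<in>R-{\<alpha>}. B \<beta> \<beta>)" if "\<alpha> \<in> R" for \<alpha>
    unfolding D_def using that by (simp add: prod.remove)
  have Pz: "P z j = D * d j" for j
  proof -
    have "P z j = (\<Sum>\<alpha>\<in>R. e \<alpha> * P \<alpha> j)"
      unfolding P_def z_def by (simp add: sum_distrib_left sum_distrib_right mult.assoc) (rule sum.swap)
    also have "\<dots> = (\<Sum>\<alpha>\<in>R. D * (c \<alpha> * cor \<alpha> j))"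
    proof (intro sum.cong refl)
      fix \<alpha> assume a: "\<alpha> \<in> R"
      have "e \<alpha> * P \<alpha> j = c \<alpha> * (\<Prod>\<beta>\<in>R-{\<alpha>}. B \<beta> \<beta>) * (2 * P \<alpha> j)" by (simp add: e_def)
      also have "\<dots> = D * (c \<alpha> * cor \<alpha> j)" unfolding two_P[OF a] De[OF a] by simp
      finally show "e \<alpha> * P \<alpha> j = D * (c \<alpha> * cor \<alpha> j)" .
    qed
    finally show ?thesis unfolding d by (simp add: sum_distrib_left)
  qed
  have "B z \<alpha> = 0" if "\<alpha> \<in> R" for \<alpha>
    using pair_P[of \<alpha> z] Pz assms(2)[OF that] by (metis (no_types, lifting) ext mult_zero_right pair_simps(10))
  moreover have "B z z = (\<Sum>\<alpha>\<in>R. e \<alpha> * B z \<alpha>)" by (subst (2) z_def) simp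
  ultimately have "B z z = 0" by simp
  hence "P z j = 0" for j unfolding P_def using B_eq_0[of z] by (intro sum.neutral) auto
  thus ?thesis using Pz Dpos by (metis ext less_irrefl mult_eq_0_iff)
qed

lemma corootlat_0: "(\<lambda>j. 0) \<in> corootlat n R cor"
  unfolding corootlat_def by (auto intro!: exI[of _ "\<lambda>_. 0"])

lemma corootlat_add: "p \<in> corootlat n R cor \<Longrightarrow> q \<in> corootlat n R cor \<Longrightarrow> (\<lambda>j. p j + q j) \<in> corootlat n R cor"
  unfolding corootlat_def
  by clarify (rule_tac x="\<lambda>\<alpha>. c \<alpha> + ca \<alpha>" in exI, simp add: sum.distrib algebra_simps)

lemma corootlat_scale: "p \<in> corootlat n R cor \<Longrightarrow> (\<lambda>j. k * p j) \<in> corootlat n R cor"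
  unfolding corootlat_def
  by clarify (rule_tac x="\<lambda>\<alpha>. k * c \<alpha>" in exI, simp add: sum_distrib_left algebra_simps)

lemma corootlat_uminus: "p \<in> corootlat n R cor \<Longrightarrow> (\<lambda>j. - p j) \<in> corootlat n R cor"
  using corootlat_scale[of p "-1"] by simp

lemma corootlat_diff: "p \<in> corootlat n R cor \<Longrightarrow> q \<in> corootlat n R cor \<Longrightarrow> (\<lambda>j. p j - q j) \<in> corootlat n R cor"
  using corootlat_add[OF _ corootlat_uminus] by simp

lemma cor_in_corootlat: "\<alpha> \<in> R \<Longrightarrow> cor \<alpha> \<in> corootlat n R cor"
  unfolding corootlat_def
  by (auto intro!: exI[of _ "\<lambda>\<beta>. if \<beta> = \<alpha> then 1 else 0"] simp: if_distrib[of "\<lambda>x. x * _"] cong: if_cong)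

lemma isvec_corootlat: "q \<in> corootlat n R cor \<Longrightarrow> isvec n q"
  unfolding corootlat_def isvec_def using isvec_cor by (auto simp: isvec_def)

lemma corootlat_corefl: "\<alpha> \<in> R \<Longrightarrow> q \<in> corootlat n R cor \<Longrightarrow> sc \<alpha> q \<in> corootlat n R cor"
  unfolding corefl_def by (intro corootlat_diff corootlat_scale cor_in_corootlat)

subsection \<open>The Weyl group\<close>

lemma weyl_add: "w \<in> W \<Longrightarrow> w (\<lambda>j. f j + g j) = (\<lambda>j. w f j + w g j)"
  by (induction rule: weyl.induct) (auto simp: corefl_simps)

lemma weyl_scale: "w \<in> W \<Longrightarrow> w (\<lambda>j. c * f j) = (\<lambda>j. c * w f j)"
  by (induction rule: weyl.induct) (auto simp: corefl_simps)

lemma weyl_0: "w \<in> W \<Longrightarrow> w (\<lambda>j. 0) = (\<lambda>j. 0)"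
  using weyl_scale[of w 0 "\<lambda>j. 0"] by simp

lemma weyl_sum:
  assumes "w \<in> W" "finite A"
  shows "w (\<lambda>j. \<Sum>i\<in>A. h i j) = (\<lambda>j. \<Sum>i\<in>A. w (h i) j)"
  using assms(2) by (induction A rule: finite_induct) (simp_all add: weyl_0[OF assms(1)] weyl_add[OF assms(1)])

lemma weyl_tail: "w \<in> W \<Longrightarrow> j \<ge> n \<Longrightarrow> w y j = y j"
  by (induction rule: weyl.induct) (use isvec_cor in \<open>auto simp: corefl_def isvec_def\<close>)

lemma isvec_weyl: "w \<in> W \<Longrightarrow> isvec n y \<Longrightarrow> isvec n (w y)"
  by (simp add: isvec_def weyl_tail)

lemma weyl_cong: "w \<in> W \<Longrightarrow> (\<And>j. j < n \<Longrightarrow> x j = y j) \<Longrightarrow> i < n \<Longrightarrow> w x i = w y i"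
proof (induction arbitrary: i rule: weyl.induct)
  case (weyl_step w \<alpha>)
  hence "pair n \<alpha> (w x) = pair n \<alpha> (w y)" by (intro pair_cong_right) auto
  thus ?case using weyl_step by (auto simp: corefl_def)
qed auto

lemma weyl_expand:
  assumes "w \<in> W" "i < n"
  shows "w y i = (\<Sum>j<n. y j * w (unitv j) i)"
proof -
  have "w y i = w (\<lambda>k. \<Sum>j<n. y j * unitv j k) i"
    by (rule weyl_cong[OF assms(1) _ assms(2)])
       (auto simp: unitv_def if_distrib[of "(*) _"] sum.delta cong: if_cong)
  thus ?thesis by (simp add: weyl_sum[OF assms(1)] weyl_scale[OF assms(1)])
qed

text \<open>Elements of \<open>W\<close> are functions on all integer sequences. Testing on unit
  vectors suffices because coordinates from \<open>n\<close> on are left alone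
  (\<open>weyl_tail\<close>) and the others depend only on the coordinates below \<open>n\<close>
  (\<open>weyl_cong\<close>).\<close>

lemma weyl_ext:
  assumes "w \<in> W" "u \<in> W" "\<And>i. i < n \<Longrightarrow> w (unitv i) = u (unitv i)"
  shows "w = u"
proof (intro ext)
  fix y j show "w y j = u y j"
    using weyl_expand[OF assms(1), of j y] weyl_expand[OF assms(2), of j y]
      weyl_tail[OF assms(1), of j y] weyl_tail[OF assms(2), of j y] assms(3)
    by (cases "j < n") auto
qed

lemma weyl_comp: "w \<in> W \<Longrightarrow> u \<in> W \<Longrightarrow> w \<circ> u \<in> W"
  by (induction rule: weyl.induct) (auto simp: comp_assoc intro: weyl.weyl_step)

lemma corefl_in_W: "\<alpha> \<in> R \<Longrightarrow> sc \<alpha> \<in> W"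
  using weyl.weyl_step[OF weyl.weyl_id, of \<alpha>] by simp

lemma weyl_inverse: "w \<in> W \<Longrightarrow> \<exists>u\<in>W. u \<circ> w = id \<and> w \<circ> u = id"
proof (induction rule: weyl.induct)
  case weyl_id show ?case by (rule bexI[of _ id]) (auto intro: weyl.weyl_id)
next
  case (weyl_step w \<alpha>)
  then obtain u where u: "u \<in> W" "u \<circ> w = id" "w \<circ> u = id" by blast
  have "u \<circ> sc \<alpha> \<in> W" using u weyl_step by (intro weyl_comp corefl_in_W)
  moreover have "(u \<circ> sc \<alpha>) \<circ> (sc \<alpha> \<circ> w) = id"
    by (rule ext) (use fun_cong[OF u(2)] weyl_step(2) in simp)
  moreover have "(sc \<alpha> \<circ> w) \<circ> (u \<circ> sc \<alpha>) = id"
    by (rule ext) (use fun_cong[OF u(3)] weyl_step(2) in simp)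
  ultimately show ?case by blast
qed

lemma bij_weyl_comp_left: assumes "w \<in> W" shows "bij_betw ((\<circ>) w) W W"
proof -
  obtain u where "u \<in> W" "u \<circ> w = id" "w \<circ> u = id" using weyl_inverse assms by blast
  thus ?thesis using assms
    by (intro bij_betw_byWitness[where f'="(\<circ>) u"]) (auto simp: weyl_comp comp_assoc[symmetric])
qed

lemma bij_weyl_comp_right: assumes "w \<in> W" shows "bij_betw (\<lambda>u. u \<circ> w) W W"
proof -
  obtain u where "u \<in> W" "u \<circ> w = id" "w \<circ> u = id" using weyl_inverse assms by blast
  thus ?thesis using assms
    by (intro bij_betw_byWitness[where f'="\<lambda>x. x \<circ> u"]) (auto simp: weyl_comp comp_assoc)
qed

text \<open>Thus \<open>W\<close> acts trivially on cocharacters modulo the coroot lattice, which is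
  why the class of a translation part survives conjugation by \<open>W\<close>.\<close>

lemma weyl_minus_in_corootlat: "w \<in> W \<Longrightarrow> (\<lambda>j. w y j - y j) \<in> corootlat n R cor"
proof (induction rule: weyl.induct)
  case weyl_id show ?case using corootlat_0 by simp
next
  case (weyl_step w \<alpha>)
  have "(\<lambda>j. (w y j - y j) - pair n \<alpha> (w y) * cor \<alpha> j) \<in> corootlat n R cor"
    using weyl_step by (intro corootlat_diff[OF _ corootlat_scale] cor_in_corootlat)
  thus ?case by (simp add: corefl_def algebra_simps)
qed

lemma corootlat_weyl: "w \<in> W \<Longrightarrow> q \<in> corootlat n R cor \<Longrightarrow> w q \<in> corootlat n R cor"
  using corootlat_add[OF weyl_minus_in_corootlat, of w q q] by simp

text \<open>The right action of \<open>W\<close> on characters dual to its action on cocharacters.\<close>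

definition wd :: "(lat \<Rightarrow> lat) \<Rightarrow> lat \<Rightarrow> lat" where
  "wd w x = (\<lambda>j. if j < n then pair n x (w (unitv j)) else 0)"

lemma isvec_wd [simp]: "isvec n (wd w x)" by (simp add: wd_def isvec_def)

lemma pair_ext: "isvec n x \<Longrightarrow> isvec n y \<Longrightarrow> (\<And>v. isvec n v \<Longrightarrow> pair n x v = pair n y v) \<Longrightarrow> x = y"
  by (rule isvec_ext) (auto, metis isvec_unitv pair_unitv)

lemma pair_wd: assumes "w \<in> W" shows "pair n (wd w x) y = pair n x (w y)"
proof -
  have "pair n x (w y) = pair n x (\<lambda>i. \<Sum>j<n. y j * w (unitv j) i)"
    by (rule pair_cong_right) (rule weyl_expand[OF assms])
  also have "\<dots> = pair n (wd w x) y"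
    by (simp add: pair_def[of n "wd w x" y], simp add: wd_def mult.commute)
  finally show ?thesis by simp
qed

lemma wd_comp: "w \<in> W \<Longrightarrow> u \<in> W \<Longrightarrow> wd (w \<circ> u) x = wd u (wd w x)"
  by (rule pair_ext) (auto simp: pair_wd weyl_comp)

lemma wd_id: "isvec n x \<Longrightarrow> wd id x = x"
  by (rule pair_ext) (auto simp: pair_wd weyl.weyl_id)

lemma wd_simps:
  "wd w (\<lambda>j. f j + g j) = (\<lambda>j. wd w f j + wd w g j)"
  "wd w (\<lambda>j. f j - g j) = (\<lambda>j. wd w f j - wd w g j)"
  "wd w (\<lambda>j. - f j) = (\<lambda>j. - wd w f j)"
  "wd w (\<lambda>j. c * f j) = (\<lambda>j. c * wd w f j)"
  "wd w (\<lambda>j. \<Sum>i\<in>A. h i j) = (\<lambda>j. \<Sum>i\<in>A. wd w (h i) j)"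
  by (auto simp: wd_def)

lemma wd_corefl: "\<alpha> \<in> R \<Longrightarrow> isvec n x \<Longrightarrow> wd (sc \<alpha>) x = s \<alpha> x"
  by (rule pair_ext) (use isvec_root in \<open>auto simp: pair_wd corefl_in_W pair_refl, auto simp: isvec_def refl_def\<close>)

lemma isvec_refl: "\<alpha> \<in> R \<Longrightarrow> isvec n x \<Longrightarrow> isvec n (s \<alpha> x)"
  using isvec_root by (auto simp: isvec_def refl_def)

lemma wd_step: "w \<in> W \<Longrightarrow> \<alpha> \<in> R \<Longrightarrow> isvec n x \<Longrightarrow> wd (sc \<alpha> \<circ> w) x = wd w (s \<alpha> x)"
  by (simp add: wd_comp corefl_in_W wd_corefl)

lemma wd_root: "w \<in> W \<Longrightarrow> \<alpha> \<in> R \<Longrightarrow> wd w \<alpha> \<in> R"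
  by (induction arbitrary: \<alpha> rule: weyl.induct) (auto simp: wd_id isvec_root wd_step)

lemma B_wd: "w \<in> W \<Longrightarrow> isvec n x \<Longrightarrow> isvec n y \<Longrightarrow> B (wd w x) (wd w y) = B x y"
  by (induction arbitrary: x y rule: weyl.induct) (auto simp: wd_id isvec_root wd_step isvec_refl B_refl)

lemma wd_inverse:
  assumes "w \<in> W" obtains u where "u \<in> W" "u \<circ> w = id" "w \<circ> u = id"
    "\<And>x. isvec n x \<Longrightarrow> wd u (wd w x) = x" "\<And>x. isvec n x \<Longrightarrow> wd w (wd u x) = x"
proof -
  obtain u where u: "u \<in> W" "u \<circ> w = id" "w \<circ> u = id" using weyl_inverse assms by blast
  show ?thesis
    by (rule that[OF u]) (metis u assms wd_comp wd_id)+
qed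

lemma bij_wd_R: assumes "w \<in> W" shows "bij_betw (wd w) R R"
proof -
  obtain u where "u \<in> W" "\<And>x. isvec n x \<Longrightarrow> wd u (wd w x) = x" "\<And>x. isvec n x \<Longrightarrow> wd w (wd u x) = x"
    using wd_inverse[OF assms] by metis
  thus ?thesis using assms
    by (intro bij_betw_byWitness[where f'="wd u"]) (auto simp: isvec_root wd_root)
qed

text \<open>\<open>W\<close> acts faithfully on the finite set \<open>R\<close>. Roots need not span
  the characters, so agreement on \<open>R\<close> alone does not give \<open>w = u\<close>; but
  \<open>w y - u y\<close> lies in the coroot lattice, where vanishing on all roots means being
  zero.\<close>

lemma finite_weyl: "finite W"
proof -
  let ?f = "\<lambda>w. restrict (wd w) R"
  have "?f ` W \<subseteq> R \<rightarrow>\<^sub>E R" using wd_root by auto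
  hence "finite (?f ` W)" using finite_PiE[of R "\<lambda>_. R"] finite_subset by auto
  moreover have "inj_on ?f W"
  proof (rule inj_onI)
    fix w u assume w: "w \<in> W" "u \<in> W" and eq: "?f w = ?f u"
    show "w = u"
    proof (rule weyl_ext[OF w])
      fix i assume "i < n"
      let ?y = "unitv i"
      have "(\<lambda>j. (w ?y j - ?y j) - (u ?y j - ?y j)) \<in> corootlat n R cor"
        by (intro corootlat_diff weyl_minus_in_corootlat w)
      hence "(\<lambda>j. w ?y j - u ?y j) \<in> corootlat n R cor" by simp
      moreover have "pair n \<alpha> (\<lambda>j. w ?y j - u ?y j) = 0" if "\<alpha> \<in> R" for \<alpha>
        using fun_cong[OF eq, of \<alpha>] that w by (simp add: pair_wd[symmetric])
      ultimately show "w ?y = u ?y" using corootlat_nondegenerate by (fastforce simp: fun_eq_iff)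
    qed
  qed
  ultimately show ?thesis using finite_imageD by blast
qed

section \<open>The real extension of \<open>W\<close> and the average over it\<close>

lemma rpair_ext:
  "isvec n x \<Longrightarrow> isvec n y \<Longrightarrow> (\<And>a. isvec n a \<Longrightarrow> rpair n a x = rpair n a y) \<Longrightarrow> x = y"
  by (rule isvec_ext) (auto, metis isvec_unitv rpair_unitv)

lemma isvec_wR [simp]: "w \<in> W \<Longrightarrow> isvec n (wR n w v)"
  by (auto simp: isvec_def wR_def weyl_tail unitv_def)

lemma rpair_wR: "rpair n x (wR n w v) = rpair n (wd w x) v"
  unfolding wR_def
  by (simp add: rpair_def[of n "wd w x" v], simp add: wd_def rpair_def pair_def mult.commute)

lemma wR_comp: "w \<in> W \<Longrightarrow> u \<in> W \<Longrightarrow> wR n (w \<circ> u) v = wR n w (wR n u v)"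
  by (rule rpair_ext) (auto simp: weyl_comp rpair_wR wd_comp)

lemma wR_id: "isvec n v \<Longrightarrow> wR n id v = v"
  by (rule rpair_ext) (auto simp: weyl.weyl_id rpair_wR wd_id)

lemma wR_simps:
  "wR n w (\<lambda>j. p j + q j) = (\<lambda>j. wR n w p j + wR n w q j)"
  "wR n w (\<lambda>j. p j - q j) = (\<lambda>j. wR n w p j - wR n w q j)"
  "wR n w (\<lambda>j. - p j) = (\<lambda>j. - wR n w p j)"
  "wR n w (\<lambda>j. d * p j) = (\<lambda>j. d * wR n w p j)"
  "wR n w (\<lambda>j. p j / d) = (\<lambda>j. wR n w p j / d)"
  "wR n w (\<lambda>j. \<Sum>i\<in>A. k i j) = (\<lambda>j. \<Sum>i\<in>A. wR n w (k i) j)"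
  by (auto simp: wR_def algebra_simps sum.distrib sum_subtractf sum_negf sum_distrib_left
      sum_distrib_right sum_divide_distrib intro: sum.swap)

lemma wR_of_int: assumes "w \<in> W" "isvec n y" shows "wR n w (\<lambda>j. of_int (y j)) = (\<lambda>j. of_int (w y j))"
  by (rule rpair_ext) (use assms isvec_weyl[OF assms] in \<open>auto simp: rpair_wR pair_wd, simp add: isvec_def\<close>)

lemma wR_corefl: assumes "\<alpha> \<in> R" "isvec n v"
  shows "wR n (sc \<alpha>) v = (\<lambda>j. v j - rpair n \<alpha> v * of_int (cor \<alpha> j))"
proof (rule rpair_ext)
  show "isvec n (\<lambda>j. v j - rpair n \<alpha> v * of_int (cor \<alpha> j))"
    using assms isvec_cor[OF assms(1)] by (simp add: isvec_def)
  fix a :: lat assume a: "isvec n a"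
  show "rpair n a (wR n (sc \<alpha>) v) = rpair n a (\<lambda>j. v j - rpair n \<alpha> v * of_int (cor \<alpha> j))"
    using a by (simp add: rpair_wR wd_corefl assms) (simp add: refl_def)
qed (simp add: corefl_in_W assms)

lemma wR_pG: assumes "w \<in> W" shows "wR n w (pG n R cor v) = pG n R cor v"
proof -
  have "(\<Sum>u\<in>W. wR n (w \<circ> u) v j) = (\<Sum>u\<in>W. wR n u v j)" for j
    by (rule sum.reindex_bij_betw[OF bij_weyl_comp_left[OF assms]])
  moreover have "(\<Sum>u\<in>W. wR n (w \<circ> u) v j) = (\<Sum>u\<in>W. wR n w (wR n u v) j)" for j
    using assms by (simp add: wR_comp)
  ultimately show ?thesis unfolding pG_def by (simp add: wR_simps)
qed

lemma isvec_pG [simp]: "isvec n (pG n R cor v)"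
  unfolding isvec_def pG_def using isvec_wR unfolding isvec_def by auto

lemma card_W_pos: "card W > 0"
  using finite_weyl weyl.weyl_id[of n R cor] by (auto simp: card_gt_0_iff)

lemma pG_invariant: assumes "isvec n v" "\<And>\<alpha>. \<alpha> \<in> R \<Longrightarrow> rpair n \<alpha> v = 0"
  shows "pG n R cor v = v"
proof -
  have "wR n w v = v" if "w \<in> W" for w using that
  proof (induction rule: weyl.induct)
    case weyl_id show ?case by (rule wR_id[OF assms(1)])
  next
    case (weyl_step w \<alpha>) thus ?case
      by (subst wR_comp) (simp_all add: corefl_in_W wR_corefl assms)
  qed
  thus ?thesis unfolding pG_def using card_W_pos by auto
qed

lemma rpair_root_pG: assumes "\<alpha> \<in> R" shows "rpair n \<alpha> (pG n R cor v) = 0"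
proof -
  have "rpair n \<alpha> (pG n R cor v) = rpair n \<alpha> (wR n (sc \<alpha>) (pG n R cor v))"
    by (simp add: wR_pG corefl_in_W assms)
  also have "\<dots> = - rpair n \<alpha> (pG n R cor v)"
    using assms by (simp add: rpair_wR wd_corefl isvec_root refl_self)
  finally show ?thesis by simp
qed

lemma pG_weyl: assumes "w \<in> W" shows "pG n R cor (wR n w v) = pG n R cor v"
proof -
  have "(\<Sum>u\<in>W. wR n (u \<circ> w) v j) = (\<Sum>u\<in>W. wR n u v j)" for j
    by (rule sum.reindex_bij_betw[OF bij_weyl_comp_right[OF assms], where g="\<lambda>u. wR n u v j"])
  thus ?thesis unfolding pG_def using assms by (simp add: wR_comp)
qed

lemma pG_simps:
  "pG n R cor (\<lambda>j. p j + q j) = (\<lambda>j. pG n R cor p j + pG n R cor q j)"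
  "pG n R cor (\<lambda>j. p j - q j) = (\<lambda>j. pG n R cor p j - pG n R cor q j)"
  unfolding pG_def by (auto simp: wR_simps sum.distrib sum_subtractf add_divide_distrib diff_divide_distrib)

text \<open>The sum of all \<open>w q\<close> is again in the coroot lattice and, being
  \<open>W\<close>-invariant, is killed by every root; nondegeneracy makes it zero. So
  \<open>pG\<close> descends to cocharacters modulo coroots.\<close>

lemma pG_corootlat: assumes "q \<in> corootlat n R cor" shows "pG n R cor (\<lambda>j. of_int (q j)) = (\<lambda>j. 0)"
proof -
  define Q where "Q j = (\<Sum>w\<in>W. w q j)" for j
  have 1: "pG n R cor (\<lambda>j. of_int (q j)) = (\<lambda>j. of_int (Q j) / real (card W))"
    unfolding pG_def Q_def using isvec_corootlat[OF assms] by (simp add: wR_of_int)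
  have "Q \<in> corootlat n R cor" unfolding Q_def using finite_weyl corootlat_weyl assms
  proof -
    have "(\<lambda>j. \<Sum>w\<in>A. w q j) \<in> corootlat n R cor" if "finite A" "A \<subseteq> W" for A
      using that
    proof (induction A rule: finite_induct)
      case (insert w A)
      thus ?case using corootlat_add[OF corootlat_weyl[OF _ assms, of w]] by simp
    qed (simp add: corootlat_0)
    thus "(\<lambda>j. \<Sum>w\<in>W. w q j) \<in> corootlat n R cor" using finite_weyl by auto
  qed
  moreover have "pair n \<alpha> Q = 0" if "\<alpha> \<in> R" for \<alpha>
    using rpair_root_pG[OF that, of "\<lambda>j. of_int (q j)"] card_W_pos unfolding 1 by simp
  ultimately have "Q = (\<lambda>j. 0)" by (rule corootlat_nondegenerate)
  thus ?thesis unfolding 1 by simp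
qed

subsection \<open>Positive roots\<close>

abbreviation "Pos \<equiv> pos_roots l R simple"

text \<open>\<open>nneg\<close> of a difference \<open>x - y\<close> is the dominance order:
  \<open>y\<close> lies below \<open>x\<close>.\<close>

definition nneg :: "lat \<Rightarrow> bool" where
  "nneg x \<longleftrightarrow> (\<exists>c::nat \<Rightarrow> int. (\<forall>i<l. c i \<ge> 0) \<and> x = (\<lambda>j. \<Sum>i<l. c i * simple i j))"

lemma Pos_iff: "\<alpha> \<in> Pos \<longleftrightarrow> \<alpha> \<in> R \<and> nneg \<alpha>"
  by (simp add: pos_roots_def nneg_def)

lemma Pos_R: "\<alpha> \<in> Pos \<Longrightarrow> \<alpha> \<in> R" by (simp add: Pos_iff)

lemma finite_Pos [simp]: "finite Pos" by (rule finite_subset[of _ R]) (auto simp: Pos_R)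

lemma nneg_0: "nneg (\<lambda>j. 0)" unfolding nneg_def by (auto intro!: exI[of _ "\<lambda>_. 0"])

lemma nneg_add: "nneg x \<Longrightarrow> nneg y \<Longrightarrow> nneg (\<lambda>j. x j + y j)"
  unfolding nneg_def by clarify (rule_tac x="\<lambda>i. c i + ca i" in exI, simp add: sum.distrib algebra_simps)

lemma nneg_scale: "nneg x \<Longrightarrow> k \<ge> 0 \<Longrightarrow> nneg (\<lambda>j. k * x j)"
  unfolding nneg_def by clarify (rule_tac x="\<lambda>i. k * c i" in exI, simp add: sum_distrib_left algebra_simps)

lemma nneg_simple: "i < l \<Longrightarrow> nneg (simple i)"
  unfolding nneg_def
  by (auto intro!: exI[of _ "\<lambda>j. if j = i then 1 else 0"] simp: if_distrib[of "\<lambda>x. x * _"] cong: if_cong)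

lemma nneg_sum: "finite A \<Longrightarrow> (\<And>i. i \<in> A \<Longrightarrow> nneg (h i)) \<Longrightarrow> nneg (\<lambda>j. \<Sum>i\<in>A. h i j)"
  by (induction A rule: finite_induct) (auto simp: nneg_0 intro!: nneg_add)

lemma simple_coeffs_unique:
  assumes "(\<lambda>j. \<Sum>i<l. c i * simple i j) = (\<lambda>j. \<Sum>i<l. d i * simple i j)" "i < l"
  shows "(c i :: int) = d i"
proof -
  have "(\<lambda>j. \<Sum>i<l. (c i - d i) * simple i j) = (\<lambda>j. 0)"
    using assms(1) by (auto simp: fun_eq_iff algebra_simps sum_subtractf)
  thus ?thesis using simple_indep[of "\<lambda>i. c i - d i"] assms(2) by fastforce
qed

lemma nneg_antisym: assumes "nneg x" "nneg (\<lambda>j. - x j)" shows "x = (\<lambda>j. 0)"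
proof -
  obtain c d where c: "\<forall>i<l. c i \<ge> 0" "x = (\<lambda>j. \<Sum>i<l. c i * simple i j)"
    and d: "\<forall>i<l. d i \<ge> 0" "(\<lambda>j. - x j) = (\<lambda>j. \<Sum>i<l. d i * simple i j)"
    using assms unfolding nneg_def by blast
  have "x = (\<lambda>j. \<Sum>i<l. (- d i) * simple i j)" using d(2) by (simp add: fun_eq_iff sum_negf) (metis minus_minus)
  hence "c i = - d i" if "i < l" for i using simple_coeffs_unique[of c "\<lambda>i. - d i"] c(2) that by simp
  hence "c i = 0" if "i < l" for i using c(1) d(1) that by force
  thus ?thesis using c(2) by simp
qed

lemma Pos_or_uminus: assumes "\<alpha> \<in> R" shows "\<alpha> \<in> Pos \<or> (\<lambda>j. - \<alpha> j) \<in> Pos"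
proof -
  obtain c where c: "\<alpha> = (\<lambda>j. \<Sum>i<l. c i * simple i j)" "(\<forall>i<l. c i \<ge> 0) \<or> (\<forall>i<l. c i \<le> 0)"
    using root_expand[OF assms] by blast
  have "(\<lambda>j. - \<alpha> j) = (\<lambda>j. \<Sum>i<l. (- c i) * simple i j)" unfolding c(1) by (simp add: sum_negf)
  hence "nneg (\<lambda>j. - \<alpha> j)" if "\<forall>i<l. c i \<le> 0"
    unfolding nneg_def using that by (intro exI[of _ "\<lambda>i. - c i"]) simp
  moreover have "nneg \<alpha>" if "\<forall>i<l. c i \<ge> 0"
    unfolding nneg_def using that c(1) by blast
  ultimately show ?thesis using c(2) assms unfolding Pos_iff by auto
qed

lemma not_Pos_uminus: "\<alpha> \<in> Pos \<Longrightarrow> (\<lambda>j. - \<alpha> j) \<notin> Pos"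
  using nneg_antisym root_nonzero by (auto simp: Pos_iff)

lemma simple_Pos [simp]: "i < l \<Longrightarrow> simple i \<in> Pos"
  by (simp add: Pos_iff nneg_simple)

text \<open>The two Cartan numbers of positively proportional roots are positive with product 4. The
  pairs (1,4) and (4,1) make one root twice the other, which reducedness forbids, and (2,2) gives
  equality. Real factors are allowed because gradients of affine roots are later compared with real
  weights.\<close>

lemma root_multiple_eq:
  assumes "\<alpha> \<in> R" "\<beta> \<in> R" "a > 0" "b > 0"
    and eq: "\<And>j. j < n \<Longrightarrow> (a::real) * of_int (\<alpha> j) = b * of_int (\<beta> j)"
  shows "\<alpha> = \<beta>"
proof -
  have p: "a * of_int (pair n \<alpha> y) = b * of_int (pair n \<beta> y)" for y
    unfolding pair_def using eq by (simp add: sum_distrib_left mult.assoc[symmetric])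
  define A where "A = pair n \<beta> (cor \<alpha>)"
  define C where "C = pair n \<alpha> (cor \<beta>)"
  have 1: "a * 2 = b * of_int A" "a * of_int C = b * 2"
    using p[of "cor \<alpha>"] p[of "cor \<beta>"] assms by (auto simp: A_def C_def)
  have "(a * 2) * (b * 2) = (b * of_int A) * (a * of_int C)" using 1 by simp
  hence "(4::real) = of_int (A * C)" using assms by (simp add: field_simps)
  hence AC: "A * C = 4" by linarith
  have "A > 0" using 1(1) assms(3,4) by (metis mult_pos_pos zero_less_mult_pos of_int_0_less_iff zero_less_numeral)
  hence "C > 0" using AC by (metis zero_less_mult_pos zero_less_numeral)
  have "A \<le> 4" using AC \<open>C > 0\<close> \<open>A > 0\<close> by (metis mult_le_cancel_left1 int_one_le_iff_zero_less not_le order_less_imp_le)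
  then consider "A = 1" | "A = 2" | "A = 3" | "A = 4" using \<open>A > 0\<close> by linarith
  thus ?thesis
  proof cases
    case 1
    hence "b = 2 * a" using \<open>a * 2 = b * of_int A\<close> by simp
    hence "\<alpha> j = 2 * \<beta> j" if "j < n" for j using eq[OF that] assms(3) by simp
    hence "\<alpha> = (\<lambda>j. 2 * \<beta> j)"
      by (intro isvec_ext[of n]) (use isvec_root assms in \<open>auto simp: isvec_def\<close>)
    thus ?thesis using reduced assms by metis
  next
    case 2
    hence "b = a" using \<open>a * 2 = b * of_int A\<close> by simp
    thus ?thesis using eq assms by (intro isvec_ext[of n]) (auto simp: isvec_root)
  next
    case 3 thus ?thesis using AC by presburger
  next
    case 4
    hence "a = 2 * b" using \<open>a * 2 = b * of_int A\<close> by simp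
    hence "\<beta> j = 2 * \<alpha> j" if "j < n" for j using eq[OF that] assms(4) by simp
    hence "\<beta> = (\<lambda>j. 2 * \<alpha> j)"
      by (intro isvec_ext[of n]) (use isvec_root assms in \<open>auto simp: isvec_def\<close>)
    thus ?thesis using reduced assms by metis
  qed
qed

text \<open>The reflection changes only the coefficient of \<open>simple i\<close>. If the image
  were negative, every other coefficient of \<alpha> would be both nonnegative and nonpositive, so
  \<alpha> would be a multiple of \<open>simple i\<close> and hence equal to it.\<close>

lemma refl_simple_Pos:
  assumes "i < l" "\<alpha> \<in> Pos" "\<alpha> \<noteq> simple i"
  shows "s (simple i) \<alpha> \<in> Pos"
proof (rule ccontr)
  assume no: "s (simple i) \<alpha> \<notin> Pos"
  have aR: "\<alpha> \<in> R" using assms Pos_R by auto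
  let ?b = "s (simple i) \<alpha>"
  have "(\<lambda>j. - ?b j) \<in> Pos" using no Pos_or_uminus[of ?b] aR assms by auto
  then obtain d where d: "\<forall>k<l. d k \<ge> 0" "(\<lambda>j. - ?b j) = (\<lambda>j. \<Sum>k<l. d k * simple k j)"
    unfolding Pos_iff nneg_def by blast
  obtain c where c: "\<forall>k<l. c k \<ge> 0" "\<alpha> = (\<lambda>j. \<Sum>k<l. c k * simple k j)"
    using assms(2) unfolding Pos_iff nneg_def by blast
  let ?m = "pair n \<alpha> (cor (simple i))"
  define e where "e k = (if k = i then ?m - c k else - c k)" for k
  have "(\<Sum>k<l. e k * simple k j) = ?m * simple i j - \<alpha> j" for j
  proof -
    have "(\<Sum>k<l. e k * simple k j) = (\<Sum>k<l. (if k = i then ?m * simple k j else 0) - c k * simple k j)"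
      by (intro sum.cong) (auto simp: e_def algebra_simps)
    also have "\<dots> = ?m * simple i j - \<alpha> j" using assms(1) c(2) by (simp add: sum_subtractf fun_eq_iff)
    finally show ?thesis .
  qed
  hence "(\<lambda>j. - ?b j) = (\<lambda>j. \<Sum>k<l. e k * simple k j)" by (auto simp: refl_def)
  hence "d k = e k" if "k < l" for k using d(2) simple_coeffs_unique[of d e k] that by simp
  hence c0: "c k = 0" if "k < l" "k \<noteq> i" for k using c(1) d(1) that by (force simp: e_def)
  have "(\<Sum>k<l. c k * simple k j) = c i * simple i j" for j
    using c0 assms(1) by (subst sum.remove[of _ i]) auto
  hence a: "\<alpha> = (\<lambda>j. c i * simple i j)" using c(2) by simp
  moreover have "c i \<noteq> 0" using a root_nonzero[OF aR] by auto
  ultimately have "\<alpha> = simple i" using c(1) assms(1) aR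
    by (intro root_multiple_eq[of \<alpha> "simple i" 1 "of_int (c i)"])
       (auto simp: fun_eq_iff less_le)
  thus False using assms by simp
qed

text \<open>Twice rho of the dual system; the doubling keeps it integral. It serves as a height
  function on characters and points into the alcove.\<close>

definition rho2 :: lat where "rho2 = (\<lambda>j. \<Sum>\<beta>\<in>Pos. cor \<beta> j)"

lemma isvec_rho2: "isvec n rho2"
  using isvec_cor Pos_R by (auto simp: isvec_def rho2_def)

text \<open>The simple reflection permutes the positive roots other than its own, so the sum of
  their coroots is fixed by it and pairs to 0 with \<open>simple i\<close>. Only
  \<open>cor (simple i)\<close> contributes.\<close>

lemma pair_simple_rho2: assumes "i < l" shows "pair n (simple i) rho2 = 2"
proof -
  let ?a = "simple i"
  let ?r = "\<lambda>j. \<Sum>\<beta>\<in>Pos-{?a}. cor \<beta> j"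
  have "bij_betw (s ?a) (Pos - {?a}) (Pos - {?a})"
  proof (rule bij_betw_byWitness[where f'="s ?a"])
    have "s ?a \<beta> \<in> Pos - {?a}" if "\<beta> \<in> Pos - {?a}" for \<beta>
    proof -
      have "s ?a \<beta> \<noteq> ?a"
      proof
        assume "s ?a \<beta> = ?a"
        hence "\<beta> = (\<lambda>j. - ?a j)" by (metis refl_refl refl_self assms simple_in_R)
        thus False using that not_Pos_uminus assms by auto
      qed
      thus ?thesis using refl_simple_Pos assms that by auto
    qed
    thus "s ?a ` (Pos - {?a}) \<subseteq> Pos - {?a}" "s ?a ` (Pos - {?a}) \<subseteq> Pos - {?a}" by auto
  qed (use assms in auto)
  hence "(\<Sum>\<beta>\<in>Pos-{?a}. cor (s ?a \<beta>) j) = (\<Sum>\<beta>\<in>Pos-{?a}. cor \<beta> j)" for j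
    by (rule sum.reindex_bij_betw)
  moreover have "(\<Sum>\<beta>\<in>Pos-{?a}. cor (s ?a \<beta>) j) = (\<Sum>\<beta>\<in>Pos-{?a}. cor \<beta> j) - pair n ?a ?r * cor ?a j" for j
    using assms by (simp add: cor_refl Pos_R sum_subtractf corefl_def sum_distrib_right)
  ultimately have "pair n ?a ?r * cor ?a j = 0" for j by simp
  hence "pair n ?a ?r = 0" using pair_cor_self[of ?a] assms
    by (metis (no_types, lifting) mult_eq_0_iff pair_simps(11) ext simple_in_R zero_neq_numeral)
  moreover have "rho2 = (\<lambda>j. cor ?a j + ?r j)"
    unfolding rho2_def using assms by (subst sum.remove[of Pos ?a]) auto
  ultimately show ?thesis using assms by simp
qed

lemma pair_rho2_nneg: assumes "nneg x" shows "pair n x rho2 \<ge> 0" "pair n x rho2 = 0 \<Longrightarrow> x = (\<lambda>j. 0)"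
proof -
  obtain c where c: "\<forall>i<l. c i \<ge> 0" "x = (\<lambda>j. \<Sum>i<l. c i * simple i j)" using assms unfolding nneg_def by blast
  have e: "pair n x rho2 = (\<Sum>i<l. c i * 2)" unfolding c(2) by (simp add: pair_simple_rho2)
  show "pair n x rho2 \<ge> 0" unfolding e using c(1) by (intro sum_nonneg) auto
  assume "pair n x rho2 = 0"
  hence "\<forall>i\<in>{..<l}. c i * 2 = 0" unfolding e using c(1) by (subst (asm) sum_nonneg_eq_0_iff) auto
  thus "x = (\<lambda>j. 0)" using c(2) by simp
qed

lemma pair_rho2_Pos: "\<alpha> \<in> Pos \<Longrightarrow> pair n \<alpha> rho2 > 0"
  using pair_rho2_nneg[of \<alpha>] root_nonzero[of \<alpha>] by (fastforce simp: Pos_iff)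

text \<open>The axioms give such expansions for roots only. Since
  \<open>B \<alpha> \<alpha> > 0\<close>, some simple root has positive product with a non-simple
  \<alpha>; reflecting in it gives a positive root of smaller height, and reflecting the coroot back
  adds a nonnegative multiple of a simple coroot.\<close>

lemma cor_Pos_expand:
  "\<alpha> \<in> Pos \<Longrightarrow> \<exists>c::nat \<Rightarrow> int. (\<forall>i<l. c i \<ge> 0) \<and> cor \<alpha> = (\<lambda>j. \<Sum>i<l. c i * cor (simple i) j)"
proof (induction "nat (pair n \<alpha> rho2)" arbitrary: \<alpha> rule: less_induct)
  case less
  show ?case
  proof (cases "\<exists>i<l. \<alpha> = simple i")
    case True
    then obtain i where "i < l" "\<alpha> = simple i" by blast
    thus ?thesis
      by (intro exI[of _ "\<lambda>j. if j = i then 1 else 0"]) (auto simp: if_distrib[of "\<lambda>x. x * _"] cong: if_cong)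
  next
    case False
    have aR: "\<alpha> \<in> R" using less Pos_R by auto
    obtain c where c: "\<forall>i<l. c i \<ge> 0" "\<alpha> = (\<lambda>j. \<Sum>i<l. c i * simple i j)"
      using less(2) unfolding Pos_iff nneg_def by blast
    have "B \<alpha> \<alpha> = (\<Sum>i<l. c i * B \<alpha> (simple i))" by (subst (2) c(2)) simp
    hence "\<exists>i<l. c i * B \<alpha> (simple i) > 0" 
      using B_root_pos[OF aR] sum_nonpos[of "{..<l}" "\<lambda>i. c i * B \<alpha> (simple i)"] by force
    then obtain i where i: "i < l" "B \<alpha> (simple i) > 0" using c(1) by (metis mult_nonneg_nonpos not_le)
    let ?a = "simple i"
    have k: "pair n \<alpha> (cor ?a) > 0" using two_B[of ?a \<alpha>] i B_root_pos[of ?a]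
      by (metis simple_in_R zero_less_mult_pos mult_pos_pos zero_less_numeral)
    let ?b = "s ?a \<alpha>"
    have bP: "?b \<in> Pos" using refl_simple_Pos[OF i(1) less(2)] False i(1) by blast
    have "pair n ?b rho2 = pair n \<alpha> rho2 - pair n \<alpha> (cor ?a) * 2"
      unfolding refl_def using pair_simple_rho2[OF i(1)] by simp
    hence "nat (pair n ?b rho2) < nat (pair n \<alpha> rho2)" using k pair_rho2_Pos[OF less(2)] by linarith
    then obtain d where d: "\<forall>i<l. d i \<ge> 0" "cor ?b = (\<lambda>j. \<Sum>i<l. d i * cor (simple i) j)"
      using less(1)[OF _ bP] by blast
    have "pair n ?b (cor ?a) < 0" using k i(1) by (simp add: refl_def)
    hence m: "pair n ?a (cor ?b) \<le> 0" using pair_sgn_swap[of ?b ?a] i(1) bP Pos_R by force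
    have "cor \<alpha> = sc ?a (cor ?b)" using i(1) aR by (simp add: cor_refl)
    hence ca: "cor \<alpha> = (\<lambda>j. cor ?b j - pair n ?a (cor ?b) * cor ?a j)" by (simp add: corefl_def)
    define e where "e k = (if k = i then d k - pair n ?a (cor ?b) else d k)" for k
    have "(\<Sum>k<l. e k * cor (simple k) j) = cor \<alpha> j" for j
    proof -
      have "(\<Sum>k<l. e k * cor (simple k) j)
          = (\<Sum>k<l. d k * cor (simple k) j - (if k = i then pair n ?a (cor ?b) * cor (simple k) j else 0))"
        by (intro sum.cong) (auto simp: e_def algebra_simps)
      also have "\<dots> = cor ?b j - pair n ?a (cor ?b) * cor ?a j"
        using i(1) d(2) by (simp add: sum_subtractf fun_eq_iff)
      finally show ?thesis using ca by simp
    qed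
    moreover have "\<forall>k<l. e k \<ge> 0" using d(1) m by (auto simp: e_def)
    ultimately show ?thesis by (intro exI[of _ e]) auto
  qed
qed

subsection \<open>Affine roots and the alcove\<close>

abbreviation "Q \<equiv> corootlat n R cor"
abbreviation "C \<equiv> alcove n l R simple"

lemma isvec_alcove: "v \<in> C \<Longrightarrow> isvec n v" by (simp add: alcove_def)

lemma alcove_Pos: "v \<in> C \<Longrightarrow> \<alpha> \<in> Pos \<Longrightarrow> 0 < rpair n \<alpha> v \<and> rpair n \<alpha> v < 1"
  by (simp add: alcove_def)

lemma alcove_nonempty: obtains y where "y \<in> C"
proof -
  \<comment> \<open>\<open>M\<close> exceeds the height of every positive root, so
    \<open>rho2 / M\<close> takes values strictly between 0 and 1; the summand 1 keeps
    \<open>M\<close> positive when there are no roots.\<close>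
  define M where "M = 1 + (\<Sum>\<alpha>\<in>Pos. pair n \<alpha> rho2)"
  have le: "pair n \<alpha> rho2 < M" if "\<alpha> \<in> Pos" for \<alpha>
    unfolding M_def using member_le_sum[of \<alpha> Pos "\<lambda>\<alpha>. pair n \<alpha> rho2"] that pair_rho2_Pos
    by (simp add: less_imp_le)
  have M: "M > 0" unfolding M_def using pair_rho2_Pos
    by (intro add_pos_nonneg sum_nonneg) (auto simp: less_imp_le)
  have "(\<lambda>j. of_int (rho2 j) / of_int M) \<in> C"
    unfolding alcove_def using isvec_rho2 le pair_rho2_Pos M by (auto simp: isvec_def)
  thus ?thesis by (rule that)
qed

text \<open>The pair \<open>(\<alpha>, k)\<close> encodes the affine root \<open>v \<mapsto> \<alpha>(v) + k\<close>.\<close>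

definition aval :: "lat \<times> int \<Rightarrow> rvec \<Rightarrow> real" where
  "aval f v = rpair n (fst f) v + of_int (snd f)"

definition arefl :: "lat \<times> int \<Rightarrow> rvec \<Rightarrow> rvec" where
  "arefl f v = (\<lambda>j. v j - aval f v * of_int (cor (fst f) j))"

text \<open>The affine function \<open>f\<close> precomposed with the reflection in \<open>e\<close>
  (\<open>aval_ract\<close>), again written as gradient and constant.\<close>

definition ract :: "lat \<times> int \<Rightarrow> lat \<times> int \<Rightarrow> lat \<times> int" where
  "ract e f = (s (fst e) (fst f), snd f - snd e * pair n (fst f) (cor (fst e)))"

definition affine_roots :: "(lat \<times> int) set" where "affine_roots = {f. fst f \<in> R}"

definition aneg :: "lat \<times> int \<Rightarrow> lat \<times> int" where "aneg f = ((\<lambda>j. - fst f j), - snd f)"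

text \<open>Elements of the affine Weyl group are represented by words in reflections, so that
  induction on word length is available.\<close>

definition act :: "(lat \<times> int) list \<Rightarrow> rvec \<Rightarrow> rvec" where "act fs v = foldr arefl fs v"

lemma act_simps [simp]: "act [] v = v" "act (e # fs) v = arefl e (act fs v)"
  "act (fs @ gs) v = act fs (act gs v)"
  by (simp_all add: act_def)

lemma aval_arefl: "aval f (arefl e v) = aval f v - aval e v * of_int (pair n (fst f) (cor (fst e)))"
  by (simp add: arefl_def aval_def)

lemma aval_ract: "aval (ract e f) v = aval f (arefl e v)"
  unfolding aval_arefl by (simp add: aval_def ract_def refl_def) (simp add: algebra_simps)

lemma aval_aneg [simp]: "aval (aneg f) v = - aval f v" by (simp add: aval_def aneg_def)

lemma aval_arefl_self: "e \<in> affine_roots \<Longrightarrow> aval e (arefl e v) = - aval e v"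
  by (simp add: aval_arefl affine_roots_def)

lemma arefl_arefl [simp]: "e \<in> affine_roots \<Longrightarrow> arefl e (arefl e v) = v"
  by (rule ext) (simp add: arefl_def[of e "arefl e v"] aval_arefl_self, simp add: arefl_def)

lemma ract_in_affine_roots [simp]: "e \<in> affine_roots \<Longrightarrow> f \<in> affine_roots \<Longrightarrow> ract e f \<in> affine_roots" by (simp add: affine_roots_def ract_def)

lemma aneg_in_affine_roots [simp]: "f \<in> affine_roots \<Longrightarrow> aneg f \<in> affine_roots" by (simp add: affine_roots_def aneg_def)

lemma ract_self: "e \<in> affine_roots \<Longrightarrow> ract e e = aneg e"
  by (simp add: affine_roots_def ract_def aneg_def refl_self)

lemma ract_ract [simp]: "e \<in> affine_roots \<Longrightarrow> ract e (ract e f) = f"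
  by (cases f) (simp add: affine_roots_def ract_def pair_refl, simp add: corefl_def)

lemma arefl_aneg: "f \<in> affine_roots \<Longrightarrow> arefl (aneg f) = arefl f"
  by (intro ext) (simp add: arefl_def aneg_def affine_roots_def cor_uminus, simp add: aval_def algebra_simps)

lemma arefl_conj: assumes "e \<in> affine_roots" "f \<in> affine_roots"
  shows "arefl (ract e f) v = arefl e (arefl f (arefl e v))"
proof
  fix j
  let ?u = "arefl e v"
  have "arefl e (arefl f ?u) j = arefl e ?u j - aval f ?u * of_int (sc (fst e) (cor (fst f)) j)"
    unfolding arefl_def[of e "arefl f ?u"] arefl_def[of e ?u] aval_arefl[of e f]
    by (simp add: arefl_def[of f ?u] corefl_def algebra_simps)
  also have "\<dots> = v j - aval (ract e f) v * of_int (cor (fst (ract e f)) j)"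
    using assms by (simp add: aval_ract) (simp add: ract_def affine_roots_def cor_refl)
  finally show "arefl (ract e f) v j = arefl e (arefl f ?u) j" by (simp add: arefl_def[of "ract e f"])
qed

lemma isvec_arefl: "e \<in> affine_roots \<Longrightarrow> isvec n v \<Longrightarrow> isvec n (arefl e v)"
  using isvec_cor by (auto simp: affine_roots_def arefl_def isvec_def)

text \<open>These are the affine roots that are positive on the alcove. A negative gradient needs
  constant at least 1, because positive roots stay below 1 there.\<close>

definition apos :: "lat \<times> int \<Rightarrow> bool" where
  "apos f \<longleftrightarrow> fst f \<in> Pos \<and> snd f \<ge> 0 \<or> (\<lambda>j. - fst f j) \<in> Pos \<and> snd f \<ge> 1"

lemma apos_affine_roots: "apos f \<Longrightarrow> f \<in> affine_roots"
  using uminus_in_R[of "\<lambda>j. - fst f j"] by (auto simp: apos_def affine_roots_def Pos_R)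

lemma apos_or_aneg: "f \<in> affine_roots \<Longrightarrow> apos f \<or> apos (aneg f)"
  using Pos_or_uminus[of "fst f"] by (auto simp: apos_def affine_roots_def aneg_def)

lemma apos_snd: "apos f \<Longrightarrow> snd f \<ge> 0" by (auto simp: apos_def)

lemma aval_apos: assumes "apos f" "v \<in> C" shows "aval f v > 0"
  using assms(1) unfolding apos_def
proof
  assume "fst f \<in> Pos \<and> snd f \<ge> 0" thus ?thesis using alcove_Pos[OF assms(2)] by (simp add: aval_def add_pos_nonneg)
next
  assume "(\<lambda>j. - fst f j) \<in> Pos \<and> snd f \<ge> 1"
  moreover from this have "- rpair n (fst f) v < 1" using alcove_Pos[OF assms(2), of "\<lambda>j. - fst f j"] by simp
  moreover have "real_of_int (snd f) \<ge> 1" using calculation by simp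
  ultimately show ?thesis unfolding aval_def by linarith
qed

lemma not_apos_aneg: assumes "apos f" shows "\<not> apos (aneg f)"
proof -
  obtain y where "y \<in> C" by (rule alcove_nonempty)
  thus ?thesis using aval_apos[OF assms] aval_apos[of "aneg f" y] by fastforce
qed

lemma aval_alcove_nonzero: "f \<in> affine_roots \<Longrightarrow> v \<in> C \<Longrightarrow> aval f v \<noteq> 0"
  using apos_or_aneg[of f] aval_apos[of f v] aval_apos[of "aneg f" v] by auto

lemma alcoveI: assumes "isvec n x" "\<And>f. apos f \<Longrightarrow> aval f x > 0" shows "x \<in> C"
proof -
  have "0 < rpair n \<alpha> x \<and> rpair n \<alpha> x < 1" if "\<alpha> \<in> Pos" for \<alpha>
    using assms(2)[of "(\<alpha>, 0)"] assms(2)[of "(\<lambda>j. - \<alpha> j, 1)"] that by (auto simp: apos_def aval_def)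
  thus ?thesis using assms(1) by (simp add: alcove_def)
qed

text \<open>With \<open>c = 0\<close> these are the hyperplanes separating \<open>x\<close> from the
  alcove. With \<open>c = aval f y\<close> for an alcove point \<open>y\<close> their number
  measures how deep the affine root \<open>f\<close> is.\<close>

definition negset :: "rvec \<Rightarrow> real \<Rightarrow> (lat \<times> int) set" where
  "negset x c = {f. apos f \<and> aval f x < c}"

lemma finite_negset [simp]: "finite (negset x c)"
proof (rule finite_subset)
  show "negset x c \<subseteq> Sigma R (\<lambda>\<alpha>. {0..\<lceil>c - rpair n \<alpha> x\<rceil>})"
  proof
    fix f assume "f \<in> negset x c"
    hence "apos f" "aval f x < c" by (auto simp: negset_def)
    moreover from this have "real_of_int (snd f) \<le> c - rpair n (fst f) x" by (simp add: aval_def)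
    hence "snd f \<le> \<lceil>c - rpair n (fst f) x\<rceil>" by linarith
    ultimately show "f \<in> Sigma R (\<lambda>\<alpha>. {0..\<lceil>c - rpair n \<alpha> x\<rceil>})"
      using apos_affine_roots[of f] apos_snd[of f] by (cases f) (auto simp: affine_roots_def)
  qed
qed (intro finite_SigmaI finite_R, simp)

text \<open>An affine root is simple if it spans a wall of the alcove: reflecting in it changes the sign
  of no other affine root.\<close>

definition asimple :: "lat \<times> int \<Rightarrow> bool" where
  "asimple e \<longleftrightarrow> apos e \<and> (\<forall>f. apos f \<longrightarrow> f \<noteq> e \<longrightarrow> apos (ract e f))"

lemma asimple_ract: "asimple e \<Longrightarrow> apos f \<Longrightarrow> f \<noteq> e \<Longrightarrow> apos (ract e f)"
  unfolding asimple_def by blast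

lemma asimple_affine_roots: "asimple e \<Longrightarrow> e \<in> affine_roots" by (simp add: asimple_def apos_affine_roots)

text \<open>The expression vanishes when the segment from the moved \<open>y\<close> to
  \<open>x\<close> meets both hyperplanes at the same point. Moving \<open>y\<close> along the curve
  (t, t^2, ...) puts each coordinate of the combined gradient into its own coefficient. If all of
  these were zero, the gradients would be proportional with positive factors, hence equal, and then
  so would the constants.\<close>

lemma ratio_polynomial_nonzero:
  assumes f: "f1 \<in> affine_roots" "f2 \<in> affine_roots" "f1 \<noteq> f2" and neg: "aval f1 x < 0" "aval f2 x < 0"
  obtains p :: "real poly" where "p \<noteq> 0"
    "\<And>t. poly p t = aval f2 x * aval f1 (\<lambda>j. y j + t ^ Suc j) - aval f1 x * aval f2 (\<lambda>j. y j + t ^ Suc j)"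
proof -
  define c where "c j = aval f2 x * of_int (fst f1 j) - aval f1 x * of_int (fst f2 j)" for j
  define k where "k = aval f2 x * aval f1 y - aval f1 x * aval f2 y"
  define p where "p = [:k:] + (\<Sum>j<n. monom (c j) (Suc j))"
  have av: "aval f (\<lambda>j. y j + t ^ Suc j) = aval f y + (\<Sum>j<n. of_int (fst f j) * t ^ Suc j)" for f t
    by (simp add: aval_def) (simp add: rpair_def sum_distrib_left mult_ac)
  have "poly p t = aval f2 x * aval f1 (\<lambda>j. y j + t ^ Suc j) - aval f1 x * aval f2 (\<lambda>j. y j + t ^ Suc j)" for t
    unfolding av p_def k_def c_def
    by (simp add: poly_sum poly_monom algebra_simps sum_subtractf sum.distrib sum_distrib_left)
  moreover have "p \<noteq> 0"
  proof
    assume "p = 0"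
    have cp: "coeff p (Suc j) = c j" if "j < n" for j
      using that by (simp add: p_def coeff_sum)
    have c0: "c j = 0" if "j < n" for j using cp[OF that] \<open>p = 0\<close> by simp
    have eq: "fst f1 = fst f2"
    proof (rule root_multiple_eq[of _ _ "- aval f2 x" "- aval f1 x"])
      fix j assume "j < n"
      thus "- aval f2 x * real_of_int (fst f1 j) = - aval f1 x * real_of_int (fst f2 j)"
        using c0[of j] by (simp add: c_def)
    qed (use f neg in \<open>auto simp: affine_roots_def\<close>)
    have "fst f1 \<noteq> (\<lambda>j. 0)" "isvec n (fst f1)"
      using f root_nonzero isvec_root by (auto simp: affine_roots_def)
    then obtain j where j: "j < n" "fst f1 j \<noteq> 0" unfolding isvec_def by (metis not_le ext)
    have "aval f1 x = aval f2 x" using c0[OF j(1)] j(2) eq by (simp add: c_def)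
    hence "snd f1 = snd f2" using eq by (simp add: aval_def)
    thus False using eq f(3) by (simp add: prod_eq_iff)
  qed
  ultimately show ?thesis using that by blast
qed

text \<open>The alcove is open, so the curve stays in it for small positive t, and each of the
  finitely many pairs of hyperplanes excludes only the finitely many roots of a nonzero
  polynomial.\<close>

lemma generic_alcove_point:
  obtains y where "y \<in> C"
    "\<And>f1 f2. f1 \<in> negset x 0 \<Longrightarrow> f2 \<in> negset x 0 \<Longrightarrow> f1 \<noteq> f2 \<Longrightarrow> aval f2 x * aval f1 y \<noteq> aval f1 x * aval f2 y"
proof -
  obtain y0 where y0: "y0 \<in> C" by (rule alcove_nonempty)
  define m where "m t = (\<lambda>j. y0 j + t ^ Suc j)" for t :: real
  have lim: "((\<lambda>t. rpair n \<alpha> (m t)) \<longlongrightarrow> rpair n \<alpha> y0) (at_right 0)" for \<alpha>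
  proof -
    have "((\<lambda>t. rpair n \<alpha> (m t)) \<longlongrightarrow> (\<Sum>i<n. of_int (\<alpha> i) * (y0 i + 0 ^ Suc i))) (at_right 0)"
      unfolding rpair_def m_def by (intro tendsto_intros)
    thus ?thesis by (simp add: rpair_def)
  qed
  have "\<forall>\<^sub>F t in at_right 0. \<forall>\<alpha>\<in>Pos. 0 < rpair n \<alpha> (m t) \<and> rpair n \<alpha> (m t) < 1"
    using alcove_Pos[OF y0]
    by (intro eventually_ball_finite ballI eventually_conj order_tendstoD[OF lim]) auto
  then obtain \<epsilon> where eps: "\<epsilon> > 0"
    "\<And>t. 0 < t \<Longrightarrow> t < \<epsilon> \<Longrightarrow> \<forall>\<alpha>\<in>Pos. 0 < rpair n \<alpha> (m t) \<and> rpair n \<alpha> (m t) < 1"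
    unfolding eventually_at_right_field by auto
  define D where "D = {(f1, f2). f1 \<in> negset x 0 \<and> f2 \<in> negset x 0 \<and> f1 \<noteq> f2}"
  define bad where "bad d = {t. aval (snd d) x * aval (fst d) (m t) = aval (fst d) x * aval (snd d) (m t)}" for d
  have "finite D" unfolding D_def
    by (rule finite_subset[of _ "negset x 0 \<times> negset x 0"]) auto
  moreover have "finite (bad d)" if "d \<in> D" for d
  proof -
    obtain f1 f2 where d: "d = (f1, f2)" by (cases d)
    obtain p :: "real poly" where "p \<noteq> 0"
      "\<And>t. poly p t = aval f2 x * aval f1 (m t) - aval f1 x * aval f2 (m t)"
    proof (rule ratio_polynomial_nonzero[of f1 f2 x y0, folded m_def])
      show "f1 \<in> affine_roots" and "f2 \<in> affine_roots" and "f1 \<noteq> f2" and "aval f1 x < 0" and "aval f2 x < 0"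
        using \<open>d \<in> D\<close> by (simp_all add: D_def d negset_def apos_affine_roots)
    qed blast
    thus ?thesis using poly_roots_finite[of p] by (simp add: bad_def d)
  qed
  ultimately have "finite (\<Union>d\<in>D. bad d)" by auto
  moreover have "infinite {0<..<\<epsilon>}" using eps(1) infinite_Ioo by auto
  ultimately obtain t where t: "t \<in> {0<..<\<epsilon>}" "t \<notin> (\<Union>d\<in>D. bad d)"
    by (meson finite_subset subsetI)
  \<comment> \<open>The curve has nonzero coordinates beyond \<open>n\<close> as well. Cutting them
    off gives the support condition of \<open>alcove\<close> and changes no pairing.\<close>
  define y where "y = (\<lambda>j. if j < n then m t j else 0)"
  have ry: "rpair n a y = rpair n a (m t)" for a by (simp add: rpair_def y_def)
  have av: "aval f y = aval f (m t)" for f by (simp add: aval_def ry)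
  have "isvec n y" by (simp add: isvec_def y_def)
  hence "y \<in> C" using eps(2) t(1) by (simp add: alcove_def ry)
  moreover have "aval f2 x * aval f1 y \<noteq> aval f1 x * aval f2 y"
    if "f1 \<in> negset x 0" "f2 \<in> negset x 0" "f1 \<noteq> f2" for f1 f2
  proof -
    have "(f1, f2) \<in> D" using that by (simp add: D_def)
    hence "t \<notin> bad (f1, f2)" using t(2) by blast
    thus ?thesis by (simp add: bad_def av)
  qed
  ultimately show ?thesis using that by blast
qed

text \<open>Walking from a generic point of the alcove to \<open>x\<close>, the first hyperplane crossed is crossed
  alone, so it is a wall.\<close>

lemma simple_separating:
  assumes reg: "\<And>f. f \<in> affine_roots \<Longrightarrow> aval f x \<noteq> 0" and ne: "negset x 0 \<noteq> {}"
  shows "\<exists>e. asimple e \<and> aval e x < 0"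
proof -
  let ?F = "negset x 0"
  obtain y where y: "y \<in> C" and gen: "\<And>f1 f2. f1 \<in> ?F \<Longrightarrow> f2 \<in> ?F \<Longrightarrow> f1 \<noteq> f2 \<Longrightarrow>
      aval f2 x * aval f1 y \<noteq> aval f1 x * aval f2 y"
    using generic_alcove_point by metis
  \<comment> \<open>The segment from \<open>y\<close> to \<open>x\<close> crosses the hyperplane of
    \<open>f\<close> at parameter \<open>r f / (1 + r f)\<close>, so the smallest \<open>r\<close>
    belongs to the first crossing; \<open>p\<close> below is that crossing point.\<close>
  define r where "r f = aval f y / - aval f x" for f
  have "Min (r ` ?F) \<in> r ` ?F" using ne by (intro Min_in) auto
  then obtain e where e: "e \<in> ?F" "r e = Min (r ` ?F)" by auto
  have emin: "r e \<le> r f" if "f \<in> ?F" for f unfolding e(2) using that by (intro Min_le) auto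
  have ex: "apos e" "aval e x < 0" using e by (auto simp: negset_def)
  have ey: "aval e y > 0" using aval_apos ex y by auto
  define t where "t = aval e y / (aval e y - aval e x)"
  have t: "0 < t" "t < 1" using ex ey by (auto simp: t_def field_simps)
  define p where "p = (\<lambda>j. y j + t * (x j - y j))"
  have ap: "aval f p = (1 - t) * aval f y + t * aval f x" for f
    by (simp add: p_def aval_def algebra_simps)
  have ep: "aval e p = 0" unfolding ap t_def using ex ey by (simp add: field_simps)
  have pos: "aval f p > 0" if "apos f" "f \<noteq> e" for f
  proof (cases "aval f x < 0")
    case False
    thus ?thesis unfolding ap using t aval_apos[OF that(1) y] by (simp add: add_pos_nonneg)
  next
    case True
    hence fF: "f \<in> ?F" using that by (simp add: negset_def)
    have "aval e y / - aval e x \<le> aval f y / - aval f x" using emin[OF fF] by (simp add: r_def)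
    hence "aval e y * - aval f x \<le> aval f y * - aval e x" using ex(2) True by (simp add: field_simps)
    moreover have "aval e y * - aval f x \<noteq> aval f y * - aval e x"
      using gen[OF fF e(1) that(2)] by (simp add: mult.commute)
    ultimately have "aval f y * - aval e x + aval e y * aval f x > 0" by simp
    moreover have "1 - t = - aval e x / (aval e y - aval e x)" using ex ey by (simp add: t_def field_simps)
    hence "aval f p = (aval f y * - aval e x + aval e y * aval f x) / (aval e y - aval e x)"
      unfolding ap by (simp add: t_def add_divide_distrib diff_divide_distrib mult.commute)
    ultimately show ?thesis using ex ey by simp
  qed
  \<comment> \<open>At \<open>p\<close> only \<open>e\<close> vanishes and all other positive affine
    roots are positive. Since \<open>p\<close> is fixed by the reflection, \<open>ract e f\<close>
    is positive there, so its negative cannot be a positive affine root.\<close>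
  have "apos (ract e f)" if f: "apos f" "f \<noteq> e" for f
  proof (rule ccontr)
    assume no: "\<not> apos (ract e f)"
    have "arefl e p = p" using ep by (simp add: arefl_def)
    hence "aval (ract e f) p > 0" using pos[OF f] by (simp add: aval_ract)
    moreover have "apos (aneg (ract e f))"
      using no apos_or_aneg[OF ract_in_affine_roots[OF apos_affine_roots[OF ex(1)] apos_affine_roots[OF f(1)]]] by blast
    hence "aval (aneg (ract e f)) p \<ge> 0"
      using pos[of "aneg (ract e f)"] ep by (metis less_imp_le order_refl)
    ultimately show False by simp
  qed
  thus ?thesis using ex unfolding asimple_def by blast
qed

lemma aval_arefl_nonzero:
  "(\<And>f. f \<in> affine_roots \<Longrightarrow> aval f x \<noteq> 0) \<Longrightarrow> e \<in> affine_roots \<Longrightarrow> f \<in> affine_roots \<Longrightarrow> aval f (arefl e x) \<noteq> 0"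
  by (simp add: aval_ract[symmetric])

text \<open>Reflecting in a separating wall \<open>e\<close> lowers the number of separating
  hyperplanes: \<open>ract e\<close> maps those of the reflected point injectively to those of
  \<open>x\<close> other than \<open>e\<close>.\<close>

lemma reach_alcove:
  assumes "isvec n x" "\<And>f. f \<in> affine_roots \<Longrightarrow> aval f x \<noteq> 0"
  shows "\<exists>fs. set fs \<subseteq> affine_roots \<and> act fs x \<in> C"
  using assms
proof (induction "card (negset x 0)" arbitrary: x rule: less_induct)
  case less
  show ?case
  proof (cases "negset x 0 = {}")
    case True
    have "aval f x > 0" if "apos f" for f
      using True that less(3)[OF apos_affine_roots[OF that]] by (fastforce simp: negset_def)
    hence "x \<in> C" using less by (intro alcoveI) auto
    thus ?thesis by (intro exI[of _ "[]"]) simp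
  next
    case False
    then obtain e where e: "asimple e" "aval e x < 0" using simple_separating less(3) by blast
    let ?x = "arefl e x"
    have eA: "e \<in> affine_roots" using asimple_affine_roots e by auto
    have "e \<in> negset x 0" using e by (simp add: negset_def asimple_def)
    have "ract e ` negset ?x 0 \<subseteq> negset x 0 - {e}"
    proof
      fix g assume "g \<in> ract e ` negset ?x 0"
      then obtain f where f: "apos f" "aval f ?x < 0" "g = ract e f" by (auto simp: negset_def)
      have "f \<noteq> e" using f(2) e(2) aval_arefl_self[OF eA] by auto
      hence "apos g" using e f by (simp add: asimple_ract)
      moreover have "g \<noteq> e"
      proof
        assume "g = e"
        hence "f = aneg e" using ract_ract[OF eA, of f] f(3) ract_self[OF eA] by simp
        thus False using f(1) e(1) not_apos_aneg by (auto simp: asimple_def)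
      qed
      ultimately show "g \<in> negset x 0 - {e}" using f by (simp add: negset_def aval_ract)
    qed
    moreover have "inj_on (ract e) (negset ?x 0)" by (rule inj_on_inverseI[of _ "ract e"]) (simp add: eA)
    ultimately have "card (negset ?x 0) \<le> card (negset x 0 - {e})" by (intro card_inj_on_le) auto
    also have "\<dots> < card (negset x 0)" using \<open>e \<in> negset x 0\<close> by (intro psubset_card_mono) auto
    finally obtain fs where "set fs \<subseteq> affine_roots" "act fs ?x \<in> C"
      using less(1)[of ?x] isvec_arefl[OF eA less(2)] aval_arefl_nonzero[OF less(3) eA] by blast
    thus ?thesis using eA by (intro exI[of _ "fs @ [e]"]) auto
  qed
qed

text \<open>Induction on depth. If \<open>f\<close> is not a wall, some wall \<open>e\<close>
  separates the mirror image of \<open>y\<close> in \<open>f\<close> from the alcove. Then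
  \<open>e\<close> and \<open>f\<close> have positive Cartan numbers, so \<open>ract e f\<close> has
  a smaller value at \<open>y\<close>, and the reflection in \<open>f\<close> is conjugate by
  \<open>e\<close> to the one in \<open>ract e f\<close>.\<close>

lemma refl_simple_word:
  assumes "apos f" shows "\<exists>fs. set fs \<subseteq> Collect asimple \<and> act fs = arefl f"
proof -
  obtain y where y: "y \<in> C" by (rule alcove_nonempty)
  show ?thesis using assms
  proof (induction "card (negset y (aval f y))" arbitrary: f rule: less_induct)
    case less
    show ?case
    proof (cases "asimple f")
      case True thus ?thesis by (intro exI[of _ "[f]"]) auto
    next
      case False
      have fA: "f \<in> affine_roots" using less(2) apos_affine_roots by auto
      let ?x = "arefl f y"
      have "aval f ?x < 0" using aval_arefl_self[OF fA] aval_apos[OF less(2) y] by simp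
      hence "f \<in> negset ?x 0" using less(2) by (simp add: negset_def)
      hence "negset ?x 0 \<noteq> {}" by blast
      then obtain e where e: "asimple e" "aval e ?x < 0"
        using simple_separating[of ?x] aval_arefl_nonzero[OF aval_alcove_nonzero[OF _ y] fA] by blast
      have eA: "e \<in> affine_roots" and ep: "apos e" using asimple_affine_roots e by (auto simp: asimple_def)
      have "aval f y * of_int (pair n (fst e) (cor (fst f))) > 0"
        using e(2) aval_apos[OF ep y] by (simp add: aval_arefl)
      hence "pair n (fst e) (cor (fst f)) > 0" using aval_apos[OF less(2) y]
        by (simp add: zero_less_mult_iff)
      hence "pair n (fst f) (cor (fst e)) > 0"
        using pair_sgn_swap eA fA by (auto simp: affine_roots_def)
      hence lt: "aval (ract e f) y < aval f y"
        using aval_apos[OF ep y] by (simp add: aval_ract aval_arefl)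
      let ?g = "ract e f"
      have gp: "apos ?g" using e(1) less(2) False by (intro asimple_ract) auto
      \<comment> \<open>Strict because \<open>?g\<close> itself lies in the larger set only.\<close>
      have "negset y (aval ?g y) \<subset> negset y (aval f y)"
        using lt gp by (fastforce simp: negset_def)
      hence "card (negset y (aval ?g y)) < card (negset y (aval f y))" by (intro psubset_card_mono) auto
      then obtain fs where fs: "set fs \<subseteq> Collect asimple" "act fs = arefl ?g" using less(1) gp by blast
      have "arefl f v = act (e # fs @ [e]) v" for v
        using arefl_conj[OF eA, of ?g v] fs(2) eA fA by simp
      thus ?thesis using fs(1) e(1) by (intro exI[of _ "e # fs @ [e]"]) auto
    qed
  qed
qed

section \<open>Words in wall reflections\<close>

lemma word_simple:
  "set fs \<subseteq> affine_roots \<Longrightarrow> \<exists>gs. set gs \<subseteq> Collect asimple \<and> act gs = act fs"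
proof (induction fs)
  case Nil show ?case by (intro exI[of _ "[]"]) simp
next
  case (Cons f fs)
  then obtain gs where gs: "set gs \<subseteq> Collect asimple" "act gs = act fs" by auto
  have "\<exists>hs. set hs \<subseteq> Collect asimple \<and> act hs = arefl f"
    using apos_or_aneg[of f] refl_simple_word[of f] refl_simple_word[of "aneg f"] Cons(2) arefl_aneg[of f] by auto
  then obtain hs where "set hs \<subseteq> Collect asimple" "act hs = arefl f" by auto
  thus ?case using gs by (intro exI[of _ "hs @ gs"]) auto
qed

text \<open>Pull \<open>e\<close> back through the letters. A wall reflection keeps a positive
  affine root positive unless it is that wall's own root. As the final pullback is negative at
  \<open>y\<close>, the root must equal the current letter at some point, and that letter
  cancels.\<close>

lemma exchange:
  assumes "set fs \<subseteq> Collect asimple" "apos e" "y \<in> C" "aval e (act fs y) < 0"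
  shows "\<exists>zs. set zs \<subseteq> Collect asimple \<and> length zs < length fs \<and> (\<forall>v. arefl e (act fs v) = act zs v)"
  using assms
proof (induction fs arbitrary: e)
  case Nil thus ?case using aval_apos[of e y] by simp
next
  case (Cons f fs)
  have f: "asimple f" "f \<in> affine_roots" using Cons asimple_affine_roots by auto
  have eA: "e \<in> affine_roots" using Cons apos_affine_roots by auto
  show ?case
  proof (cases "e = f")
    case True thus ?thesis using Cons f by (intro exI[of _ fs]) auto
  next
    case False
    let ?e = "ract f e"
    have "apos ?e" using f Cons False by (intro asimple_ract) auto
    moreover have "aval ?e (act fs y) < 0" using Cons(5) by (simp add: aval_ract)
    moreover have "set fs \<subseteq> Collect asimple" using Cons by simp
    ultimately obtain zs where zs: "set zs \<subseteq> Collect asimple" "length zs < length fs"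
      "\<forall>v. arefl ?e (act fs v) = act zs v" using Cons.IH[of ?e] Cons.prems by blast
    have "arefl e (act (f # fs) v) = act (f # zs) v" for v
      using zs(3)[rule_format, of v, symmetric] arefl_conj[OF f(2) eA] f(2) by simp
    thus ?thesis using zs f by (intro exI[of _ "f # zs"]) auto
  qed
qed

text \<open>The first letter is positive at the image point, hence negative once it is removed, so
  the exchange lemma shortens any nonempty word with this property. The shortening ends at the empty
  word.\<close>

lemma simple_word_free:
  assumes "set fs \<subseteq> Collect asimple" "y \<in> C" "act fs y \<in> C"
  shows "act fs v = v"
  using assms
proof (induction "length fs" arbitrary: fs rule: less_induct)
  case less
  show ?case
  proof (cases fs)
    case (Cons f gs)
    hence f: "asimple f" "f \<in> affine_roots" "apos f" using less asimple_affine_roots by (auto simp: asimple_def)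
    have "aval f (act gs y) < 0"
      using aval_apos[OF f(3) less(4)] by (simp add: Cons aval_arefl_self f)
    then obtain zs where zs: "set zs \<subseteq> Collect asimple" "length zs < length gs"
      "\<forall>v. arefl f (act gs v) = act zs v"
      using exchange[of gs f y] less f Cons by auto
    hence "act fs = act zs" using Cons by (simp add: fun_eq_iff)
    thus ?thesis using less(1)[of zs] zs less(3,4) Cons by simp
  qed simp
qed

section \<open>Words as pairs of an element of \<open>W\<close> and a coroot translation\<close>

lemma word_affine:
  assumes "set fs \<subseteq> affine_roots"
  shows "\<exists>w\<in>W. \<exists>q\<in>Q. \<forall>v. isvec n v \<longrightarrow> act fs v = (\<lambda>j. wR n w v j + of_int (q j))"
  using assms
proof (induction fs)
  case Nil
  show ?case
    by (intro bexI[OF _ weyl.weyl_id] bexI[OF _ corootlat_0]) (simp add: wR_id[unfolded id_def])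
next
  case (Cons f fs)
  then obtain w q where w: "w \<in> W" "q \<in> Q" "\<And>v. isvec n v \<Longrightarrow> act fs v = (\<lambda>j. wR n w v j + of_int (q j))"
    by auto
  obtain \<alpha> k where f: "f = (\<alpha>, k)" "\<alpha> \<in> R" using Cons by (cases f) (auto simp: affine_roots_def)
  let ?q = "\<lambda>j. sc \<alpha> q j - k * cor \<alpha> j"
  have "act (f # fs) v = (\<lambda>j. wR n (sc \<alpha> \<circ> w) v j + of_int (?q j))" if v: "isvec n v" for v
  proof -
    have "wR n (sc \<alpha> \<circ> w) v = (\<lambda>j. wR n w v j - rpair n \<alpha> (wR n w v) * of_int (cor \<alpha> j))"
      by (subst wR_comp) (simp_all add: w f corefl_in_W wR_corefl)
    thus ?thesis using w(3)[OF v] by (simp add: f arefl_def aval_def corefl_def algebra_simps)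
  qed
  hence "\<forall>v. isvec n v \<longrightarrow> act (f # fs) v = (\<lambda>j. wR n (sc \<alpha> \<circ> w) v j + of_int (?q j))" by (intro allI impI)
  moreover have "?q \<in> Q" using w f by (intro corootlat_diff corootlat_scale corootlat_corefl cor_in_corootlat)
  moreover have "sc \<alpha> \<circ> w \<in> W" using w f by (intro weyl.weyl_step)
  ultimately show ?case by (rule bexI[where x="sc \<alpha> \<circ> w", OF bexI[where x="?q"]])
qed

lemma linear_word: "w \<in> W \<Longrightarrow> \<exists>fs. set fs \<subseteq> affine_roots \<and> (\<forall>v. isvec n v \<longrightarrow> act fs v = wR n w v)"
proof (induction rule: weyl.induct)
  case weyl_id show ?case by (intro exI[of _ "[]"]) (simp add: wR_id[unfolded id_def])
next
  case (weyl_step w \<alpha>)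
  then obtain fs where fs: "set fs \<subseteq> affine_roots" "\<And>v. isvec n v \<Longrightarrow> act fs v = wR n w v" by auto
  have "act ((\<alpha>, 0) # fs) v = wR n (sc \<alpha> \<circ> w) v" if "isvec n v" for v
    by (subst wR_comp) (use weyl_step fs that in \<open>simp_all add: corefl_in_W wR_corefl arefl_def aval_def\<close>)
  moreover have "set ((\<alpha>, 0) # fs) \<subseteq> affine_roots" using fs(1) weyl_step by (simp add: affine_roots_def)
  ultimately show ?case by blast
qed

lemma translation_word:
  assumes "q \<in> Q" shows "\<exists>fs. set fs \<subseteq> affine_roots \<and> (\<forall>v. act fs v = (\<lambda>j. v j + of_int (q j)))"
proof -
  obtain c where q: "q = (\<lambda>j. \<Sum>\<alpha>\<in>R. c \<alpha> * cor \<alpha> j)" using assms by (auto simp: corootlat_def)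
  have "\<exists>fs. set fs \<subseteq> affine_roots \<and> (\<forall>v. act fs v = (\<lambda>j. v j + of_int (\<Sum>\<alpha>\<in>A. c \<alpha> * cor \<alpha> j)))"
    if "finite A" "A \<subseteq> R" for A
    using that
  proof (induction A rule: finite_induct)
    case empty show ?case by (intro exI[of _ "[]"]) simp
  next
    case (insert \<alpha> A)
    then obtain fs where fs: "set fs \<subseteq> affine_roots" "\<forall>v. act fs v = (\<lambda>j. v j + of_int (\<Sum>\<alpha>\<in>A. c \<alpha> * cor \<alpha> j))" by auto
    \<comment> \<open>Reflections in two parallel hyperplanes compose to a translation along the
      coroot; the constant \<open>- c \<alpha>\<close> gives it length
      \<open>c \<alpha>\<close>.\<close>
    let ?gs = "[(\<alpha>, - c \<alpha>), (\<alpha>, 0)]"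
    have "act ?gs v = (\<lambda>j. v j + of_int (c \<alpha> * cor \<alpha> j))" for v
      using insert by (simp add: arefl_def aval_def algebra_simps)
    hence "act (?gs @ fs) v = (\<lambda>j. v j + of_int (\<Sum>\<alpha>\<in>insert \<alpha> A. c \<alpha> * cor \<alpha> j))" for v
      unfolding act_simps(3) using fs(2) insert by (simp add: add_ac)
    thus ?case using fs(1) insert by (intro exI[of _ "?gs @ fs"]) (auto simp: affine_roots_def)
  qed
  thus ?thesis unfolding q by simp
qed

lemma affine_weyl_transitive:
  assumes "isvec n x" "\<And>\<alpha>. \<alpha> \<in> R \<Longrightarrow> rpair n \<alpha> x \<notin> \<int>"
  shows "\<exists>w\<in>W. \<exists>q\<in>Q. (\<lambda>j. wR n w x j + of_int (q j)) \<in> C"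
proof -
  have "aval f x \<noteq> 0" if "f \<in> affine_roots" for f
  proof
    assume "aval f x = 0"
    hence "rpair n (fst f) x = of_int (- snd f)" by (simp add: aval_def)
    thus False using assms(2)[of "fst f"] that by (auto simp: affine_roots_def simp del: of_int_minus)
  qed
  then obtain fs where "set fs \<subseteq> affine_roots" "act fs x \<in> C" using reach_alcove assms by blast
  thus ?thesis using word_affine[of fs] assms(1) by metis
qed

text \<open>Written as a word in wall reflections, the map is the identity by
  \<open>simple_word_free\<close>. Evaluating it at 0 isolates \<open>q\<close>, and at the unit
  vectors it determines \<open>w\<close>.\<close>

lemma affine_weyl_free:
  assumes "w \<in> W" "q \<in> Q" "y \<in> C" "(\<lambda>j. wR n w y j + of_int (q j)) \<in> C"
  shows "w = id" "q = (\<lambda>j. 0)"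
proof -
  obtain fs gs where fs: "set fs \<subseteq> affine_roots" "\<And>v. isvec n v \<Longrightarrow> act fs v = wR n w v"
    and gs: "set gs \<subseteq> affine_roots" "\<And>v. act gs v = (\<lambda>j. v j + of_int (q j))"
    using linear_word translation_word assms by metis
  have "set (gs @ fs) \<subseteq> affine_roots" using fs gs by simp
  then obtain hs where hs: "set hs \<subseteq> Collect asimple" "act hs = act (gs @ fs)" using word_simple by metis
  have h: "act hs v = (\<lambda>j. wR n w v j + of_int (q j))" if "isvec n v" for v
    using hs(2) fs(2) gs(2) that by simp
  have "act hs v = v" for v
    using simple_word_free[OF hs(1) assms(3)] assms(4) h[OF isvec_alcove[OF assms(3)]] by simp
  hence e: "(\<lambda>j. wR n w v j + of_int (q j)) = v" if "isvec n v" for v using h that by metis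
  have "wR n w (\<lambda>j. 0) j + real_of_int (q j) = 0" for j
    using fun_cong[OF e[of "\<lambda>j. 0"], of j] by (simp add: isvec_def)
  thus q: "q = (\<lambda>j. 0)" by (auto simp: wR_def)
  show "w = id"
  proof (rule weyl_ext)
    fix i assume i: "i < n"
    have "wR n w (\<lambda>j. of_int (unitv i j)) j = of_int (unitv i j)" for j
      using fun_cong[OF e[of "\<lambda>j. of_int (unitv i j)"], of j] isvec_unitv[OF i] by (simp add: q isvec_def)
    thus "w (unitv i) = id (unitv i)" using i by (auto simp: wR_of_int assms fun_eq_iff)
  qed (use assms weyl.weyl_id in auto)
qed

text \<open>Such a \<open>w\<close> maps the alcove to itself, so freeness of the affine action
  takes the place of a length argument.\<close>

lemma weyl_Pos_id: assumes "w \<in> W" "\<And>\<alpha>. \<alpha> \<in> Pos \<Longrightarrow> wd w \<alpha> \<in> Pos" shows "w = id"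
proof -
  obtain y where y: "y \<in> C" by (rule alcove_nonempty)
  hence "wR n w y \<in> C" using assms by (auto simp: alcove_def rpair_wR)
  thus ?thesis using affine_weyl_free(1)[OF assms(1) corootlat_0 y] by simp
qed

end

subsection \<open>Orbit sums\<close>

text \<open>Linear independence of characters: subtracting \<open>g z\<close> times the relation at
  \<open>x\<close> from the relation at \<open>z + x\<close> eliminates \<open>g\<close>.\<close>

lemma artin_independence:
  fixes X :: "(lat \<Rightarrow> 'a::field) set"
  assumes "finite X" "\<And>f x y. f \<in> X \<Longrightarrow> f (\<lambda>j. x j + y j) = f x * f y" "\<And>f. f \<in> X \<Longrightarrow> f (\<lambda>j. 0) = 1"
    and "\<And>x. (\<Sum>f\<in>X. c f * f x) = 0"
  shows "\<forall>f\<in>X. c f = 0"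
  using assms
proof (induction X arbitrary: c rule: finite_induct)
  case (insert g X)
  have s: "(\<Sum>f\<in>X. c f * f x) = - c g * g x" for x
    using insert(6)[of x] insert(1,2) by (simp add: eq_neg_iff_add_eq_0 add.commute)
  have "\<forall>f\<in>X. c f * (f z - g z) = 0" for z
  proof (rule insert(3))
    fix x
    have "(\<Sum>f\<in>X. c f * (f z - g z) * f x) = (\<Sum>f\<in>X. c f * f (\<lambda>j. z j + x j)) - g z * (\<Sum>f\<in>X. c f * f x)"
      by (simp add: insert.prems(1) sum_distrib_left sum_subtractf[symmetric] algebra_simps)
    also have "\<dots> = 0" unfolding s by (simp add: insert.prems(1))
    finally show "(\<Sum>f\<in>X. c f * (f z - g z) * f x) = 0" .
  qed (use insert in auto)
  \<comment> \<open>A nonzero \<open>c f\<close> would make \<open>f\<close> agree with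
    \<open>g\<close> at every \<open>z\<close>, contradicting \<open>g \<notin> X\<close>.\<close>
  hence "c f = 0" if "f \<in> X" for f
    using that insert(2) by (metis eq_iff_diff_eq_0 ext mult_eq_0_iff)
  thus ?case using s[of "\<lambda>j. 0"] insert.prems(2)[of g] by auto
qed simp

lemma power_int_prod: "(\<Prod>i\<in>A. (f i :: 'a::field) powi k) = (\<Prod>i\<in>A. f i) powi k"
  by (induction A rule: infinite_finite_induct) (auto simp: power_int_mult_distrib)

abbreviation torus_elt :: "nat \<Rightarrow> (nat \<Rightarrow> complex fls) \<Rightarrow> bool" where
  "torus_elt n a \<equiv> \<forall>i<n. a i \<noteq> 0"

lemma charval_add: "torus_elt n a \<Longrightarrow> charval n (\<lambda>j. x j + y j) a = charval n x a * charval n y a"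
  unfolding charval_def prod.distrib[symmetric] by (intro prod.cong) (auto simp: power_int_add)

lemma charval_0: "charval n (\<lambda>j. 0) a = 1" by (simp add: charval_def)

lemma charval_scale: "torus_elt n a \<Longrightarrow> charval n (\<lambda>j. k * x j) a = charval n x a powi k"
  unfolding charval_def power_int_prod[symmetric]
  by (intro prod.cong) (auto simp: power_int_mult[symmetric] mult.commute)

lemma charval_sum:
  "finite A \<Longrightarrow> torus_elt n a \<Longrightarrow> charval n (\<lambda>j. \<Sum>i\<in>A. h i j) a = (\<Prod>i\<in>A. charval n (h i) a)"
  by (induction A rule: finite_induct) (auto simp: charval_0 charval_add)

lemma charval_unitv: "j < n \<Longrightarrow> charval n (unitv j) a = a j"
  unfolding charval_def unitv_def by (simp add: if_distrib[of "\<lambda>k. _ powi k"] prod.delta cong: if_cong)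

lemma charval_cong: "(\<And>i. i < n \<Longrightarrow> a i = b i) \<Longrightarrow> charval n x a = charval n x b"
  unfolding charval_def by auto

context based_root_datum
begin

lemma charval_wact: assumes "torus_elt n a"
  shows "charval n x (wact n w a) = charval n (wd w x) a"
proof -
  have "charval n x (wact n w a) = (\<Prod>j<n. \<Prod>i<n. a i powi (w (unitv i) j * x j))"
    unfolding charval_def wact_def by (simp add: power_int_prod[symmetric] power_int_mult)
  also have "\<dots> = (\<Prod>i<n. \<Prod>j<n. a i powi (w (unitv i) j * x j))" by (rule prod.swap)
  also have "\<dots> = (\<Prod>i<n. a i powi (\<Sum>j<n. w (unitv i) j * x j))"
  proof (intro prod.cong refl)
    fix i assume "i \<in> {..<n}"
    hence "a i \<noteq> 0" using assms by auto
    moreover have "(\<Prod>j\<in>A. a i powi f j) = a i powi (\<Sum>j\<in>A. f j)" if "finite A" for A :: "nat set" and f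
      using that \<open>a i \<noteq> 0\<close> by (induction A rule: finite_induct) (auto simp: power_int_add)
    ultimately show "(\<Prod>j<n. a i powi (w (unitv i) j * x j)) = a i powi (\<Sum>j<n. w (unitv i) j * x j)"
      by simp
  qed
  also have "\<dots> = charval n (wd w x) a"
    unfolding charval_def by (intro prod.cong) (auto simp: wd_def pair_def mult.commute)
  finally show ?thesis .
qed

lemma Omega_wact: assumes "torus_elt n a" "w \<in> W" shows "Omega n R (wact n w a) = Omega n R a"
  unfolding Omega_def charval_wact[OF assms(1)]
  by (rule prod.reindex_bij_betw[OF bij_wd_R[OF assms(2)], where g="\<lambda>\<alpha>. 1 - charval n \<alpha> a"])

text \<open>Not an irreducible character: it is the orbit sum with each weight counted as often as
  its stabilizer is large. Summing over \<open>W\<close> keeps stabilizers out of the product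
  formula.\<close>

definition weyl_char :: "lat \<Rightarrow> (nat \<Rightarrow> complex fls) \<Rightarrow> complex fls" where
  "weyl_char x a = (\<Sum>w\<in>W. charval n (wd w x) a)"

lemma weyl_char_wd: assumes "u \<in> W" shows "weyl_char (wd u x) a = weyl_char x a"
proof -
  have "weyl_char (wd u x) a = (\<Sum>w\<in>W. charval n (wd (u \<circ> w) x) a)"
    unfolding weyl_char_def by (intro sum.cong) (auto simp: wd_comp[OF assms])
  also have "\<dots> = weyl_char x a" unfolding weyl_char_def
    by (rule sum.reindex_bij_betw[OF bij_weyl_comp_left[OF assms], where g="\<lambda>v. charval n (wd v x) a"])
  finally show ?thesis .
qed

text \<open>Reindexing the second sum by \<open>w \<circ> u\<close>, with \<open>u\<close> the index
  of the first, collects the double sum into full orbit sums, because \<open>wd\<close> is a right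
  action.\<close>

lemma weyl_char_mult: assumes "torus_elt n a"
  shows "weyl_char x a * weyl_char y a = (\<Sum>w\<in>W. weyl_char (\<lambda>j. x j + wd w y j) a)"
proof -
  have "(\<Sum>w\<in>W. weyl_char (\<lambda>j. x j + wd w y j) a)
      = (\<Sum>w\<in>W. \<Sum>u\<in>W. charval n (wd u x) a * charval n (wd (w \<circ> u) y) a)"
    unfolding weyl_char_def by (intro sum.cong refl) (simp add: wd_simps charval_add[OF assms] wd_comp)
  also have "\<dots> = (\<Sum>u\<in>W. charval n (wd u x) a * (\<Sum>w\<in>W. charval n (wd (w \<circ> u) y) a))"
    by (subst sum.swap) (simp add: sum_distrib_left)
  also have "\<dots> = (\<Sum>u\<in>W. charval n (wd u x) a * weyl_char y a)"
  proof (intro sum.cong refl)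
    fix u assume "u \<in> W"
    show "charval n (wd u x) a * (\<Sum>w\<in>W. charval n (wd (w \<circ> u) y) a) = charval n (wd u x) a * weyl_char y a"
      unfolding weyl_char_def
      using sum.reindex_bij_betw[OF bij_weyl_comp_right[OF \<open>u \<in> W\<close>], where g="\<lambda>v. charval n (wd v y) a"] by simp
  qed
  finally show ?thesis by (simp add: weyl_char_def sum_distrib_right)
qed

lemma worbit_eq: assumes "isvec n x" shows "worbit n R cor x = (\<lambda>w. wd w x) ` W"
proof (intro subset_antisym subsetI)
  fix m assume "m \<in> worbit n R cor x"
  then obtain w where w: "isvec n m" "w \<in> W" "\<And>y. isvec n y \<Longrightarrow> pair n m (w y) = pair n x y"
    unfolding worbit_def by auto
  have "x = wd w m" using w assms by (intro pair_ext) (auto simp: pair_wd)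
  moreover obtain u where "u \<in> W" "wd u (wd w m) = m" using wd_inverse[OF w(2)] w(1) by metis
  ultimately show "m \<in> (\<lambda>w. wd w x) ` W" by (metis imageI)
next
  fix m assume "m \<in> (\<lambda>w. wd w x) ` W"
  then obtain w where w: "w \<in> W" "m = wd w x" by auto
  obtain u where u: "u \<in> W" "wd u (wd w x) = x" using wd_inverse[OF w(1)] assms by metis
  have "pair n m (u y) = pair n x y" for y using pair_wd[OF u(1), of m y] u(2) w(2) by simp
  thus "m \<in> worbit n R cor x" unfolding worbit_def using w u(1) by auto
qed

text \<open>All fibres of the orbit map have the size of the stabilizer of \<open>x\<close>;
  \<open>k\<close> is that size.\<close>

lemma weyl_char_orbit_sum:
  assumes "isvec n x"
  shows "\<exists>k>0. \<forall>a. weyl_char x a = of_nat k * (\<Sum>m\<in>worbit n R cor x. charval n m a)"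
proof -
  define k where "k = card {w\<in>W. wd w x = x}"
  have kpos: "k > 0" unfolding k_def using finite_weyl weyl.weyl_id[of n R cor] assms
    by (auto simp: card_gt_0_iff wd_id intro!: exI[of _ id])
  have fib: "card {w\<in>W. wd w x = m} = k" if "m \<in> (\<lambda>w. wd w x) ` W" for m
  proof -
    obtain u where u: "u \<in> W" "m = wd u x" using \<open>m \<in> (\<lambda>w. wd w x) ` W\<close> by auto
    obtain u' where u': "u' \<in> W" "u' \<circ> u = id" "u \<circ> u' = id" "wd u' (wd u x) = x"
      using wd_inverse[OF u(1)] assms by metis
    have "bij_betw (\<lambda>w. w \<circ> u') {w\<in>W. wd w x = m} {w\<in>W. wd w x = x}"
      by (rule bij_betw_byWitness[where f'="\<lambda>w. w \<circ> u"])
         (use u u' in \<open>auto simp: weyl_comp comp_assoc wd_comp\<close>)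
    thus ?thesis unfolding k_def by (rule bij_betw_same_card)
  qed
  have "weyl_char x a = of_nat k * (\<Sum>m\<in>worbit n R cor x. charval n m a)" for a
  proof -
    have "weyl_char x a = (\<Sum>m\<in>(\<lambda>w. wd w x) ` W. \<Sum>w\<in>{w\<in>W. wd w x = m}. charval n (wd w x) a)"
      unfolding weyl_char_def by (rule sum.image_gen[OF finite_weyl])
    also have "\<dots> = (\<Sum>m\<in>(\<lambda>w. wd w x) ` W. of_nat k * charval n m a)"
      by (intro sum.cong refl) (simp add: fib)
    finally show ?thesis by (simp add: worbit_eq[OF assms] sum_distrib_left)
  qed
  thus ?thesis using kpos by blast
qed

section \<open>Dominant weights and the dominance order\<close>

definition dominant :: "lat \<Rightarrow> bool" where "dominant x \<longleftrightarrow> (\<forall>i<l. pair n x (cor (simple i)) \<ge> 0)"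

lemma dom_pair_Pos: assumes "dominant x" "\<alpha> \<in> Pos" shows "pair n x (cor \<alpha>) \<ge> 0"
proof -
  obtain c where c: "\<forall>i<l. c i \<ge> 0" "cor \<alpha> = (\<lambda>j. \<Sum>i<l. c i * cor (simple i) j)"
    using cor_Pos_expand[OF assms(2)] by blast
  show ?thesis unfolding c(2) using c(1) assms(1) by (auto simp: dominant_def intro!: sum_nonneg)
qed

lemma B_dom_nneg: assumes "dominant x" "nneg d" shows "B d x \<ge> 0"
proof -
  obtain c where c: "\<forall>i<l. c i \<ge> 0" "d = (\<lambda>j. \<Sum>i<l. c i * simple i j)"
    using assms(2) unfolding nneg_def by blast
  have "B x (simple i) \<ge> 0" if "i < l" for i
  proof -
    have "B (simple i) (simple i) * pair n x (cor (simple i)) \<ge> 0"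
      using that assms(1) B_nonneg by (simp add: dominant_def)
    thus ?thesis using two_B[of "simple i" x] that by simp
  qed
  thus ?thesis unfolding c(2) using c(1) by (auto simp: B_sym[of _ x] intro!: sum_nonneg)
qed

text \<open>\<open>B\<close> is a sum over coroots, and on each coroot two dominant weights have
  values of the same sign.\<close>

lemma B_dom_dom: assumes "dominant x" "dominant y" shows "B x y \<ge> 0"
  unfolding B_def
proof (rule sum_nonneg)
  fix g assume "g \<in> cor ` R"
  then obtain \<alpha> where a: "\<alpha> \<in> R" "g = cor \<alpha>" by auto
  show "pair n x g * pair n y g \<ge> 0"
  proof (cases "\<alpha> \<in> Pos")
    case True thus ?thesis using dom_pair_Pos assms a by simp
  next
    case False
    hence "(\<lambda>j. - \<alpha> j) \<in> Pos" using Pos_or_uminus a by auto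
    hence "pair n x (\<lambda>j. - g j) \<ge> 0 \<and> pair n y (\<lambda>j. - g j) \<ge> 0"
      using dom_pair_Pos assms a cor_uminus by metis
    thus ?thesis by (simp add: mult_nonpos_nonpos)
  qed
qed

text \<open>A point of the orbit with maximal height is dominant: a negative value on a simple
  coroot would let that reflection raise the height.\<close>

lemma exists_dom: assumes "isvec n x" shows "\<exists>u\<in>W. dominant (wd u x)"
proof -
  define f where "f u = pair n (wd u x) rho2" for u
  have "Max (f ` W) \<in> f ` W" using finite_weyl weyl.weyl_id[of n R cor] by (intro Max_in) auto
  then obtain u where u: "u \<in> W" "f u = Max (f ` W)" by auto
  have "dominant (wd u x)" unfolding dominant_def
  proof (intro allI impI, rule ccontr)
    fix i assume i: "i < l" "\<not> 0 \<le> pair n (wd u x) (cor (simple i))"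
    let ?v = "u \<circ> sc (simple i)"
    have v: "?v \<in> W" using u i by (intro weyl_comp corefl_in_W) auto
    have "wd ?v x = s (simple i) (wd u x)" using u i by (simp add: wd_comp corefl_in_W wd_corefl)
    hence "f ?v = f u - pair n (wd u x) (cor (simple i)) * 2"
      using pair_simple_rho2[OF i(1)] by (simp add: f_def refl_def)
    hence "f ?v > f u" using i by simp
    moreover have "f ?v \<le> Max (f ` W)" using v finite_weyl by (intro Max_ge) auto
    ultimately show False using u by simp
  qed
  thus ?thesis using u by blast
qed

text \<open>Induction on the number of positive roots that \<open>w\<close> makes negative.\<close>

lemma dom_minus_wd_nneg:
  assumes "w \<in> W" "isvec n x" "dominant x" shows "nneg (\<lambda>j. x j - wd w x j)"
  using assms(1)
proof (induction "card {\<alpha>\<in>Pos. wd w \<alpha> \<notin> Pos}" arbitrary: w rule: less_induct)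
  case less
  show ?case
  proof (cases "\<forall>i<l. wd w (simple i) \<in> Pos")
    case True
    have "wd w \<alpha> \<in> Pos" if "\<alpha> \<in> Pos" for \<alpha>
    proof -
      obtain c where c: "\<forall>i<l. c i \<ge> 0" "\<alpha> = (\<lambda>j. \<Sum>i<l. c i * simple i j)"
        using \<open>\<alpha> \<in> Pos\<close> unfolding Pos_iff nneg_def by blast
      have "wd w \<alpha> = (\<lambda>j. \<Sum>i<l. c i * wd w (simple i) j)" unfolding c(2) by (simp add: wd_simps)
      moreover have "nneg \<dots>" using c(1) True by (intro nneg_sum nneg_scale) (auto simp: Pos_iff)
      moreover have "wd w \<alpha> \<in> R" using wd_root[OF less(2)] that Pos_R by blast
      ultimately show ?thesis unfolding Pos_iff by metis
    qed
    hence "w = id" using weyl_Pos_id[OF less(2)] by blast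
    thus ?thesis using assms(2) by (simp add: wd_id nneg_0)
  next
    case False
    then obtain i where i: "i < l" "wd w (simple i) \<notin> Pos" by auto
    let ?a = "simple i" and ?v = "sc (simple i) \<circ> w"
    have v: "?v \<in> W" using less(2) i by (intro weyl.weyl_step) auto
    have wv: "wd ?v y = wd w (s ?a y)" if "isvec n y" for y using wd_step[OF less(2) _ that] i by simp
    have neg: "(\<lambda>j. - wd w ?a j) \<in> Pos" using i Pos_or_uminus[of "wd w ?a"] wd_root[OF less(2)] by auto
    have va: "wd ?v ?a = (\<lambda>j. - wd w ?a j)"
      using i by (simp add: wv isvec_root refl_self wd_simps)
    have "s ?a ` {\<alpha>\<in>Pos. wd ?v \<alpha> \<notin> Pos} \<subseteq> {\<alpha>\<in>Pos. wd w \<alpha> \<notin> Pos} - {?a}"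
    proof
      fix b assume "b \<in> s ?a ` {\<alpha>\<in>Pos. wd ?v \<alpha> \<notin> Pos}"
      then obtain \<alpha> where al: "\<alpha> \<in> Pos" "wd ?v \<alpha> \<notin> Pos" "b = s ?a \<alpha>" by auto
      have ne: "\<alpha> \<noteq> ?a" using al(2) va neg by metis
      have "b \<in> Pos" using refl_simple_Pos[OF i(1) al(1) ne] al by simp
      moreover have "wd w b \<notin> Pos" using al wv[of \<alpha>] isvec_root Pos_R by simp
      moreover have "b \<noteq> ?a"
      proof
        assume "b = ?a"
        hence "\<alpha> = (\<lambda>j. - ?a j)" using al(3) by (metis refl_refl refl_self i(1) simple_in_R)
        thus False using al(1) not_Pos_uminus i by auto
      qed
      ultimately show "b \<in> {\<alpha>\<in>Pos. wd w \<alpha> \<notin> Pos} - {?a}" by simp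
    qed
    moreover have "inj_on (s ?a) {\<alpha>\<in>Pos. wd ?v \<alpha> \<notin> Pos}"
      by (rule inj_on_inverseI[of _ "s ?a"]) (simp add: i)
    ultimately have "card {\<alpha>\<in>Pos. wd ?v \<alpha> \<notin> Pos} \<le> card ({\<alpha>\<in>Pos. wd w \<alpha> \<notin> Pos} - {?a})"
      by (intro card_inj_on_le) auto
    also have "\<dots> < card {\<alpha>\<in>Pos. wd w \<alpha> \<notin> Pos}" 
      by (rule card_Diff1_less) (use i in simp_all)
    finally have IH: "nneg (\<lambda>j. x j - wd ?v x j)" using less(1) v by blast
    \<comment> \<open>Passing from \<open>?v\<close> to \<open>w\<close> subtracts a multiple of
      \<open>wd ?v ?a\<close>. The multiplier is nonnegative because \<open>x\<close> is dominant,
      and the root \<open>wd ?v ?a\<close> is positive by the choice of \<open>i\<close>.\<close>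
    have wx: "wd w x = (\<lambda>j. wd ?v x j - pair n x (cor ?a) * wd ?v ?a j)"
    proof -
      have "wd w x = wd w (s ?a (s ?a x))" using i by simp
      also have "\<dots> = wd ?v (s ?a x)" using wv[OF isvec_refl[of ?a x]] assms(2) i by simp
      finally show ?thesis unfolding refl_def by (simp add: wd_simps)
    qed
    have "x j - wd w x j = (x j - wd ?v x j) + pair n x (cor ?a) * wd ?v ?a j" for j
      using fun_cong[OF wx, of j] by simp
    moreover have "nneg (wd ?v ?a)" using neg unfolding va Pos_iff by blast
    hence "nneg (\<lambda>j. (x j - wd ?v x j) + pair n x (cor ?a) * wd ?v ?a j)"
      using assms(3) i by (intro nneg_add IH nneg_scale) (auto simp: dominant_def)
    ultimately show ?thesis by presburger
  qed
qed

text \<open>For the difference d, both \<open>B d x\<close> and \<open>B d y\<close> are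
  nonnegative, and their sum \<open>B x x - B y y\<close> is 0. Hence \<open>B d d = 0\<close>, all
  coroots kill d, and a nonnegative combination of simple roots of height 0 is zero.\<close>

lemma dom_eq_of_norm_eq:
  assumes "dominant x" "dominant y" "nneg (\<lambda>j. x j - y j)" "B x x = B y y"
  shows "x = y"
proof -
  let ?d = "\<lambda>j. x j - y j"
  have "B ?d x \<ge> 0" "B ?d y \<ge> 0" by (rule B_dom_nneg[OF assms(1,3)], rule B_dom_nneg[OF assms(2,3)])
  moreover have "B ?d x + B ?d y = 0" using assms(4) by (simp add: B_sym[of y x])
  ultimately have "B ?d ?d = 0" by simp
  hence "pair n ?d (cor \<alpha>) = 0" if "\<alpha> \<in> R" for \<alpha> using B_eq_0 that by blast
  hence "pair n ?d rho2 = 0" unfolding rho2_def using Pos_R by (simp del: pair_simps(2))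
  thus ?thesis using pair_rho2_nneg(2)[OF assms(3)] by (auto simp: fun_eq_iff)
qed

lemma wd_fixed:
  assumes "isvec n x" "\<And>i. i < l \<Longrightarrow> pair n x (cor (simple i)) = 0" "w \<in> W"
  shows "wd w x = x"
proof -
  have p: "pair n x (cor \<alpha>) = 0" if "\<alpha> \<in> Pos" for \<alpha>
  proof -
    obtain c where "cor \<alpha> = (\<lambda>j. \<Sum>i<l. c i * cor (simple i) j)" 
      using cor_Pos_expand[OF \<open>\<alpha> \<in> Pos\<close>] by blast
    thus ?thesis using assms(2) by simp
  qed
  have r: "pair n x (cor \<alpha>) = 0" if "\<alpha> \<in> R" for \<alpha>
    using p Pos_or_uminus[OF that] cor_uminus[OF that] by fastforce
  show ?thesis using assms(3)
  proof (induction rule: weyl.induct)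
    case weyl_id show ?case by (rule wd_id[OF assms(1)])
  next
    case (weyl_step w \<alpha>)
    have "s \<alpha> x = x" using r[OF weyl_step(2)] by (simp add: refl_def)
    thus ?case using weyl_step wd_step[OF _ _ assms(1)] by metis
  qed
qed

end

section \<open>The adapted basis, its dual basis and the kernel of the average\<close>

locale adapted_root_datum = based_root_datum +
  fixes \<omega> :: "nat \<Rightarrow> lat"
  assumes adapted: "adapted_basis n l cor simple \<omega>"
begin

definition dual :: "nat \<Rightarrow> lat" where
  "dual = (SOME y. (\<forall>j<n. isvec n (y j)) \<and> (\<forall>i<n. \<forall>j<n. pair n (\<omega> i) (y j) = (if i = j then 1 else 0)))"

lemma isvec_omega [simp]: "i < n \<Longrightarrow> isvec n (\<omega> i)"
  and pair_omega_cor: "i < n \<Longrightarrow> j < l \<Longrightarrow> pair n (\<omega> i) (cor (simple j)) = (if i = j then 1 else 0)"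
  using adapted unfolding adapted_basis_def by auto

lemma isvec_dual [simp]: "j < n \<Longrightarrow> isvec n (dual j)"
  and pair_omega_dual: "i < n \<Longrightarrow> j < n \<Longrightarrow> pair n (\<omega> i) (dual j) = (if i = j then 1 else 0)"
  using someI_ex[of "\<lambda>y. (\<forall>j<n. isvec n (y j)) \<and> (\<forall>i<n. \<forall>j<n. pair n (\<omega> i) (y j) = (if i = j then 1 else 0))"]
    adapted unfolding adapted_basis_def dual_def by blast+

text \<open>Duality says that one product of two square matrices is the identity; over a field the
  product in the other order is the identity too, and this gives the expansions in both
  bases.\<close>

lemma dual_omega: assumes "a < n" "b < n"
  shows "(\<Sum>j<n. dual j a * \<omega> j b) = (if a = b then 1 else 0)"
proof -
  define X where "X = mat n n (\<lambda>(i, a). real_of_int (\<omega> i a))"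
  define Y where "Y = mat n n (\<lambda>(a, j). real_of_int (dual j a))"
  have XY: "X * Y = 1\<^sub>m n"
  proof (rule eq_matI)
    fix i j assume ij: "i < dim_row (1\<^sub>m n :: real mat)" "j < dim_col (1\<^sub>m n :: real mat)"
    have "(X * Y) $$ (i, j) = (\<Sum>a<n. real_of_int (\<omega> i a) * real_of_int (dual j a))"
      using ij by (simp add: X_def Y_def scalar_prod_def atLeast0LessThan)
    also have "\<dots> = real_of_int (pair n (\<omega> i) (dual j))" by (simp add: pair_def)
    finally show "(X * Y) $$ (i, j) = 1\<^sub>m n $$ (i, j)" using ij by (simp add: pair_omega_dual)
  qed (auto simp: X_def Y_def)
  have "Y * X = 1\<^sub>m n"
    by (rule mat_mult_left_right_inverse[OF _ _ XY]) (auto simp: X_def Y_def)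
  moreover have "(Y * X) $$ (a, b) = real_of_int (\<Sum>j<n. dual j a * \<omega> j b)"
    using assms by (simp add: X_def Y_def scalar_prod_def atLeast0LessThan)
  moreover have "(1\<^sub>m n :: real mat) $$ (a, b) = real_of_int (if a = b then 1 else 0)"
    using assms by simp
  ultimately have "real_of_int (\<Sum>j<n. dual j a * \<omega> j b) = real_of_int (if a = b then 1 else 0)"
    by metis
  thus ?thesis by (simp only: of_int_eq_iff)
qed

lemma weight_expand: assumes "isvec n x" shows "x = (\<lambda>b. \<Sum>j<n. pair n x (dual j) * \<omega> j b)"
proof (rule isvec_ext[OF assms])
  show "isvec n (\<lambda>b. \<Sum>j<n. pair n x (dual j) * \<omega> j b)"
    unfolding isvec_def using isvec_omega by (auto simp: isvec_def)
  fix b assume b: "b < n"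
  have "(\<Sum>j<n. pair n x (dual j) * \<omega> j b) = (\<Sum>a<n. x a * (\<Sum>j<n. dual j a * \<omega> j b))"
    unfolding pair_def by (simp add: sum_distrib_left sum_distrib_right mult.assoc) (rule sum.swap)
  also have "\<dots> = (\<Sum>a<n. if a = b then x a else 0)" using b by (intro sum.cong) (auto simp: dual_omega)
  finally show "x b = (\<Sum>j<n. pair n x (dual j) * \<omega> j b)" using b by simp
qed

lemma coweight_expand: assumes "isvec n v" shows "v = (\<lambda>a. \<Sum>j<n. pair n (\<omega> j) v * dual j a)"
proof (rule isvec_ext[OF assms])
  show "isvec n (\<lambda>a. \<Sum>j<n. pair n (\<omega> j) v * dual j a)"
    unfolding isvec_def using isvec_dual by (auto simp: isvec_def)
  fix a assume a: "a < n"
  have "(\<Sum>j<n. pair n (\<omega> j) v * dual j a) = (\<Sum>b<n. v b * (\<Sum>j<n. dual j a * \<omega> j b))"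
    unfolding pair_def by (simp add: sum_distrib_left sum_distrib_right mult_ac) (rule sum.swap)
  also have "\<dots> = (\<Sum>b<n. if a = b then v b else 0)" using a by (intro sum.cong) (auto simp: dual_omega)
  finally show "v a = (\<Sum>j<n. pair n (\<omega> j) v * dual j a)" using a by simp
qed

lemma l_le_n: assumes "j < l" shows "j < n"
proof (rule ccontr)
  assume "\<not> j < n"
  hence "pair n (\<omega> i) (cor (simple j)) = 0" if "i < n" for i using pair_omega_cor[OF that assms] that by simp
  hence "cor (simple j) = (\<lambda>a. 0)"
    using coweight_expand[OF isvec_cor[OF simple_in_R[OF assms]]] by simp
  thus False using pair_cor_self[OF simple_in_R[OF assms]] by simp
qed

text \<open>This is how simple connectedness of the derived group enters: the simple coroots are
  part of a lattice basis of the cocharacters.\<close>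

lemma dual_simple: assumes "j < l" shows "dual j = cor (simple j)"
proof -
  have "cor (simple j) = (\<lambda>a. \<Sum>i<n. pair n (\<omega> i) (cor (simple j)) * dual i a)"
    by (rule coweight_expand[OF isvec_cor[OF simple_in_R[OF assms]]])
  also have "\<dots> = (\<lambda>a. \<Sum>i<n. if i = j then dual i a else 0)"
    by (intro ext sum.cong) (auto simp: pair_omega_cor assms)
  finally show ?thesis using l_le_n[OF assms] by simp
qed

text \<open>Converse of \<open>pG_corootlat\<close>. For i \<ge> l the weight \<omega> i is fixed by
  \<open>W\<close>, so averaging does not change its pairing with \<open>d\<close>; that pairing is
  therefore 0, and only simple coroots remain in the expansion of \<open>d\<close>.\<close>

lemma pG_kernel:
  assumes "isvec n d" "pG n R cor (\<lambda>j. of_int (d j)) = (\<lambda>j. 0)" shows "d \<in> Q"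
proof -
  have z: "pair n (\<omega> i) d = 0" if i: "i < n" "\<not> i < l" for i
  proof -
    have fx: "wd w (\<omega> i) = \<omega> i" if "w \<in> W" for w
      using i that by (intro wd_fixed) (auto simp: pair_omega_cor)
    have "0 = rpair n (\<omega> i) (pG n R cor (\<lambda>j. of_int (d j)))" by (simp add: assms(2))
    also have "\<dots> = (\<Sum>w\<in>W. rpair n (\<omega> i) (wR n w (\<lambda>j. of_int (d j)))) / real (card W)"
      unfolding pG_def by simp
    also have "\<dots> = of_int (pair n (\<omega> i) d)" using card_W_pos by (simp add: rpair_wR fx)
    finally show ?thesis by simp
  qed
  have "d = (\<lambda>a. \<Sum>j<n. pair n (\<omega> j) d * dual j a)" by (rule coweight_expand[OF assms(1)])
  moreover have "(\<lambda>a. \<Sum>j\<in>A. pair n (\<omega> j) d * dual j a) \<in> Q" if "finite A" "A \<subseteq> {..<n}" for A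
    using that
  proof (induction A rule: finite_induct)
    case (insert j A)
    have "(\<lambda>a. pair n (\<omega> j) d * dual j a) \<in> Q"
    proof (cases "j < l")
      case True thus ?thesis by (intro corootlat_scale) (simp add: dual_simple cor_in_corootlat)
    next
      case False thus ?thesis using z[of j] insert by (simp add: corootlat_0)
    qed
    thus ?case using insert corootlat_add[of "\<lambda>a. pair n (\<omega> j) d * dual j a"] by simp
  qed (simp add: corootlat_0)
  ultimately show ?thesis by (metis finite_lessThan order_refl)
qed

text \<open>Every orbit sum is a polynomial in the orbit sums of the \<open>\<omega> i\<close> (with inverses for \<open>i \<ge> l\<close>),
  by induction on the invariant form \<open>B\<close>.\<close>

lemma weyl_char_determined:
  assumes a: "torus_elt n a" and b: "torus_elt n b"
    and eq: "\<And>i. i < n \<Longrightarrow> weyl_char (\<omega> i) a = weyl_char (\<omega> i) b"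
  shows "isvec n x \<Longrightarrow> weyl_char x a = weyl_char x b"
proof (induction "nat (B x x)" arbitrary: x rule: less_induct)
  case less
  obtain u where u: "u \<in> W" "dominant (wd u x)" using exists_dom less by blast
  define y where "y = wd u x"
  have y: "isvec n y" "dominant y" "B y y = B x x" and SWy: "weyl_char y c = weyl_char x c" for c
    using u less by (auto simp: y_def B_wd weyl_char_wd)
  have IH: "weyl_char z a = weyl_char z b" if "isvec n z" "B z z < B y y" for z
    using less(1)[of z] that y(3) B_nonneg[of z] by simp
  have "weyl_char y a = weyl_char y b"
  proof (cases "\<exists>i<l. pair n y (cor (simple i)) > 0")
    case False
    \<comment> \<open>Here \<open>y\<close> and the \<omega> j with j \<ge> l are
      \<open>W\<close>-fixed, so their sums are \<open>card W\<close> times single characters. The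
      value at \<open>y\<close> is a product of integral powers, possibly negative, of the values at
      those \<omega> j.\<close>
    hence p: "pair n y (cor (simple i)) = 0" if "i < l" for i
      using y(2) that by (force simp: dominant_def)
    have inv: "weyl_char z c = of_nat (card W) * charval n z c"
      if "isvec n z" "\<And>i. i < l \<Longrightarrow> pair n z (cor (simple i)) = 0" for z c
      unfolding weyl_char_def using wd_fixed[OF that] by simp
    have om: "charval n (\<omega> j) a = charval n (\<omega> j) b" if j: "j < n" "\<not> j < l" for j
      using eq[OF j(1)] inv[OF isvec_omega[OF j(1)]] j card_W_pos by (force simp: pair_omega_cor)
    have "charval n y c = (\<Prod>j<n. charval n (\<omega> j) c powi pair n y (dual j))" if "torus_elt n c" for c
      by (subst weight_expand[OF y(1)]) (simp add: charval_sum charval_scale that)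
    moreover have "charval n (\<omega> j) a powi pair n y (dual j) = charval n (\<omega> j) b powi pair n y (dual j)"
      if "j < n" for j
      using om[OF that] p[of j] by (cases "j < l") (auto simp: dual_simple)
    ultimately have "charval n y a = charval n y b" using a b by simp
    thus ?thesis using inv[OF y(1) p] by simp
  next
    case True
    then obtain i where i: "i < l" "pair n y (cor (simple i)) > 0" by blast
    have i_n: "i < n" using l_le_n i by auto
    \<comment> \<open>Split off one fundamental weight and expand the product of the sums of
      \<open>m\<close> and \<omega> i. No weight in it is longer than \<open>y\<close>, and the
      shorter ones are covered by induction, as is \<open>m\<close> itself.\<close>
    define m where "m = (\<lambda>j. y j - \<omega> i j)"
    have m: "isvec n m" using y(1) isvec_omega[OF i_n] by (simp add: m_def isvec_def)
    have ym: "y = (\<lambda>j. m j + \<omega> i j)" by (simp add: m_def)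
    have dm: "dominant m" using y(2) i i_n by (auto simp: dominant_def m_def pair_omega_cor)
    have dw: "dominant (\<omega> i)" using i_n by (auto simp: dominant_def pair_omega_cor)
    have By: "B y y = B m m + 2 * B m (\<omega> i) + B (\<omega> i) (\<omega> i)"
      unfolding ym by (simp add: B_sym[of "\<omega> i" m])
    have "B (\<omega> i) (\<omega> i) > 0"
      using B_nonneg[of "\<omega> i"] B_eq_0[of "\<omega> i" "simple i"] i i_n by (fastforce simp: pair_omega_cor)
    hence "B m m < B y y" using B_dom_dom[OF dm dw] By by simp
    hence SWm: "weyl_char m a = weyl_char m b" using IH m by blast
    define t where "t w = (\<lambda>j. m j + wd w (\<omega> i) j)" for w
    \<comment> \<open>The terms of maximal norm. Each turns out to be a conjugate of
      \<open>y\<close>, so together they contribute \<open>card E\<close> times the sum of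
      \<open>y\<close>; \<open>id \<in> E\<close> makes this multiple nonzero.\<close>
    define E where "E = {w\<in>W. B (t w) (t w) = B y y}"
    have t: "isvec n (t w)" for w using m by (auto simp: t_def isvec_def wd_def)
    have le: "B (t w) (t w) \<le> B y y" if w: "w \<in> W" for w
    proof -
      have "B m (\<lambda>j. \<omega> i j - wd w (\<omega> i) j) \<ge> 0"
        using dom_minus_wd_nneg[OF w _ dw] i_n by (subst B_sym, intro B_dom_nneg dm) auto
      thus ?thesis unfolding By t_def using B_wd[OF w, of "\<omega> i" "\<omega> i"] i_n
        by (simp add: B_sym[of "wd w (\<omega> i)" m])
    qed
    have E: "weyl_char (t w) c = weyl_char y c" if w: "w \<in> E" for w c
    proof -
      have wW: "w \<in> W" using w by (simp add: E_def)
      obtain v where v: "v \<in> W" "dominant (wd v (t w))" using exists_dom t by blast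
      \<comment> \<open>The dominant conjugate of \<open>t w\<close> lies below \<open>y\<close>
        because each of its two summands lies below the dominant weight it comes from; equal norm
        then forces equality with \<open>y\<close>.\<close>
      have "(\<lambda>j. y j - wd v (t w) j) = (\<lambda>j. (m j - wd v m j) + (\<omega> i j - wd (w \<circ> v) (\<omega> i) j))"
        using v wW by (auto simp: ym t_def wd_simps wd_comp)
      moreover have "nneg \<dots>" using v wW i_n m dm dw
        by (intro nneg_add dom_minus_wd_nneg weyl_comp) auto
      ultimately have "nneg (\<lambda>j. y j - wd v (t w) j)" by metis
      hence "y = wd v (t w)"
        using y(2) v w t by (intro dom_eq_of_norm_eq) (auto simp: B_wd E_def)
      thus ?thesis using weyl_char_wd[OF v(1)] by simp
    qed
    have "(\<Sum>w\<in>W. weyl_char (t w) a - weyl_char (t w) b) = weyl_char m a * weyl_char (\<omega> i) a - weyl_char m b * weyl_char (\<omega> i) b"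
      unfolding weyl_char_mult[OF a] weyl_char_mult[OF b] t_def by (simp add: sum_subtractf)
    also have "\<dots> = 0" using SWm eq[OF i_n] by simp
    finally have "0 = (\<Sum>w\<in>W. weyl_char (t w) a - weyl_char (t w) b)" by simp
    also have "\<dots> = (\<Sum>w\<in>E. weyl_char (t w) a - weyl_char (t w) b)"
    proof (rule sum.mono_neutral_right)
      show "\<forall>w\<in>W - E. weyl_char (t w) a - weyl_char (t w) b = 0"
        using le IH t by (force simp: E_def)
    qed (auto simp: E_def finite_weyl)
    also have "\<dots> = of_nat (card E) * (weyl_char y a - weyl_char y b)" using E by simp
    finally have "of_nat (card E) * (weyl_char y a - weyl_char y b) = 0" by simp
    moreover have "id \<in> E" using weyl.weyl_id i_n by (simp add: E_def t_def wd_id ym)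
    hence "card E > 0" using finite_weyl by (auto simp: card_gt_0_iff E_def)
    ultimately show ?thesis by simp
  qed
  thus ?case using SWy by simp
qed

text \<open>Once all orbit sums agree, the conjugates of \<open>a\<close> and of \<open>b\<close>,
  viewed as characters of the weight lattice, have equal sums. Independence makes their
  multiplicities agree, so the character of \<open>b\<close> itself occurs among the conjugates of
  \<open>a\<close>.\<close>

theorem orbit_sums_separate:
  assumes a: "torus_elt n a" and b: "torus_elt n b"
    and eq: "\<And>i. i < n \<Longrightarrow> (\<Sum>m\<in>worbit n R cor (\<omega> i). charval n m a) = (\<Sum>m\<in>worbit n R cor (\<omega> i). charval n m b)"
  shows "\<exists>w\<in>W. \<forall>j<n. b j = wact n w a j"
proof -
  have SWi: "weyl_char (\<omega> i) a = weyl_char (\<omega> i) b" if "i < n" for i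
    using weyl_char_orbit_sum[OF isvec_omega[OF that]] eq[OF that] by fastforce
  define \<chi> where "\<chi> c w = (\<lambda>x. charval n (wd w x) c)" for c w
  have SWx: "(\<Sum>w\<in>W. \<chi> a w x) = (\<Sum>w\<in>W. \<chi> b w x)" for x
  proof -
    \<comment> \<open>\<open>weyl_char_determined\<close> needs support below \<open>n\<close>,
      while independence of characters quantifies over all sequences; \<open>wd\<close> ignores the
      tail.\<close>
    define x' where "x' = (\<lambda>j. if j < n then x j else 0)"
    have "wd w x' = wd w x" for w by (auto simp: wd_def x'_def pair_def)
    moreover have "isvec n x'" by (simp add: x'_def isvec_def)
    ultimately show ?thesis using weyl_char_determined[OF a b SWi, of x'] by (simp add: weyl_char_def \<chi>_def)
  qed
  define X where "X = \<chi> a ` W \<union> \<chi> b ` W"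
  \<comment> \<open>Multiplicities are taken in the coefficient field; as it has characteristic 0,
    equality there gives back equality of cardinalities.\<close>
  define k where "k c f = (of_nat (card {w\<in>W. \<chi> c w = f}) :: complex fls)" for c f
  have grp: "(\<Sum>f\<in>X. k c f * f x) = (\<Sum>w\<in>W. \<chi> c w x)" if "\<chi> c ` W \<subseteq> X" for c x
  proof -
    have "(\<Sum>f\<in>X. k c f * f x) = (\<Sum>f\<in>X. \<Sum>w\<in>{w\<in>W. \<chi> c w = f}. \<chi> c w x)"
      by (intro sum.cong refl) (simp add: k_def)
    also have "\<dots> = (\<Sum>w\<in>W. \<chi> c w x)" using that finite_weyl by (intro sum.group) (auto simp: X_def)
    finally show ?thesis .
  qed
  have "\<forall>f\<in>X. k a f - k b f = 0"
  proof (rule artin_independence)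
    show "finite X" using finite_weyl by (simp add: X_def)
    show "f (\<lambda>j. x j + y j) = f x * f y" if "f \<in> X" for f x y
      using that a b by (auto simp: X_def \<chi>_def wd_simps charval_add)
    show "f (\<lambda>j. 0) = 1" if "f \<in> X" for f
    proof -
      have "wd w (\<lambda>j. 0) = (\<lambda>j. 0)" for w by (auto simp: wd_def)
      thus ?thesis using that by (auto simp: X_def \<chi>_def charval_0)
    qed
    show "(\<Sum>f\<in>X. (k a f - k b f) * f x) = 0" for x
      using SWx[of x] grp[of a x] grp[of b x] by (simp add: X_def left_diff_distrib sum_subtractf)
  qed
  moreover have idb: "\<chi> b id \<in> X" using weyl.weyl_id by (simp add: X_def)
  ultimately have "card {w\<in>W. \<chi> a w = \<chi> b id} = card {w\<in>W. \<chi> b w = \<chi> b id}" by (simp add: k_def)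
  moreover have "card {w\<in>W. \<chi> b w = \<chi> b id} > 0"
    using finite_weyl weyl.weyl_id[of n R cor] by (auto simp: card_gt_0_iff)
  ultimately have "{w\<in>W. \<chi> a w = \<chi> b id} \<noteq> {}" by (metis card.empty less_irrefl)
  then obtain w where w: "w \<in> W" "\<chi> a w = \<chi> b id" by auto
  have "b j = wact n w a j" if "j < n" for j
  proof -
    have "b j = \<chi> b id (unitv j)" using that by (simp add: \<chi>_def wd_id[unfolded id_def] charval_unitv id_def)
    also have "\<dots> = charval n (unitv j) (wact n w a)" using w(2) by (simp add: \<chi>_def charval_wact[OF a] fun_eq_iff)
    finally show ?thesis using that by (simp add: charval_unitv)
  qed
  thus ?thesis using w(1) by blast
qed

end

subsection \<open>Puiseux series\<close>

definition exp2pi :: "complex \<Rightarrow> complex" where "exp2pi z = exp (2 * of_real pi * \<i> * z)"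

lemma exp2pi_add: "exp2pi (x + y) = exp2pi x * exp2pi y" by (simp add: exp2pi_def ring_distribs exp_add)
lemma exp2pi_0 [simp]: "exp2pi 0 = 1" by (simp add: exp2pi_def)
lemma exp2pi_nonzero [simp]: "exp2pi z \<noteq> 0" by (simp add: exp2pi_def)
lemma exp2pi_diff: "exp2pi (x - y) = exp2pi x / exp2pi y" by (simp add: exp2pi_def ring_distribs exp_diff)
lemma exp2pi_powi: "exp2pi z powi k = exp2pi (of_int k * z)" by (simp add: exp2pi_def exp_power_int mult_ac)

lemma exp2pi_sum: "exp2pi (\<Sum>i\<in>A. f i) = (\<Prod>i\<in>A. exp2pi (f i))"
  by (induction A rule: infinite_finite_induct) (auto simp: exp2pi_add)

lemma exp2pi_eq_1: "exp2pi z = 1 \<longleftrightarrow> z \<in> \<int>"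
proof
  assume h: "exp2pi z = 1"
  hence "exp (Re (2 * of_real pi * \<i> * z)) = 1" unfolding exp2pi_def by (metis norm_exp_eq_Re norm_one)
  hence im: "Im z = 0" by simp
  have "Re (exp2pi z) = cos (2 * pi * Re z)" using im by (simp add: exp2pi_def Re_exp)
  hence "cos (2 * pi * Re z) = 1" using h by simp
  then obtain n :: int where "2 * pi * Re z = real_of_int n * 2 * pi" using cos_one_2pi_int by blast
  hence "Re z = of_int n" by simp
  hence "z = of_int n" using im by (simp add: complex_eq_iff)
  thus "z \<in> \<int>" by simp
next
  assume "z \<in> \<int>"
  then obtain n :: int where "z = of_int n" by (auto elim: Ints_cases)
  moreover have "cos (2 * pi * real_of_int n) = 1" by (rule cos_int_2pin)
  moreover have "sin (2 * pi * real_of_int n) = 0" by (rule sin_int_2pin)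
  ultimately show "exp2pi z = 1"
    by (auto simp: complex_eq_iff exp2pi_def Re_exp Im_exp)
qed

lemma exp2pi_eq_iff: "exp2pi x = exp2pi y \<longleftrightarrow> x - y \<in> \<int>"
  by (simp add: exp2pi_eq_1[symmetric] exp2pi_diff)

lemma exp2pi_surj: assumes "c \<noteq> 0" shows "\<exists>z. exp2pi z = c"
proof -
  let ?w = "of_real (ln (cmod c)) + \<i> * of_real (Arg c)"
  have "exp ?w = c" using assms rcis_cmod_Arg[of c]
    by (simp add: exp_add rcis_def cis_conv_exp exp_of_real)
  thus ?thesis by (intro exI[of _ "?w / (2 * of_real pi * \<i>)"]) (simp add: exp2pi_def)
qed

section \<open>Leading coefficients and the Galois generator\<close>

definition lead :: "complex fls \<Rightarrow> complex" where "lead f = fls_nth f (fls_subdegree f)"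

lemma lead_mult: "lead (f * g) = lead f * lead g"
  by (cases "f = 0 \<or> g = 0") (auto simp: lead_def)

lemma lead_1 [simp]: "lead 1 = 1" by (simp add: lead_def)

lemma lead_nonzero: "f \<noteq> 0 \<Longrightarrow> lead f \<noteq> 0" by (simp add: lead_def)

lemma lead_power: "lead (f ^ k) = lead f ^ k" by (induction k) (auto simp: lead_mult)

lemma lead_inverse: "f \<noteq> 0 \<Longrightarrow> lead (inverse f) = inverse (lead f)"
  using lead_mult[of f "inverse f"] by (simp add: inverse_unique)

lemma lead_powi: "f \<noteq> 0 \<Longrightarrow> lead (f powi k) = lead f powi k"
  by (auto simp: power_int_def lead_power lead_inverse)

lemma lead_prod: "lead (\<Prod>i\<in>A. f i) = (\<Prod>i\<in>A. lead (f i))"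
  by (induction A rule: infinite_finite_induct) (auto simp: lead_mult)

lemma gal_nth: "fls_nth (gal N f) k = exp (2 * pi * \<i> / of_nat N) powi k * fls_nth f k"
  unfolding gal_def by (rule nth_Abs_fls_lower_bound[of "fls_subdegree f"]) auto

lemma gal_subdegree: "f \<noteq> 0 \<Longrightarrow> fls_subdegree (gal N f) = fls_subdegree f"
  by (rule fls_subdegree_eqI) (auto simp: gal_nth)

lemma gal_root: "exp (2 * of_real pi * \<i> / of_nat N) powi k = exp2pi (of_int k / of_nat N)"
  by (simp add: exp2pi_def exp_power_int mult_ac)

lemma lead_gal: "f \<noteq> 0 \<Longrightarrow> lead (gal N f) = exp2pi (of_int (fls_subdegree f) / of_nat N) * lead f"
  by (simp add: lead_def gal_subdegree gal_nth gal_root)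

section \<open>Change of denominator\<close>

lemma refine_eq: assumes "M > 0" shows "refine M f = fls_compose_power f M"
proof -
  have "(\<lambda>k. if int M dvd k then fls_nth f (k div int M) else 0) = fls_nth (fls_compose_power f M)"
    using assms by (simp add: fls_nth_compose_power fun_eq_iff)
  thus ?thesis unfolding refine_def by (simp add: fls_nth_inverse)
qed

lemma refine_nth: "M > 0 \<Longrightarrow> fls_nth (refine M f) k = (if int M dvd k then fls_nth f (k div int M) else 0)"
  by (simp add: refine_eq fls_nth_compose_power)

lemma refine_eq_0_iff [simp]: assumes "M > 0" shows "refine M f = 0 \<longleftrightarrow> f = 0"
proof
  assume r: "refine M f = 0"
  have "fls_nth f k = 0" for k using arg_cong[OF r, of "\<lambda>g. fls_nth g (int M * k)"] assms by (simp add: refine_nth)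
  thus "f = 0" by (simp add: fls_eq_iff)
qed (use assms in \<open>simp add: refine_eq\<close>)

lemma refine_mult: "M > 0 \<Longrightarrow> refine M (f * g) = refine M f * refine M g"
  and refine_diff: "M > 0 \<Longrightarrow> refine M (f - g) = refine M f - refine M g"
  and refine_1: "M > 0 \<Longrightarrow> refine M 1 = 1"
  by (simp_all add: refine_eq)

lemma refine_sum: "M > 0 \<Longrightarrow> refine M (\<Sum>i\<in>A. f i) = (\<Sum>i\<in>A. refine M (f i))"
  by (induction A rule: infinite_finite_induct) (auto simp: refine_eq)

lemma refine_prod: "M > 0 \<Longrightarrow> refine M (\<Prod>i\<in>A. f i) = (\<Prod>i\<in>A. refine M (f i))"
  by (induction A rule: infinite_finite_induct) (auto simp: refine_eq)

lemma refine_powi: assumes "M > 0" "f \<noteq> 0" shows "refine M (f powi k) = refine M f powi k"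
proof -
  have p: "refine M (g ^ m) = refine M g ^ m" for g and m :: nat
    using assms by (simp add: refine_eq)
  have "refine M f * refine M (inverse f) = 1"
    using assms by (simp add: refine_mult[symmetric] refine_1)
  hence "refine M (inverse f) = inverse (refine M f)" by (rule inverse_unique[symmetric])
  thus ?thesis by (simp add: power_int_def p)
qed

lemma refine_subdegree: assumes "M > 0" "f \<noteq> 0" shows "fls_subdegree (refine M f) = int M * fls_subdegree f"
proof (rule fls_subdegree_eqI)
  show "fls_nth (refine M f) (int M * fls_subdegree f) \<noteq> 0" using assms by (simp add: refine_nth)
  fix k assume "k < int M * fls_subdegree f"
  thus "fls_nth (refine M f) k = 0" using assms
    by (auto simp: refine_nth elim!: dvdE)
qed

lemma has_val_refine:
  assumes "N > 0" "M > 0" shows "has_val (N * M) (refine M f) r \<longleftrightarrow> has_val N f r"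
  using assms by (cases "f = 0") (auto simp: has_val_def refine_subdegree)

lemma refine_charval: assumes "M > 0" "torus_elt n a"
  shows "refine M (charval n x a) = charval n x (\<lambda>i. refine M (a i))"
  unfolding charval_def using assms by (auto simp: refine_prod refine_powi intro!: prod.cong)

section \<open>Monomials, used for the explicit point\<close>

definition fls_mono :: "complex \<Rightarrow> int \<Rightarrow> complex fls" where "fls_mono c k = fls_shift (- k) (fls_const c)"

lemma fls_mono_nth: "fls_nth (fls_mono c k) j = (if j = k then c else 0)" by (simp add: fls_mono_def)

lemma fls_mono_mult: "fls_mono c k * fls_mono d m = fls_mono (c * d) (k + m)"
  by (simp add: fls_mono_def fls_shifted_times_simps fls_const_mult_const add.commute)

lemma fls_mono_1: "fls_mono 1 0 = 1" by (simp add: fls_mono_def)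

lemma fls_mono_power: "fls_mono c k ^ m = fls_mono (c ^ m) (int m * k)"
  by (induction m) (auto simp: fls_mono_1 fls_mono_mult algebra_simps)

lemma fls_mono_inverse: "c \<noteq> 0 \<Longrightarrow> inverse (fls_mono c k) = fls_mono (inverse c) (- k)"
  by (rule inverse_unique) (simp add: fls_mono_mult fls_mono_1)

lemma fls_mono_powi: "c \<noteq> 0 \<Longrightarrow> fls_mono c k powi m = fls_mono (c powi m) (m * k)"
  by (auto simp: power_int_def fls_mono_power fls_mono_inverse)

lemma fls_mono_prod: "finite A \<Longrightarrow> (\<Prod>i\<in>A. fls_mono (f i) (g i)) = fls_mono (\<Prod>i\<in>A. f i) (\<Sum>i\<in>A. g i)"
  by (induction A rule: finite_induct) (auto simp: fls_mono_1 fls_mono_mult)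

lemma fls_mono_nonzero: "c \<noteq> 0 \<Longrightarrow> fls_mono c k \<noteq> 0" by (metis fls_mono_nth fls_zero_nth)

lemma fls_mono_subdegree: "c \<noteq> 0 \<Longrightarrow> fls_subdegree (fls_mono c k) = k"
  by (rule fls_subdegree_eqI) (auto simp: fls_mono_nth)

lemma has_val_fls_mono: "c \<noteq> 0 \<Longrightarrow> has_val N (fls_mono c k) (- real_of_int k / real N)"
  by (simp add: has_val_def fls_mono_subdegree fls_mono_nonzero)

lemma gal_fls_mono: "gal N (fls_mono c k) = fls_mono (exp2pi (of_int k / of_nat N) * c) k"
  by (rule fls_eqI) (auto simp: gal_nth fls_mono_nth gal_root)

context based_root_datum
begin

subsection \<open>Stabilizer elements of the alcove\<close>

text \<open>The pullback of a positive affine root is an affine root, so it has constant sign on the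
  alcove, and the single point \<open>y\<close> decides that sign. The hypothesis covers integral
  translations outside the coroot lattice and maps with linear part \<open>- w\<close>.\<close>

lemma alcove_map_into:
  assumes "\<And>f. f \<in> affine_roots \<Longrightarrow> \<exists>f'\<in>affine_roots. \<forall>v. aval f (g v) = aval f' v"
    and "\<And>v. isvec n v \<Longrightarrow> isvec n (g v)" and "y \<in> C" "g y \<in> C" "v \<in> C"
  shows "g v \<in> C"
proof (rule alcoveI)
  show "isvec n (g v)" using assms isvec_alcove by blast
  fix f assume f: "apos f"
  obtain f' where f': "f' \<in> affine_roots" "\<And>v. aval f (g v) = aval f' v" using assms(1) apos_affine_roots[OF f] by blast
  have "aval f' y > 0" using aval_apos[OF f assms(4)] f'(2) by simp
  hence "apos f'" using apos_or_aneg[OF f'(1)] aval_apos[of "aneg f'" y] assms(3) by force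
  thus "aval f (g v) > 0" using aval_apos[OF _ assms(5)] f'(2) by simp
qed

lemma affine_map_into:
  assumes "w \<in> W" "isvec n t" "y \<in> C" "(\<lambda>j. wR n w y j + of_int (t j)) \<in> C" "v \<in> C"
  shows "(\<lambda>j. wR n w v j + of_int (t j)) \<in> C"
proof (rule alcove_map_into[where g="\<lambda>v. (\<lambda>j. wR n w v j + of_int (t j))", OF _ _ assms(3-5)])
  fix f assume "f \<in> affine_roots"
  thus "\<exists>f'\<in>affine_roots. \<forall>v. aval f (\<lambda>j. wR n w v j + of_int (t j)) = aval f' v"
    using assms(1) by (intro bexI[of _ "(wd w (fst f), pair n (fst f) t + snd f)"])
      (auto simp: aval_def rpair_wR affine_roots_def wd_root)
qed (use assms isvec_wR[OF assms(1)] in \<open>auto simp: isvec_def\<close>)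

lemma neg_affine_map_into:
  assumes "w \<in> W" "isvec n t" "y \<in> C" "(\<lambda>j. - wR n w y j + of_int (t j)) \<in> C" "v \<in> C"
  shows "(\<lambda>j. - wR n w v j + of_int (t j)) \<in> C"
proof (rule alcove_map_into[where g="\<lambda>v. (\<lambda>j. - wR n w v j + of_int (t j))", OF _ _ assms(3-5)])
  fix f assume "f \<in> affine_roots"
  thus "\<exists>f'\<in>affine_roots. \<forall>v. aval f (\<lambda>j. - wR n w v j + of_int (t j)) = aval f' v"
    using assms(1) by (intro bexI[of _ "((\<lambda>j. - wd w (fst f) j), pair n (fst f) t + snd f)"])
      (auto simp: aval_def rpair_wR affine_roots_def wd_root)
qed (use assms isvec_wR[OF assms(1)] in \<open>auto simp: isvec_def\<close>)

text \<open>The condition of \<open>psiG\<close> tested at one point: by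
  \<open>alcove_image_eq\<close>, a single alcove point landing in the alcove already means that the
  alcove is preserved.\<close>

definition alcove_stab :: "lat \<Rightarrow> (lat \<Rightarrow> lat) \<Rightarrow> bool" where
  "alcove_stab t w \<longleftrightarrow> w \<in> W \<and> (\<exists>q\<in>Q. \<exists>y\<in>C. (\<lambda>j. wR n w y j + of_int (t j + q j)) \<in> C)"

lemma alcove_image_eq:
  assumes "w \<in> W" "isvec n t" "y \<in> C" "(\<lambda>j. wR n w y j + of_int (t j)) \<in> C"
  shows "(\<lambda>v. (\<lambda>j. wR n w v j + of_int (t j))) ` C = C"
proof (intro subset_antisym subsetI)
  fix x assume "x \<in> (\<lambda>v. (\<lambda>j. wR n w v j + of_int (t j))) ` C"
  thus "x \<in> C" using affine_map_into[OF assms] by auto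
next
  fix x assume x: "x \<in> C"
  obtain u where u: "u \<in> W" "u \<circ> w = id" "w \<circ> u = id" using weyl_inverse assms by blast
  let ?t = "\<lambda>j. - u t j"
  have inv: "(\<lambda>j. wR n u (\<lambda>j. wR n w v j + of_int (t j)) j + of_int (?t j)) = v" if "isvec n v" for v
    using that u assms by (simp add: wR_simps wR_of_int wR_comp[symmetric] wR_id)
  have inv': "(\<lambda>j. wR n w (\<lambda>j. wR n u v j + of_int (?t j)) j + of_int (t j)) = v" if "isvec n v" for v
  proof -
    have "w (u t) = t" using u(3) by (metis comp_apply id_apply)
    thus ?thesis using that u assms isvec_weyl[OF u(1) assms(2)]
      by (simp add: wR_simps wR_of_int wR_comp[symmetric] wR_id)
  qed
  have "(\<lambda>j. wR n u x j + of_int (?t j)) \<in> C"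
    by (rule affine_map_into[OF u(1) _ assms(4) _ x])
       (use isvec_weyl[OF u(1) assms(2)] inv[OF isvec_alcove[OF assms(3)]] assms(3) in \<open>auto simp: isvec_def\<close>)
  thus "x \<in> (\<lambda>v. (\<lambda>j. wR n w v j + of_int (t j))) ` C"
    using inv'[OF isvec_alcove[OF x]] by (intro image_eqI[where x="\<lambda>j. wR n u x j + of_int (?t j)"]) simp_all
qed

text \<open>Composing one map with the inverse of the other cancels \<open>t\<close> up to an
  element of the coroot lattice. The result is in the affine Weyl group and sends an alcove point
  into the alcove, so freeness applies.\<close>

lemma alcove_stab_unique:
  assumes "isvec n t" "alcove_stab t w1" "alcove_stab t w2" shows "w1 = w2"
proof -
  obtain q1 y1 where 1: "w1 \<in> W" "q1 \<in> Q" "y1 \<in> C" "(\<lambda>j. wR n w1 y1 j + of_int (t j + q1 j)) \<in> C"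
    using assms(2) by (auto simp: alcove_stab_def)
  obtain q2 y2 where 2: "w2 \<in> W" "q2 \<in> Q" "y2 \<in> C" "(\<lambda>j. wR n w2 y2 j + of_int (t j + q2 j)) \<in> C"
    using assms(3) by (auto simp: alcove_stab_def)
  obtain u where u: "u \<in> W" "u \<circ> w2 = id" "w2 \<circ> u = id" using weyl_inverse 2 by blast
  let ?x1 = "\<lambda>j. wR n w1 y1 j + of_int (t j + q1 j)" and ?x2 = "\<lambda>j. wR n w2 y1 j + of_int (t j + q2 j)"
  have x2: "?x2 \<in> C"
    by (rule affine_map_into[OF 2(1) _ 2(3,4) 1(3)]) (use assms(1) isvec_corootlat[OF 2(2)] in \<open>auto simp: isvec_def\<close>)
  let ?g = "w1 \<circ> u"
  have g: "?g \<in> W" using 1 u by (intro weyl_comp)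
  have "?g \<circ> w2 = w1" using u(2) by (simp add: comp_assoc)
  hence gw: "wR n ?g (wR n w2 y1) = wR n w1 y1" using wR_comp[OF g 2(1), of y1] by simp
  \<comment> \<open>Solved from the requirement that \<open>?g\<close> followed by translation by
    \<open>q\<close> sends \<open>?x2\<close> to \<open>?x1\<close>; \<open>t\<close> enters only
    through \<open>?g t - t\<close>.\<close>
  define q where "q = (\<lambda>j. (q1 j - ?g q2 j) - (?g t j - t j))"
  have q: "q \<in> Q" unfolding q_def
    by (rule corootlat_diff[OF corootlat_diff[OF 1(2) corootlat_weyl[OF g 2(2)]] weyl_minus_in_corootlat[OF g]])
  have "isvec n (\<lambda>j. t j + q2 j)" using assms(1) isvec_corootlat[OF 2(2)] by (simp add: isvec_def)
  hence gx: "wR n ?g ?x2 = (\<lambda>j. wR n w1 y1 j + of_int (?g (\<lambda>j. t j + q2 j) j))"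
    using g gw wR_of_int[OF g, of "\<lambda>j. t j + q2 j"] by (simp only: wR_simps)
  have "(\<lambda>j. wR n ?g ?x2 j + of_int (q j)) = ?x1"
    unfolding gx weyl_add[OF g] q_def by (simp add: algebra_simps)
  hence "(\<lambda>j. wR n ?g ?x2 j + of_int (q j)) \<in> C" using 1(4) by simp
  hence "?g = id" using affine_weyl_free(1)[OF g q x2] by blast
  hence "w1 \<circ> u \<circ> w2 = w2" by simp
  thus ?thesis using u(2) by (simp add: comp_assoc)
qed

lemma psiG_eqI: assumes "isvec n t" "alcove_stab t w" shows "psiG n l R cor simple t = w"
proof -
  have iff: "(u \<in> W \<and> (\<exists>q\<in>Q. (\<lambda>v. (\<lambda>j. wR n u v j + real_of_int (t j + q j))) ` C = C)) \<longleftrightarrow> alcove_stab t u" for u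
  proof
    assume "u \<in> W \<and> (\<exists>q\<in>Q. (\<lambda>v. (\<lambda>j. wR n u v j + real_of_int (t j + q j))) ` C = C)"
    then obtain q where q: "u \<in> W" "q \<in> Q" "(\<lambda>v. (\<lambda>j. wR n u v j + real_of_int (t j + q j))) ` C = C" by blast
    obtain y where y: "y \<in> C" by (rule alcove_nonempty)
    hence "(\<lambda>j. wR n u y j + real_of_int (t j + q j)) \<in> C" using q(3) by blast
    thus "alcove_stab t u" using q y unfolding alcove_stab_def by blast
  next
    assume "alcove_stab t u"
    then obtain q y where q: "u \<in> W" "q \<in> Q" "y \<in> C" "(\<lambda>j. wR n u y j + of_int (t j + q j)) \<in> C"
      by (auto simp: alcove_stab_def)
    have "isvec n (\<lambda>j. t j + q j)" using assms(1) isvec_corootlat[OF q(2)] by (simp add: isvec_def)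
    thus "u \<in> W \<and> (\<exists>q\<in>Q. (\<lambda>v. (\<lambda>j. wR n u v j + real_of_int (t j + q j))) ` C = C)"
      using alcove_image_eq[OF q(1) _ q(3,4)] q by blast
  qed
  show ?thesis unfolding psiG_def iff
    by (rule the_equality[where P="alcove_stab t"]) (use assms alcove_stab_unique in blast)+
qed

text \<open>The alcove \<open>- C\<close> is carried back to \<open>C\<close> by some \<open>u\<close>; conjugation by \<open>v \<mapsto> - u v\<close> relates
  the stabilizer elements over \<open>- t\<close> to those over \<open>t\<close>.\<close>

lemma alcove_stab_uminus:
  assumes "isvec n t" "alcove_stab (\<lambda>j. - t j) k"
  shows "\<exists>u\<in>W. \<exists>u'\<in>W. u \<circ> u' = id \<and> u' \<circ> u = id \<and> alcove_stab t (u \<circ> k \<circ> u')"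
proof -
  obtain p y where k: "k \<in> W" "p \<in> Q" "y \<in> C" "(\<lambda>j. wR n k y j + of_int (- t j + p j)) \<in> C"
    using assms(2) by (auto simp: alcove_stab_def)
  define z where "z = (\<lambda>j. wR n k y j + real_of_int (- t j + p j))"
  have zC: "z \<in> C" using k(4) by (simp add: z_def)
  have "rpair n \<alpha> (\<lambda>j. - y j) \<notin> \<int>" if "\<alpha> \<in> R" for \<alpha>
  proof
    assume "rpair n \<alpha> (\<lambda>j. - y j) \<in> \<int>"
    then obtain m where "rpair n \<alpha> (\<lambda>j. - y j) = of_int m" by (rule Ints_cases)
    hence "aval (\<alpha>, m) y = 0" by (simp add: aval_def)
    thus False using aval_alcove_nonzero[of "(\<alpha>, m)" y] that k(3) by (simp add: affine_roots_def)
  qed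
  moreover have "isvec n (\<lambda>j. - y j)" using isvec_alcove[OF k(3)] by (simp add: isvec_def)
  ultimately obtain u q where u: "u \<in> W" "q \<in> Q" "(\<lambda>j. wR n u (\<lambda>j. - y j) j + of_int (q j)) \<in> C"
    using affine_weyl_transitive[of "\<lambda>j. - y j"] by blast
  obtain u' where u': "u' \<in> W" "u' \<circ> u = id" "u \<circ> u' = id" using weyl_inverse u by blast
  define y' where "y' = (\<lambda>j. - wR n u y j + real_of_int (q j))"
  have y'C: "y' \<in> C" using u(3) by (simp add: y'_def wR_simps)
  have z'C: "(\<lambda>j. - wR n u z j + real_of_int (q j)) \<in> C"
    using neg_affine_map_into[OF u(1) isvec_corootlat[OF u(2)] k(3) _ zC] y'C by (simp add: y'_def)
  let ?K = "u \<circ> k \<circ> u'"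
  have K: "?K \<in> W" using u k u' by (intro weyl_comp)
  have "?K \<circ> u = u \<circ> k" using u'(2) by (simp add: comp_assoc)
  hence Ku: "wR n ?K (wR n u y) = wR n u (wR n k y)" using K u k by (metis wR_comp)
  have iq: "isvec n q" and ip: "isvec n p" using isvec_corootlat u(2) k(2) by auto
  hence itp: "isvec n (\<lambda>j. - t j + p j)" using assms(1) by (simp add: isvec_def)
  \<comment> \<open>Solved from the requirement that \<open>?K\<close> followed by translation by
    \<open>t + r\<close> sends \<open>y'\<close> to \<open>- u z + q\<close>, which is in the
    alcove; every bracket lies in the coroot lattice.\<close>
  define r where "r = (\<lambda>j. ((u t j - t j) - u p j) + (q j - ?K q j))"
  have r: "r \<in> Q" unfolding r_def
    by (rule corootlat_add[OF corootlat_diff[OF weyl_minus_in_corootlat[OF u(1)] corootlat_weyl[OF u(1) k(2)]]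
          corootlat_diff[OF u(2) corootlat_weyl[OF K u(2)]]])
  have uz: "wR n u z = (\<lambda>j. wR n u (wR n k y) j + of_int (u (\<lambda>j. - t j + p j) j))"
    unfolding z_def using wR_of_int[OF u(1) itp] by (simp only: wR_simps)
  have um: "u (\<lambda>j. - t j + p j) = (\<lambda>j. - u t j + u p j)"
    using weyl_add[OF u(1), of "\<lambda>j. - t j" p] weyl_scale[OF u(1), of "-1" t] by simp
  have Ky: "wR n ?K y' = (\<lambda>j. - wR n u (wR n k y) j + of_int (?K q j))"
    unfolding y'_def using wR_of_int[OF K iq] Ku by (simp only: wR_simps)
  have "(\<lambda>j. wR n ?K y' j + of_int (t j + r j)) = (\<lambda>j. - wR n u z j + real_of_int (q j))"
    unfolding uz Ky um by (simp add: r_def algebra_simps)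
  hence "(\<lambda>j. wR n ?K y' j + of_int (t j + r j)) \<in> C" using z'C by simp
  hence "alcove_stab t ?K" unfolding alcove_stab_def using K r y'C by blast
  thus ?thesis using u(1) u' by blast
qed

text \<open>The alcove is bounded in every root direction, so a root that is nonzero on
  \<open>T\<close> would leave the interval from 0 to 1 for large \<open>k\<close>.\<close>

lemma alcove_translation_zero:
  assumes y: "y \<in> C" and T: "\<And>k::nat. (\<lambda>j. y j + real k * T j) \<in> C" and a: "\<alpha> \<in> R"
  shows "rpair n \<alpha> T = 0"
proof -
  have P: "rpair n \<alpha> T = 0" if "\<alpha> \<in> Pos" for \<alpha>
  proof (rule ccontr)
    assume "rpair n \<alpha> T \<noteq> 0"
    then obtain k :: nat where "1 < real k * \<bar>rpair n \<alpha> T\<bar>"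
      using reals_Archimedean3[of "\<bar>rpair n \<alpha> T\<bar>"] by auto
    hence k: "1 < \<bar>real k * rpair n \<alpha> T\<bar>" by (simp add: abs_mult)
    have "0 < rpair n \<alpha> y + real k * rpair n \<alpha> T" "rpair n \<alpha> y + real k * rpair n \<alpha> T < 1"
      using alcove_Pos[OF T[of k] that] by auto
    moreover have "0 < rpair n \<alpha> y" "rpair n \<alpha> y < 1" using alcove_Pos[OF y that] by auto
    ultimately show False using k by linarith
  qed
  show ?thesis using P[of \<alpha>] P[of "\<lambda>j. - \<alpha> j"] Pos_or_uminus[OF a] by auto
qed

text \<open>The barycentre of an orbit of the stabilizer element is fixed up to a central translation.\<close>

lemma stabilizer_fixed_point:
  assumes t: "isvec n t"
  shows "\<exists>u\<in>W. \<exists>q\<in>Q. \<exists>x\<in>C. (\<lambda>j. wR n u x j + of_int (t j + q j))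
      = (\<lambda>j. x j + pG n R cor (\<lambda>j. of_int (t j)) j)"
proof -
  obtain y where y: "y \<in> C" by (rule alcove_nonempty)
  let ?y = "\<lambda>j. y j + real_of_int (t j)"
  have iy: "isvec n ?y" using t isvec_alcove[OF y] by (simp add: isvec_def)
  have "rpair n \<alpha> ?y \<notin> \<int>" if "\<alpha> \<in> R" for \<alpha>
  proof
    assume "rpair n \<alpha> ?y \<in> \<int>"
    then obtain m where "rpair n \<alpha> ?y = of_int m" by (rule Ints_cases)
    hence "aval (\<alpha>, pair n \<alpha> t - m) y = 0" by (simp add: aval_def)
    thus False using aval_alcove_nonzero[of "(\<alpha>, pair n \<alpha> t - m)" y] that y by (simp add: affine_roots_def)
  qed
  then obtain u q' where u: "u \<in> W" "q' \<in> Q" "(\<lambda>j. wR n u ?y j + of_int (q' j)) \<in> C"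
    using affine_weyl_transitive[OF iy] by blast
  \<comment> \<open>Turns \<open>u (y + t) + q'\<close> into \<open>u y + t + q\<close>: moving
    \<open>t\<close> past \<open>u\<close> costs only an element of the coroot lattice.\<close>
  define q where "q = (\<lambda>j. (u t j - t j) + q' j)"
  have q: "q \<in> Q" unfolding q_def using u by (intro corootlat_add weyl_minus_in_corootlat)
  define g where "g v = (\<lambda>j. wR n u v j + real_of_int (t j + q j))" for v
  have itq: "isvec n (\<lambda>j. t j + q j)" using t isvec_corootlat[OF q] by (simp add: isvec_def)
  have "wR n u ?y = (\<lambda>j. wR n u y j + of_int (u t j))"
    using wR_of_int[OF u(1) t] by (simp only: wR_simps)
  hence gy: "g y \<in> C" using u(3) by (simp add: g_def q_def add_ac)
  have gC: "g v \<in> C" if "v \<in> C" for v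
    unfolding g_def by (rule affine_map_into[OF u(1) itq y gy[unfolded g_def] that])
  have gk: "(g ^^ k) v \<in> C" if "v \<in> C" for k v
    by (induction k) (use that gC in auto)
  have uk: "u ^^ k \<in> W" for k
  proof (induction k)
    case 0 show ?case unfolding funpow.simps(1) by (rule weyl.weyl_id)
  next
    case (Suc k) thus ?case unfolding funpow.simps(2) by (rule weyl_comp[OF u(1)])
  qed
  obtain m where m: "m > 0" "u ^^ m = id"
  proof -
    have "\<not> inj (\<lambda>k. u ^^ k)"
    proof
      assume "inj (\<lambda>k. u ^^ k)"
      hence "infinite (range (\<lambda>k. u ^^ k))" by (rule range_inj_infinite)
      thus False using uk finite_weyl finite_subset[of "range (\<lambda>k. u ^^ k)" W] by auto
    qed
    then obtain i j where "u ^^ i = u ^^ j" "i \<noteq> j" by (auto simp: inj_def)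
    hence "\<exists>i j. i < j \<and> u ^^ i = u ^^ j" by (metis nat_neq_iff)
    then obtain i j where ij: "i < j" "u ^^ i = u ^^ j" by blast
    obtain v where v: "v \<circ> u ^^ i = id" using weyl_inverse[OF uk] by blast
    have "u ^^ j = u ^^ i \<circ> u ^^ (j - i)" using ij(1) by (simp add: funpow_add[symmetric])
    hence "v \<circ> u ^^ i = v \<circ> u ^^ i \<circ> u ^^ (j - i)" using ij(2) by (simp add: comp_assoc)
    hence "u ^^ (j - i) = id" using v by simp
    thus ?thesis using that[of "j - i"] ij(1) by simp
  qed
  have "\<exists>T. isvec n T \<and> (\<forall>v. isvec n v \<longrightarrow> (g ^^ k) v = (\<lambda>j. wR n (u ^^ k) v j + T j))" for k
  proof (induction k)
    case 0 show ?case by (intro exI[of _ "\<lambda>j. 0"]) (simp add: isvec_def wR_id[unfolded id_def] id_def)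
  next
    case (Suc k)
    then obtain T where T: "isvec n T" "\<And>v. isvec n v \<Longrightarrow> (g ^^ k) v = (\<lambda>j. wR n (u ^^ k) v j + T j)" by blast
    have "(g ^^ Suc k) v = (\<lambda>j. wR n (u ^^ Suc k) v j + (wR n u T j + of_int (t j + q j)))" if "isvec n v" for v
    proof -
      have "wR n (u ^^ Suc k) v = wR n u (wR n (u ^^ k) v)"
        unfolding funpow.simps(2) by (rule wR_comp[OF u(1) uk])
      thus ?thesis using T(2)[OF that] by (simp add: g_def wR_simps add_ac)
    qed
    moreover have "isvec n (\<lambda>j. wR n u T j + of_int (t j + q j))"
      using isvec_wR[OF u(1)] itq by (simp add: isvec_def del: of_int_add)
    ultimately show ?case by blast
  qed
  then obtain T where T: "isvec n T" "\<And>v. isvec n v \<Longrightarrow> (g ^^ m) v = (\<lambda>j. v j + T j)"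
    using m(2) wR_id by metis
  \<comment> \<open>As \<open>u ^^ m = id\<close>, the power \<open>g ^^ m\<close> is translation by
    \<open>T\<close>, and it preserves the alcove. So \<open>T\<close> is killed by every root, that
    is, \<open>W\<close>-invariant.\<close>
  have "(\<lambda>j. y j + real k * T j) \<in> C" for k
  proof (induction k)
    case (Suc k)
    have "(g ^^ m) (\<lambda>j. y j + real k * T j) = (\<lambda>j. y j + real (Suc k) * T j)"
      using T(2)[OF isvec_alcove[OF Suc]] by (simp add: algebra_simps)
    thus ?case using gk[OF Suc, of m] by simp
  qed (simp add: y)
  hence aT: "rpair n \<alpha> T = 0" if "\<alpha> \<in> R" for \<alpha> using alcove_translation_zero[OF y _ that] by blast
  define x where "x = (\<lambda>j. (\<Sum>k<m. (g ^^ k) y j) / real m)"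
  have x: "x \<in> C"
  proof -
    have "isvec n x" unfolding isvec_def x_def
      using isvec_alcove[OF gk[OF y]] by (auto simp: isvec_def)
    moreover have "0 < rpair n \<alpha> x \<and> rpair n \<alpha> x < 1" if "\<alpha> \<in> Pos" for \<alpha>
    proof -
      have e: "rpair n \<alpha> x = (\<Sum>k<m. rpair n \<alpha> ((g ^^ k) y)) / real m" unfolding x_def by simp
      have "(\<Sum>k<m. rpair n \<alpha> ((g ^^ k) y)) > 0"
        using alcove_Pos[OF gk[OF y] that] m(1) by (intro sum_pos) auto
      moreover have "(\<Sum>k<m. rpair n \<alpha> ((g ^^ k) y)) < (\<Sum>k<m. 1)"
        using alcove_Pos[OF gk[OF y] that] m(1) by (intro sum_strict_mono) auto
      ultimately show ?thesis unfolding e using m(1) by simp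
    qed
    ultimately show ?thesis by (simp add: alcove_def)
  qed
  \<comment> \<open>\<open>g\<close> is affine and shifts the orbit sum by one place; the two ends
    differ by \<open>(g ^^ m) y - y = T\<close>.\<close>
  have gx: "g x = (\<lambda>j. x j + T j / real m)"
  proof
    fix j
    have "wR n u x j = (\<Sum>k<m. wR n u ((g ^^ k) y) j) / real m"
      unfolding x_def by (simp only: wR_simps)
    also have "\<dots> = (\<Sum>k<m. (g ^^ Suc k) y j - of_int (t j + q j)) / real m" by (simp add: g_def)
    also have "\<dots> = (\<Sum>k<m. (g ^^ Suc k) y j) / real m - of_int (t j + q j)"
      using m(1) by (simp add: sum_subtractf diff_divide_distrib del: funpow.simps)
    finally have "g x j = (\<Sum>k<m. (g ^^ Suc k) y j) / real m" by (simp add: g_def del: funpow.simps)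
    also have "(\<Sum>k<m. (g ^^ Suc k) y j) = (\<Sum>k<m. (g ^^ k) y j) + ((g ^^ m) y j - y j)"
      using sum_lessThan_telescope[of "\<lambda>k. (g ^^ k) y j" m] by (simp add: sum_subtractf)
    also have "(g ^^ m) y j - y j = T j" using T(2)[OF isvec_alcove[OF y]] by simp
    finally show "g x j = x j + T j / real m" by (simp add: x_def add_divide_distrib)
  qed
  let ?\<nu> = "pG n R cor (\<lambda>j. of_int (t j))"
  have inv: "pG n R cor (\<lambda>j. T j / real m) = (\<lambda>j. T j / real m)"
    using T(1) aT by (intro pG_invariant) (auto simp: isvec_def)
  \<comment> \<open>Computing the average of \<open>g x\<close> in two ways identifies
    \<open>T / m\<close> with the average of \<open>t\<close>: the average forgets \<open>u\<close>
    and \<open>q\<close> and fixes the invariant vector \<open>T / m\<close>.\<close>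
  have "pG n R cor (g x) = (\<lambda>j. pG n R cor x j + T j / real m)" unfolding gx pG_simps inv ..
  moreover have "pG n R cor (g x) = (\<lambda>j. pG n R cor x j + ?\<nu> j)"
    unfolding g_def of_int_add pG_simps pG_weyl[OF u(1)] pG_corootlat[OF q] by simp
  ultimately have "T j / real m = ?\<nu> j" for j by (metis add_left_cancel)
  hence "g x = (\<lambda>j. x j + ?\<nu> j)" using gx by simp
  thus ?thesis using u(1) q x unfolding g_def by blast
qed

end

context adapted_root_datum
begin

subsection \<open>The Galois action\<close>

text \<open>Refining \<open>a\<close> by \<open>M\<close> and \<open>b\<close> by \<open>N\<close>
  puts both over the denominator \<open>N * M\<close>, where the separation theorem compares them in
  one field.\<close>

lemma orbit_sums_eq_imp_conj:
  assumes N: "N > 0" and M: "M > 0" and a: "torus_elt n a" and b: "torus_elt n b"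
    and eq: "pt_eq n (cmap n R cor \<omega> (N, a)) (cmap n R cor \<omega> (M, b))"
  shows "\<exists>w\<in>W. (\<forall>x. refine N (charval n x b) = refine M (charval n (wd w x) a)) \<and>
    refine N (Omega n R b) = refine M (Omega n R a)"
proof -
  define a' b' where "a' = (\<lambda>i. refine M (a i))" and "b' = (\<lambda>i. refine N (b i))"
  have a': "torus_elt n a'" and b': "torus_elt n b'" using a b N M by (auto simp: a'_def b'_def)
  have ca: "charval n x a' = refine M (charval n x a)" and cb: "charval n x b' = refine N (charval n x b)" for x
    using refine_charval a b N M by (auto simp: a'_def b'_def)
  have "(\<Sum>m\<in>worbit n R cor (\<omega> i). charval n m a') = (\<Sum>m\<in>worbit n R cor (\<omega> i). charval n m b')"
    if "i < n" for i
    using eq that N M by (simp add: pt_eq_def cmap_def refine_sum ca cb)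
  then obtain w where w: "w \<in> W" "\<forall>j<n. b' j = wact n w a' j"
    using orbit_sums_separate[OF a' b'] by blast
  have c: "charval n x b' = charval n (wd w x) a'" for x
  proof -
    have "charval n x b' = charval n x (wact n w a')" using w(2) by (intro charval_cong) auto
    thus ?thesis using charval_wact[OF a'] by simp
  qed
  have "refine N (Omega n R b) = Omega n R b'"
    using N by (simp add: Omega_def refine_prod refine_diff refine_1 cb)
  also have "\<dots> = Omega n R (wact n w a')"
    unfolding Omega_def c charval_wact[OF a'] ..
  also have "\<dots> = Omega n R a'" by (rule Omega_wact[OF a' w(1)])
  also have "\<dots> = refine M (Omega n R a)"
    using M by (simp add: Omega_def refine_prod refine_diff refine_1 ca)
  finally show ?thesis using w(1) c by (auto simp: ca cb)
qed

text \<open>The witness \<open>b\<close> is only a refined conjugate of \<open>a\<close>.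
  Conjugation permutes the characters, but \<nu> does not see this because it is
  \<open>W\<close>-invariant.\<close>

lemma has_val_charval_transfer:
  assumes N: "N > 0" and M: "M > 0" and a: "torus_elt n a" and b: "torus_elt n b"
    and eq: "pt_eq n (cmap n R cor \<omega> (N, a)) (cmap n R cor \<omega> (M, b))"
    and inv: "\<And>w. w \<in> W \<Longrightarrow> wR n w \<nu> = \<nu>"
    and val: "\<And>x. isvec n x \<Longrightarrow> has_val M (charval n x b) (rpair n x \<nu>)"
    and x: "isvec n x"
  shows "has_val N (charval n x a) (rpair n x \<nu>)"
proof -
  obtain w where w: "w \<in> W" "\<And>x. refine N (charval n x b) = refine M (charval n (wd w x) a)"
    using orbit_sums_eq_imp_conj[OF N M a b eq] by blast
  obtain u where u: "u \<in> W" "\<And>x. isvec n x \<Longrightarrow> wd w (wd u x) = x" using wd_inverse[OF w(1)] by metis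
  have "has_val M (charval n (wd u x) b) (rpair n (wd u x) \<nu>)" by (rule val) simp
  hence "has_val (M * N) (refine N (charval n (wd u x) b)) (rpair n (wd u x) \<nu>)"
    using has_val_refine N M by blast
  hence "has_val (N * M) (refine M (charval n x a)) (rpair n (wd u x) \<nu>)"
    using w(2) u(2)[OF x] by (simp add: mult.commute)
  hence "has_val N (charval n x a) (rpair n (wd u x) \<nu>)"
    using has_val_refine N M by blast
  thus ?thesis using inv[OF u(1)] by (simp add: rpair_wR[symmetric])
qed

lemma has_val_Omega_transfer:
  assumes N: "N > 0" and M: "M > 0" and a: "torus_elt n a" and b: "torus_elt n b"
    and eq: "pt_eq n (cmap n R cor \<omega> (N, a)) (cmap n R cor \<omega> (M, b))"
    and val: "has_val M (Omega n R b) r"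
  shows "has_val N (Omega n R a) r"
proof -
  have "refine N (Omega n R b) = refine M (Omega n R a)"
    using orbit_sums_eq_imp_conj[OF N M a b eq] by blast
  thus ?thesis using has_val_refine[OF N M] has_val_refine[OF M N] val by (metis mult.commute)
qed

text \<open>Each factor of \<open>Omega\<close> has nonnegative order and the orders add up to 0. So
  every factor is a unit, and its constant term is 1 minus the leading coefficient.\<close>

lemma Omega_unit_imp_regular:
  assumes a: "torus_elt n a"
    and val: "\<And>\<alpha>. \<alpha> \<in> R \<Longrightarrow> fls_subdegree (charval n \<alpha> a) = 0"
    and Om: "Omega n R a \<noteq> 0" "fls_subdegree (Omega n R a) = 0"
    and \<alpha>: "\<alpha> \<in> R"
  shows "lead (charval n \<alpha> a) \<noteq> 1"
proof -
  have nz: "1 - charval n \<beta> a \<noteq> 0" if "\<beta> \<in> R" for \<beta>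
    using Om(1) that by (auto simp: Omega_def)
  have ge: "fls_subdegree (1 - charval n \<beta> a) \<ge> 0" if "\<beta> \<in> R" for \<beta>
    using val[OF that] by (intro fls_subdegree_ge0I) simp
  have "(\<Sum>\<beta>\<in>R. fls_subdegree (1 - charval n \<beta> a)) = 0"
    using Om(2) nz unfolding Omega_def by (subst (asm) fls_subdegree_prod) auto
  hence "fls_subdegree (1 - charval n \<alpha> a) = 0"
    using ge \<alpha> by (subst (asm) sum_nonneg_eq_0_iff) auto
  hence "fls_nth (1 - charval n \<alpha> a) 0 \<noteq> 0" using nz[OF \<alpha>] nth_fls_subdegree_nonzero by metis
  thus ?thesis using val[OF \<alpha>] by (simp add: lead_def)
qed

text \<open>The leading coefficients of \<open>a\<close> are \<open>exp (2 \<pi> i z)\<close>; a generic real combination of the real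
  and imaginary parts of \<open>z\<close> stays off all affine root hyperplanes.\<close>

lemma galois_point_logarithm:
  assumes N: "N > 0" and a: "torus_elt n a" and h: "h \<in> W" and sig: "sigma_eq_w n (N, a) h"
    and \<nu>: "isvec n \<nu>" "\<And>\<alpha>. \<alpha> \<in> R \<Longrightarrow> rpair n \<alpha> \<nu> = 0"
    and val: "\<And>x. isvec n x \<Longrightarrow> has_val N (charval n x a) (rpair n x \<nu>)"
    and Om: "has_val N (Omega n R a) 0"
  obtains x :: rvec and \<mu> :: lat where "isvec n x" "isvec n \<mu>"
    "\<And>\<alpha>. \<alpha> \<in> R \<Longrightarrow> rpair n \<alpha> x \<notin> \<int>" "wR n h x = (\<lambda>j. x j - \<nu> j + of_int (\<mu> j))"
proof -
  have "\<forall>i. \<exists>z. i < n \<longrightarrow> lead (a i) = exp2pi z" using exp2pi_surj lead_nonzero a by metis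
  then obtain z where z: "\<And>i. i < n \<Longrightarrow> lead (a i) = exp2pi (z i)" by metis
  define S where "S \<alpha> = (\<Sum>i<n. of_int (\<alpha> i) * z i)" for \<alpha> :: lat
  have lcS: "lead (\<Prod>i<n. a i powi \<alpha> i) = exp2pi (S \<alpha>)" for \<alpha>
    using a by (simp add: lead_prod lead_powi z exp2pi_powi S_def exp2pi_sum)
  have subN: "real_of_int (fls_subdegree (charval n x a)) = - rpair n x \<nu> * real N" if "isvec n x" for x
    using val[OF that] N by (auto simp: has_val_def field_simps)
  have reg: "S \<alpha> \<notin> \<int>" if "\<alpha> \<in> R" for \<alpha>
  proof -
    have "fls_subdegree (charval n \<beta> a) = 0" if "\<beta> \<in> R" for \<beta>
      using subN[OF isvec_root[OF that]] \<nu>(2)[OF that] by simp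
    hence "lead (charval n \<alpha> a) \<noteq> 1"
      using Om N that by (intro Omega_unit_imp_regular a) (auto simp: has_val_def)
    thus ?thesis by (simp add: charval_def lcS exp2pi_eq_1)
  qed
  have "\<exists>m::int. S (\<lambda>i. h (unitv i) j) = z j - of_real (\<nu> j) + of_int m" if j: "j < n" for j
  proof -
    have "real_of_int (fls_subdegree (a j)) = - \<nu> j * real N"
      using subN[OF isvec_unitv[OF j]] j by (simp add: charval_unitv)
    hence "complex_of_real (real_of_int (fls_subdegree (a j))) = complex_of_real (- \<nu> j * real N)" by simp
    \<comment> \<open>The sign convention for \<open>val\<close> enters here: \<sigma> multiplies
      the leading coefficient of \<open>a j\<close> by exp(-2 pi i \<nu> j).\<close>
    hence sub: "of_int (fls_subdegree (a j)) / of_nat N = - complex_of_real (\<nu> j)"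
      using N by (simp add: field_simps)
    have "exp2pi (S (\<lambda>i. h (unitv i) j)) = lead (gal N (a j))"
      using sig j by (simp add: sigma_eq_w_def wact_def lcS)
    also have "\<dots> = exp2pi (z j - of_real (\<nu> j))"
      using a j by (simp add: lead_gal sub z exp2pi_add[symmetric])
    finally have "S (\<lambda>i. h (unitv i) j) - (z j - of_real (\<nu> j)) \<in> \<int>" by (simp add: exp2pi_eq_iff)
    then obtain m where "S (\<lambda>i. h (unitv i) j) - (z j - of_real (\<nu> j)) = of_int m" by (rule Ints_cases)
    thus ?thesis by (intro exI[of _ m]) (simp add: algebra_simps)
  qed
  then obtain m where m: "\<And>j. j < n \<Longrightarrow> S (\<lambda>i. h (unitv i) j) = z j - of_real (\<nu> j) + of_int (m j)" by metis
  define \<mu> where "\<mu> = (\<lambda>j. if j < n then m j else 0)"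
  \<comment> \<open>\<open>h\<close> is integral, and \<nu> and the integers \<open>m\<close> are
    real. So the real part of \<open>z\<close> solves the equation and the imaginary part solves its
    homogeneous version; every such combination is again a solution.\<close>
  define x where "x \<delta> = (\<lambda>j. if j < n then Re (z j) + \<delta> * Im (z j) else 0)" for \<delta>
  have rx: "rpair n \<alpha> (x \<delta>) = Re (S \<alpha>) + \<delta> * Im (S \<alpha>)" for \<alpha> \<delta>
    unfolding rpair_def S_def x_def by (simp add: algebra_simps sum.distrib sum_distrib_left)
  have bad: "finite {\<delta>\<in>{0<..<1}. rpair n \<alpha> (x \<delta>) \<in> \<int>}" if "\<alpha> \<in> R" for \<alpha>
  proof (cases "Im (S \<alpha>) = 0")
    case True
    have "Re (S \<alpha>) \<notin> \<int>"
    proof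
      assume "Re (S \<alpha>) \<in> \<int>"
      then obtain k where "Re (S \<alpha>) = of_int k" by (rule Ints_cases)
      hence "S \<alpha> = of_int k" using True by (simp add: complex_eq_iff)
      thus False using reg[OF that] by simp
    qed
    thus ?thesis by (simp add: rx True)
  next
    case False
    let ?r = "Re (S \<alpha>)" and ?s = "Im (S \<alpha>)"
    \<comment> \<open>For \<delta> between 0 and 1 the root value stays in a bounded interval, so it
      meets finitely many integers, each at a single \<delta>.\<close>
    have "{\<delta>\<in>{0<..<1}. rpair n \<alpha> (x \<delta>) \<in> \<int>} \<subseteq> (\<lambda>k. (of_int k - ?r) / ?s) ` {\<lfloor>?r - \<bar>?s\<bar>\<rfloor>..\<lceil>?r + \<bar>?s\<bar>\<rceil>}"
    proof
      fix \<delta> assume "\<delta> \<in> {\<delta>\<in>{0<..<1}. rpair n \<alpha> (x \<delta>) \<in> \<int>}"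
      hence d: "0 < \<delta>" "\<delta> < 1" "?r + \<delta> * ?s \<in> \<int>" by (auto simp: rx)
      obtain k where k: "?r + \<delta> * ?s = of_int k" using d(3) by (rule Ints_cases)
      have "\<bar>\<delta> * ?s\<bar> \<le> \<bar>?s\<bar>" using d by (simp add: abs_mult mult_left_le_one_le)
      hence "of_int k \<le> ?r + \<bar>?s\<bar>" "?r - \<bar>?s\<bar> \<le> of_int k" unfolding k[symmetric] by linarith+
      hence "k \<in> {\<lfloor>?r - \<bar>?s\<bar>\<rfloor>..\<lceil>?r + \<bar>?s\<bar>\<rceil>}" by (simp add: floor_le_iff le_ceiling_iff)
      moreover have "\<delta> = (of_int k - ?r) / ?s" using k False by (simp add: field_simps)
      ultimately show "\<delta> \<in> (\<lambda>k. (of_int k - ?r) / ?s) ` {\<lfloor>?r - \<bar>?s\<bar>\<rfloor>..\<lceil>?r + \<bar>?s\<bar>\<rceil>}" by blast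
    qed
    thus ?thesis by (rule finite_subset) simp
  qed
  have "finite (\<Union>\<alpha>\<in>R. {\<delta>\<in>{0<..<1}. rpair n \<alpha> (x \<delta>) \<in> \<int>})" using bad by auto
  moreover have "infinite {0<..<1::real}" by (rule infinite_Ioo) simp
  ultimately have "\<not> {0<..<1} \<subseteq> (\<Union>\<alpha>\<in>R. {\<delta>\<in>{0<..<1}. rpair n \<alpha> (x \<delta>) \<in> \<int>})"
    using finite_subset by blast
  then obtain \<delta> where \<delta>: "\<And>\<alpha>. \<alpha> \<in> R \<Longrightarrow> rpair n \<alpha> (x \<delta>) \<notin> \<int>" by blast
  have "wR n h (x \<delta>) j = x \<delta> j - \<nu> j + of_int (\<mu> j)" for j
  proof (cases "j < n")
    case True
    have "wR n h (x \<delta>) j = rpair n (\<lambda>i. h (unitv i) j) (x \<delta>)" by (simp add: wR_def rpair_def mult.commute)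
    also have "\<dots> = x \<delta> j - \<nu> j + of_int (\<mu> j)" unfolding rx m[OF True] using True by (simp add: x_def \<mu>_def)
    finally show ?thesis .
  next
    case False
    thus ?thesis using isvec_wR[OF h, of "x \<delta>"] \<nu>(1) by (simp add: isvec_def x_def \<mu>_def)
  qed
  hence "wR n h (x \<delta>) = (\<lambda>j. x \<delta> j - \<nu> j + of_int (\<mu> j))" by blast
  moreover have "isvec n (x \<delta>)" "isvec n \<mu>" by (auto simp: isvec_def x_def \<mu>_def)
  ultimately show ?thesis using that \<delta> by blast
qed

lemma frobenius_wconj_psiG:
  assumes lam: "isvec n lam" and h: "h \<in> W" and x: "isvec n x" and \<mu>: "isvec n \<mu>"
    and reg: "\<And>\<alpha>. \<alpha> \<in> R \<Longrightarrow> rpair n \<alpha> x \<notin> \<int>"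
    and hx: "wR n h x = (\<lambda>j. x j - pG n R cor (\<lambda>j. of_int (lam j)) j + of_int (\<mu> j))"
  shows "wconj n R cor h (psiG n l R cor simple lam)"
proof -
  let ?\<nu> = "pG n R cor (\<lambda>j. real_of_int (lam j))"
  \<comment> \<open>Averaging the relation for \<open>h x\<close> cancels \<open>x\<close> and shows
    that \<mu> has average \<nu>, so \<mu> and \<open>lam\<close> agree modulo the coroot
    lattice.\<close>
  have "pG n R cor (wR n h x) = pG n R cor x" by (rule pG_weyl[OF h])
  moreover have "pG n R cor ?\<nu> = ?\<nu>" by (rule pG_invariant) (auto simp: rpair_root_pG)
  ultimately have "pG n R cor (\<lambda>j. of_int (\<mu> j)) j = ?\<nu> j" for j
    unfolding hx pG_simps by (auto simp: fun_eq_iff dest: spec[of _ j])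
  hence "pG n R cor (\<lambda>j. of_int (\<mu> j - lam j)) = (\<lambda>j. 0)" unfolding of_int_diff pG_simps by simp
  hence d: "(\<lambda>j. \<mu> j - lam j) \<in> Q" using lam \<mu> by (intro pG_kernel) (auto simp: isvec_def)
  obtain u q where u: "u \<in> W" "q \<in> Q" "(\<lambda>j. wR n u x j + of_int (q j)) \<in> C"
    using affine_weyl_transitive[OF x reg] by blast
  obtain u' where u': "u' \<in> W" "u' \<circ> u = id" "u \<circ> u' = id" using weyl_inverse u by blast
  define y where "y = (\<lambda>j. wR n u x j + real_of_int (q j))"
  have yC: "y \<in> C" using u(3) by (simp add: y_def)
  let ?k = "u \<circ> h \<circ> u'"
  have k: "?k \<in> W" using u h u' by (intro weyl_comp)
  have "?k \<circ> u = u \<circ> h" using u'(2) by (simp add: comp_assoc)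
  hence ku: "wR n ?k (wR n u x) = wR n u (wR n h x)"
    using wR_comp[OF k u(1), of x] wR_comp[OF u(1) h, of x] by simp
  have uhx: "wR n u (wR n h x) = (\<lambda>j. wR n u x j - ?\<nu> j + of_int (u \<mu> j))"
    unfolding hx wR_simps wR_pG[OF u(1)] wR_of_int[OF u(1) \<mu>] ..
  have ky: "wR n ?k y = (\<lambda>j. wR n u x j - ?\<nu> j + of_int (u \<mu> j) + of_int (?k q j))"
    unfolding y_def wR_simps ku uhx wR_of_int[OF k isvec_corootlat[OF u(2)]] ..
  \<comment> \<open>Solved from the requirement that \<open>?k\<close> followed by translation by
    \<open>- lam + r\<close> sends \<open>y\<close> to \<open>y - \<nu>\<close>. That point is still
    in the alcove, because every root vanishes on \<nu>.\<close>
  define r where "r = (\<lambda>j. (q j - ?k q j) - ((u \<mu> j - \<mu> j) + (\<mu> j - lam j)))"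
  have r: "r \<in> Q" unfolding r_def
    by (rule corootlat_diff[OF corootlat_diff[OF u(2) corootlat_weyl[OF k u(2)]]
          corootlat_add[OF weyl_minus_in_corootlat[OF u(1)] d]])
  have e: "(\<lambda>j. wR n ?k y j + of_int (- lam j + r j)) = (\<lambda>j. y j - ?\<nu> j)"
    unfolding ky by (simp add: r_def y_def algebra_simps)
  have "isvec n (\<lambda>j. y j - ?\<nu> j)" using isvec_alcove[OF yC] isvec_pG by (simp add: isvec_def)
  hence "(\<lambda>j. y j - ?\<nu> j) \<in> C"
    using alcove_Pos[OF yC] rpair_root_pG Pos_R by (simp add: alcove_def)
  hence "alcove_stab (\<lambda>j. - lam j) ?k" unfolding alcove_stab_def using k r yC e by metis
  then obtain v v' where v: "v \<in> W" "v' \<in> W" "v \<circ> v' = id" "v' \<circ> v = id" "alcove_stab lam (v \<circ> ?k \<circ> v')"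
    using alcove_stab_uminus[OF lam] by blast
  have "psiG n l R cor simple lam = v \<circ> ?k \<circ> v'" by (rule psiG_eqI[OF lam v(5)])
  moreover have "h \<circ> (u' \<circ> v') = (u' \<circ> v') \<circ> (v \<circ> ?k \<circ> v')"
    by (rule ext) (simp add: fun_cong[OF u'(2), simplified] fun_cong[OF v(4), simplified])
  moreover have "u' \<circ> v' \<in> W" using u' v by (intro weyl_comp)
  ultimately show ?thesis unfolding wconj_def by metis
qed

lemma exists_in_X_nu:
  assumes lam: "isvec n lam"
  defines "\<nu> \<equiv> pG n R cor (\<lambda>j. real_of_int (lam j))"
  shows "\<exists>c. in_X_nu n R cor \<omega> \<nu> c"
proof -
  obtain u q x where u: "u \<in> W" "q \<in> Q" "x \<in> C"
    and ux: "(\<lambda>j. wR n u x j + of_int (lam j + q j)) = (\<lambda>j. x j + \<nu> j)"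
    using stabilizer_fixed_point[OF lam] unfolding \<nu>_def by blast
  \<comment> \<open>The order of \<open>W\<close> clears the denominator of the average, so
    \<open>N * \<nu>\<close> is the integral vector \<open>k\<close>.\<close>
  define N where "N = card W"
  have N: "N > 0" unfolding N_def by (rule card_W_pos)
  define k where "k j = (\<Sum>w\<in>W. w lam j)" for j
  have \<nu>k: "\<nu> j = of_int (k j) / real N" for j
    unfolding \<nu>_def pG_def k_def N_def using lam by (simp add: wR_of_int)
  have rk: "real_of_int (pair n y k) = real N * rpair n y \<nu>" for y
  proof -
    have "\<nu> = (\<lambda>j. of_int (k j) / real N)" using \<nu>k by blast
    thus ?thesis using N by simp
  qed
  \<comment> \<open>The exponent \<open>- k j\<close> over \<open>N\<close> gives value \<nu> j. The
    minus sign before \<open>x j\<close> matches \<open>u x = x + \<nu>\<close> modulo integers with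
    the factor exp(-2 pi i \<nu> j) produced by \<sigma>, so here no passage from \<nu> to its
    negative is needed.\<close>
  define a where "a j = fls_mono (exp2pi (- of_real (x j))) (- k j)" for j
  have a: "torus_elt n a" by (simp add: a_def fls_mono_nonzero)
  have ch: "charval n y a = fls_mono (exp2pi (- of_real (rpair n y x))) (- pair n y k)" for y
  proof -
    have "charval n y a = fls_mono (\<Prod>i<n. exp2pi (of_int (y i) * - of_real (x i))) (\<Sum>i<n. y i * - k i)"
      unfolding charval_def a_def by (simp add: fls_mono_powi exp2pi_powi fls_mono_prod)
    also have "(\<Prod>i<n. exp2pi (of_int (y i) * - of_real (x i))) = exp2pi (- of_real (rpair n y x))"
      by (simp add: exp2pi_sum[symmetric] rpair_def sum_negf)
    finally show ?thesis by (simp add: pair_def sum_negf)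
  qed
  have val: "has_val N (charval n y a) (rpair n y \<nu>)" for y
    using has_val_fls_mono[of "exp2pi (- of_real (rpair n y x))" N "- pair n y k"] rk[of y] N by (simp add: ch)
  have sig: "sigma_eq_w n (N, a) u"
    unfolding sigma_eq_w_def
  proof (intro allI impI)
    fix j assume j: "j < n"
    have inv: "wR n u \<nu> = \<nu>" unfolding \<nu>_def by (rule wR_pG[OF u(1)])
    have "real_of_int (pair n (wd u (unitv j)) k) = real N * rpair n (unitv j) (wR n u \<nu>)"
      by (simp add: rk rpair_wR)
    also have "\<dots> = real_of_int (k j)" using inv j N by (simp add: \<nu>k)
    finally have pk: "pair n (wd u (unitv j)) k = k j" by simp
    have "rpair n (wd u (unitv j)) x = wR n u x j" using j by (simp add: rpair_wR[symmetric])
    also have "\<dots> = x j + \<nu> j - of_int (lam j + q j)" using fun_cong[OF ux, of j] by simp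
    finally have px: "rpair n (wd u (unitv j)) x = x j + \<nu> j - of_int (lam j + q j)" .
    have "wact n u a j = charval n (unitv j) (wact n u a)" using j by (simp add: charval_unitv)
    also have "\<dots> = fls_mono (exp2pi (- of_real (x j + \<nu> j - of_int (lam j + q j)))) (- k j)"
      unfolding charval_wact[OF a] ch pk px ..
    \<comment> \<open>The integral part \<open>lam + q\<close> of the translation disappears under
      the exponential.\<close>
    also have "exp2pi (- of_real (x j + \<nu> j - of_int (lam j + q j))) = exp2pi (- of_real (\<nu> j) + - of_real (x j))"
      unfolding exp2pi_eq_iff by (simp del: of_int_add)
    also have "\<dots> = exp2pi (of_int (- k j) / of_nat N) * exp2pi (- of_real (x j))"
      unfolding exp2pi_add by (simp add: \<nu>k)
    finally have e: "wact n u a j = fls_mono (exp2pi (of_int (- k j) / of_nat N) * exp2pi (- of_real (x j))) (- k j)" .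
    show "gal (fst (N, a)) (snd (N, a) j) = wact n u (snd (N, a)) j"
      by (simp add: e) (simp add: a_def gal_fls_mono)
  qed
  have root: "1 - charval n \<alpha> a = fls_const (1 - exp2pi (- of_real (rpair n \<alpha> x)))" if "\<alpha> \<in> R" for \<alpha>
  proof -
    have "pair n \<alpha> k = 0" using rk[of \<alpha>] rpair_root_pG[OF that] by (simp add: \<nu>_def)
    thus ?thesis by (simp add: ch fls_mono_def fls_minus_const[symmetric] fls_const_1[symmetric] del: fls_const_1)
  qed
  have nz: "1 - exp2pi (- of_real (rpair n \<alpha> x)) \<noteq> 0" if "\<alpha> \<in> R" for \<alpha>
  proof
    assume "1 - exp2pi (- of_real (rpair n \<alpha> x)) = 0"
    hence "- complex_of_real (rpair n \<alpha> x) \<in> \<int>" by (simp add: exp2pi_eq_1[symmetric])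
    then obtain m where "- complex_of_real (rpair n \<alpha> x) = of_int m" by (rule Ints_cases)
    hence "Re (- complex_of_real (rpair n \<alpha> x)) = Re (of_int m)" by simp
    hence "aval (\<alpha>, m) x = 0" by (simp add: aval_def)
    thus False using aval_alcove_nonzero[of "(\<alpha>, m)" x] u(3) that by (simp add: affine_roots_def)
  qed
  have "Omega n R a = fls_const (\<Prod>\<alpha>\<in>R. 1 - exp2pi (- of_real (rpair n \<alpha> x)))"
  proof -
    have "(\<Prod>\<alpha>\<in>A. fls_const (f \<alpha>)) = fls_const (\<Prod>\<alpha>\<in>A. f \<alpha> :: complex)" for A :: "lat set" and f
      by (induction A rule: infinite_finite_induct) (auto simp: fls_const_mult_const)
    thus ?thesis unfolding Omega_def using root by simp
  qed
  moreover have "(\<Prod>\<alpha>\<in>R. 1 - exp2pi (- of_real (rpair n \<alpha> x))) \<noteq> 0" using nz by simp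
  moreover have "m_nu n R \<nu> = 0" unfolding m_nu_def \<nu>_def using rpair_root_pG by simp
  ultimately have Om: "has_val N (Omega n R a) (m_nu n R \<nu>)"
    by (simp add: has_val_def fls_const_nonzero)
  have tp: "is_torus_pt n (N, a)" using a N by (simp add: is_torus_pt_def)
  have "in_X_nu n R cor \<omega> \<nu> (cmap n R cor \<omega> (N, a))"
    unfolding in_X_nu_def in_AF_nu_def
    using tp sig u(1) val Om N by (intro conjI exI[of _ "(N, a)"]) (auto simp: cmap_def pt_eq_def)
  thus ?thesis by blast
qed

lemma in_X_nu_wconj:
  assumes lam: "isvec n lam" and p: "is_torus_pt n p"
    and X: "in_X_nu n R cor \<omega> (pG n R cor (\<lambda>j. real_of_int (lam j))) (cmap n R cor \<omega> p)"
    and h: "h \<in> W" and sig: "sigma_eq_w n p h"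
  shows "wconj n R cor h (psiG n l R cor simple lam)"
proof -
  let ?\<nu> = "pG n R cor (\<lambda>j. real_of_int (lam j))"
  obtain N a where pa: "p = (N, a)" by (cases p)
  have N: "N > 0" and a: "torus_elt n a" using p by (auto simp: pa is_torus_pt_def)
  \<comment> \<open>\<open>b\<close> supplies the valuations and \<open>d\<close> below supplies the
    order of \<open>Omega\<close>; both are then transferred to \<open>a\<close>.\<close>
  obtain M b where b: "is_torus_pt n (M, b)" "pt_eq n (cmap n R cor \<omega> p) (cmap n R cor \<omega> (M, b))"
    "\<And>x. isvec n x \<Longrightarrow> has_val M (charval n x b) (rpair n x ?\<nu>)"
    using X unfolding in_X_nu_def in_AF_nu_def by (metis fst_conv snd_conv surj_pair)
  obtain L d where d: "is_torus_pt n (L, d)" "pt_eq n (cmap n R cor \<omega> p) (cmap n R cor \<omega> (L, d))"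
    "has_val L (Omega n R d) (m_nu n R ?\<nu>)"
    using X unfolding in_X_nu_def by (metis fst_conv snd_conv surj_pair)
  have val: "has_val N (charval n x a) (rpair n x ?\<nu>)" if "isvec n x" for x
    using has_val_charval_transfer[OF N _ a _ _ wR_pG b(3) that] b(1,2) by (simp add: pa is_torus_pt_def)
  have "m_nu n R ?\<nu> = 0" unfolding m_nu_def using rpair_root_pG by simp
  hence Om: "has_val N (Omega n R a) 0"
    using has_val_Omega_transfer[OF N _ a _ _ d(3)] d(1,2) by (simp add: pa is_torus_pt_def)
  obtain x \<mu> where "isvec n x" "isvec n \<mu>" "\<And>\<alpha>. \<alpha> \<in> R \<Longrightarrow> rpair n \<alpha> x \<notin> \<int>"
    "wR n h x = (\<lambda>j. x j - ?\<nu> j + of_int (\<mu> j))"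
    using galois_point_logarithm[OF N a h sig[unfolded pa] isvec_pG rpair_root_pG val Om] by metis
  thus ?thesis using frobenius_wconj_psiG[OF lam h] by blast
qed

end

theorem theorem2p6:
  fixes n l :: nat and R :: "lat set" and cor :: "lat \<Rightarrow> lat"
    and simple \<omega> :: "nat \<Rightarrow> lat" and lam :: lat
  assumes "root_datum_with_base n l R cor simple"
    and "adapted_basis n l cor simple \<omega>"
    and "isvec n lam"
  defines "\<nu> \<equiv> pG n R cor (\<lambda>j. real_of_int (lam j))"
  shows "(\<exists>c. in_X_nu n R cor \<omega> \<nu> c) \<and>
    (\<forall>a h. is_torus_pt n a \<longrightarrow> in_X_nu n R cor \<omega> \<nu> (cmap n R cor \<omega> a) \<longrightarrow>
       h \<in> weyl n R cor \<longrightarrow> sigma_eq_w n a h \<longrightarrow>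
       wconj n R cor h (psiG n l R cor simple lam))"
proof -
  interpret adapted_root_datum n l R cor simple \<omega>
    by unfold_locales (fact assms)+
  show ?thesis unfolding \<nu>_def
    using exists_in_X_nu[OF assms(3)] in_X_nu_wconj[OF assms(3)] by blast
qed

end
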